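(* Let $\mathscr H$ be a real separable Hilbert space, $q,t\in\mathbb R$ with $|q|<t\le1$, and for $h\in\mathscr H$ let $s_{q,t}(h):=a_{q,t}(h)+a_{q,t}(h)^\ast\in\mathscr B(\mathscr F_{q,t})$ (the $(q,t)$-Gaussian element). Then $s_{q,t}(h)$ is self-adjoint and, for all $n\in\mathbb N$, $$\varphi_{q,t}(s_{q,t}(h)^{2n-1})=0,$$ $$\varphi_{q,t}(s_{q,t}(h)^{2n})=\|h\|_{\mathscr H}^{2n}\sum_{\mathscr V\in\mathscr P_2(2n)}q^{\mathrm{cross}(\mathscr V)}t^{\mathrm{nest}(\mathscr V)}=\|h\|_{\mathscr H}^{2n}\,[z^n]\,\cfrac{1}{1-\cfrac{[1]_{q,t}z}{1-\cfrac{[2]_{q,t}z}{1-\cfrac{[3]_{q,t}z}{\ldots}}}},$$ where $[z^n](\cdot)$ denotes the coefficient of $z^n$ in the power series expansion of $(\cdot)$ and $[n]_{q,t}:=\sum_{i=1}^nq^{i-1}t^{n-i}=\frac{t^n-q^n}{t-q}$. Furthermore, if $\|e\|_{\mathscr H}=1$, the distribution of $s_{q,t}(e)$ (with respect to $\varphi_{q,t}$) is the unique probability measure on $\mathbb R$ that orthogonalizes the $(q,t)$-Hermite polynomial sequence $\{H_n(z;q,t)\}_{n\ge0}$ given by $H_0(z;q,t)=1$, $H_1(z;q,t)=z$ and $$zH_n(z;q,t)=H_{n+1}(z;q,t)+[n]_{q,t}H_{n-1}(z;q,t)\qquad(n\ge1).$$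
   Context: $\mathscr H_{\mathbb C}$ is the complexification of $\mathscr H$, with inner product extended to be conjugate-linear in the first and linear in the second argument. $\mathscr F=\mathbb C\Omega\oplus\bigoplus_{n\ge1}\mathscr H_{\mathbb C}^{\otimes n}$ (algebraic direct sum and tensor products), $\Omega$ a distinguished unit vector; $\langle\cdot,\cdot\rangle_0$ is the usual full Fock space inner product on $\mathscr F$. For $\pi\in S_n$, $\mathrm{inv}(\pi)$ is the number of pairs $i<j$ with $\pi(i)>\pi(j)$, $\mathrm{cinv}(\pi)$ the number of pairs $i<j$ with $\pi(i)<\pi(j)$, and $U_\pi^{(n)}h_1\otimes\cdots\otimes h_n=h_{\pi(1)}\otimes\cdots\otimes h_{\pi(n)}$. Put $P_{q,t}=\bigoplus_{n\ge0}P_{q,t}^{(n)}$, $P_{q,t}^{(n)}=\sum_{\pi\in S_n}q^{\mathrm{inv}(\pi)}t^{\mathrm{cinv}(\pi)}U^{(n)}_\pi$ (identity for $n=0$) and $\langle\eta,\xi\rangle_{q,t}=\langle\eta,P_{q,t}\xi\rangle_0$, an inner product on $\mathscr F$ when $|q|<t$. The $(q,t)$-Fock space $\mathscr F_{q,t}$ is the completion of $\mathscr F$ for $\langle\cdot,\cdot\rangle_{q,t}$. For $f\in\mathscr H$, $a_{q,t}(f)^\ast$ and $a_{q,t}(f)$ are the linear operators (bounded on $\mathscr F_{q,t}$ and mutually adjoint for $|q|<t\le1$) with $a_{q,t}(f)^\ast\Omega=f$, $a_{q,t}(f)^\ast h_1\otimes\cdots\otimes h_n=f\otimes h_1\otimes\cdots\otimes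 h_n$, $a_{q,t}(f)\Omega=0$, $a_{q,t}(f)h_1\otimes\cdots\otimes h_n=\sum_{k=1}^nq^{k-1}t^{n-k}\langle f,h_k\rangle_{\mathscr H}h_1\otimes\cdots\otimes\breve h_k\otimes\cdots\otimes h_n$ ($\breve h_k$: deleted). The vacuum state is $\varphi_{q,t}(b)=\langle\Omega,b\Omega\rangle_{q,t}$. The distribution of a bounded self-adjoint $s$ is the probability measure $\mu$ on $\mathbb R$ with $\int x^n\,d\mu=\varphi_{q,t}(s^n)$ for all $n\ge0$. A measure $\mu$ orthogonalizes $\{H_n\}$ if $\int H_mH_n\,d\mu=0$ for $m\ne n$. $\mathscr P_2(2n)$ is the set of pair partitions of $\{1,\dots,2n\}$. For $\mathscr V=\{(w_1,z_1),\dots,(w_n,z_n)\}$ with $w_i<z_i$: $\mathrm{cross}(\mathscr V)$ is the number of pairs of blocks with $w_i<w_j<z_i<z_j$, $\mathrm{nest}(\mathscr V)$ the number of pairs of blocks with $w_i<w_j<z_j<z_i$. Convention: $0^0=1$. The continued fraction is understood as a formal power series in $z$. *)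

theory Defs
  imports
    "HOL-Probability.Probability"
    "HOL-Computational_Algebra.Formal_Power_Series"
    "HOL-Computational_Algebra.Polynomial"
    "HOL-Combinatorics.Permutations"
    "HOL-Library.Poly_Mapping"
    "HOL-Library.Disjoint_Sets"
begin

section \<open>The complexification of a real inner product space\<close>

text \<open>The pair \<open>(x, y)\<close> stands for \<open>x + i y\<close>. Addition is that of the product type; the product
  type's own real inner product is not used.\<close>

type_synonym 'a cplx = "'a \<times> 'a"

definition cplx_of :: "'a::real_inner \<Rightarrow> 'a cplx" where
  "cplx_of x = (x, 0)"

definition cplx_scale :: "complex \<Rightarrow> 'a::real_inner cplx \<Rightarrow> 'a cplx" where
  "cplx_scale c u = (Re c *\<^sub>R fst u - Im c *\<^sub>R snd u, Im c *\<^sub>R fst u + Re c *\<^sub>R snd u)"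

definition cplx_inner :: "'a::real_inner cplx \<Rightarrow> 'a cplx \<Rightarrow> complex" where
  "cplx_inner u v = Complex (fst u \<bullet> fst v + snd u \<bullet> snd v) (fst u \<bullet> snd v - snd u \<bullet> fst v)"

lemma cplx_inner_add_right: "cplx_inner u (x + y) = cplx_inner u x + cplx_inner u y"
  by (simp add: cplx_inner_def complex_eq_iff inner_add_right)

lemma cplx_inner_scale_right: "cplx_inner u (cplx_scale c x) = c * cplx_inner u x"
  by (simp add: cplx_inner_def cplx_scale_def complex_eq_iff inner_add_right inner_diff_right
      algebra_simps)

lemma cplx_inner_commute: "cplx_inner u v = cnj (cplx_inner v u)"
  by (simp add: cplx_inner_def complex_eq_iff inner_commute)

lemma cplx_inner_of [simp]: "cplx_inner (cplx_of f) (cplx_of g) = complex_of_real (f \<bullet> g)"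
  by (simp add: cplx_inner_def cplx_of_def complex_eq_iff)


section \<open>The algebraic Fock space\<close>

text \<open>The direct sum over \<open>n\<close> of the \<open>n\<close>-fold algebraic tensor powers is the free complex vector
  space on all finite words, divided by the multilinearity relations. The empty word gives
  \<open>\<Omega>\<close>.\<close>

type_synonym 'a free = "'a cplx list \<Rightarrow>\<^sub>0 complex"

definition free_scale :: "complex \<Rightarrow> 'a free \<Rightarrow> 'a free" where
  "free_scale c p = Poly_Mapping.map (\<lambda>a. c * a) p"

lemma lookup_free_scale [simp]:
  "Poly_Mapping.lookup (free_scale c p) w = c * Poly_Mapping.lookup p w"
  by (simp add: free_scale_def map.rep_eq when_def)

interpretation free: vector_space free_scale
  by unfold_locales (auto intro!: poly_mapping_eqI simp: lookup_add algebra_simps)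

lemma free_scale_single [simp]:
  "free_scale c (Poly_Mapping.single w a) = Poly_Mapping.single w (c * a)"
  by (simp add: free_scale_def map_single)

inductive_set multilinear_relations :: "'a::real_inner free set" where
  add: "i < length w \<Longrightarrow> Poly_Mapping.single (w[i := x + y]) 1
          - Poly_Mapping.single (w[i := x]) 1 - Poly_Mapping.single (w[i := y]) 1
          \<in> multilinear_relations"
| scale: "i < length w \<Longrightarrow> Poly_Mapping.single (w[i := cplx_scale c x]) 1
            - Poly_Mapping.single (w[i := x]) c \<in> multilinear_relations"

definition fock_rel :: "'a::real_inner free \<Rightarrow> 'a free \<Rightarrow> bool" where
  "fock_rel p r \<longleftrightarrow> p - r \<in> free.span multilinear_relations"

lemma fock_rel_add: "fock_rel p p' \<Longrightarrow> fock_rel r r' \<Longrightarrow> fock_rel (p + r) (p' + r')"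
  unfolding fock_rel_def
  by (drule (1) free.span_add) (simp add: algebra_simps)

lemma fock_rel_scale: "fock_rel p p' \<Longrightarrow> fock_rel (free_scale c p) (free_scale c p')"
  unfolding fock_rel_def
  by (drule free.span_scale[of _ _ c]) (simp add: free.scale_right_diff_distrib)

lemma fock_rel_refl: "fock_rel p p"
  by (simp add: fock_rel_def free.span_zero)

lemma fock_rel_sym: "fock_rel p r \<Longrightarrow> fock_rel r p"
  unfolding fock_rel_def by (drule free.span_neg) simp

lemma fock_rel_trans: "fock_rel p r \<Longrightarrow> fock_rel r s \<Longrightarrow> fock_rel p s"
  unfolding fock_rel_def by (drule (1) free.span_add) simp

lemma fock_rel_minus: "fock_rel p p' \<Longrightarrow> fock_rel (- p) (- p')"
  using fock_rel_scale[of p p' "-1"] by simp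

lemma fock_rel_diff: "fock_rel p p' \<Longrightarrow> fock_rel r r' \<Longrightarrow> fock_rel (p - r) (p' - r')"
  using fock_rel_add[of p p' "- r" "- r'"] fock_rel_minus[of r r'] by simp

lemma fock_rel_sum:
  "(\<And>k. k \<in> A \<Longrightarrow> fock_rel (f k) (g k)) \<Longrightarrow> fock_rel (\<Sum>k\<in>A. f k) (\<Sum>k\<in>A. g k)"
  by (induction A rule: infinite_finite_induct) (auto intro: fock_rel_refl fock_rel_add)

lemma fock_rel_single_add:
  assumes "i < length w"
  shows "fock_rel (Poly_Mapping.single (w[i := x + y]) a)
           (Poly_Mapping.single (w[i := x]) a + Poly_Mapping.single (w[i := y]) a)"
proof -
  have "fock_rel (Poly_Mapping.single (w[i := x + y]) 1)
          (Poly_Mapping.single (w[i := x]) 1 + Poly_Mapping.single (w[i := y]) 1)"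
    unfolding fock_rel_def
    using free.span_base[OF multilinear_relations.add[OF assms, of x y]]
    by (simp add: diff_diff_eq)
  from fock_rel_scale[OF this, of a] show ?thesis
    by (simp add: free.scale_right_distrib)
qed

lemma fock_rel_single_scale:
  assumes "i < length w"
  shows "fock_rel (Poly_Mapping.single (w[i := cplx_scale c x]) a)
           (Poly_Mapping.single (w[i := x]) (c * a))"
proof -
  have "fock_rel (Poly_Mapping.single (w[i := cplx_scale c x]) 1)
          (Poly_Mapping.single (w[i := x]) c)"
    unfolding fock_rel_def
    by (rule free.span_base) (rule multilinear_relations.scale[OF assms])
  from fock_rel_scale[OF this, of a] show ?thesis
    by (simp add: mult.commute)
qed

quotient_type (overloaded) 'a fock = "'a::real_inner free" / fock_rel
  by (intro equivpI reflpI sympI transpI)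
    (blast intro: fock_rel_refl fock_rel_sym fock_rel_trans)+

instantiation fock :: (real_inner) ab_group_add
begin

lift_definition zero_fock :: "'a fock" is 0 .
lift_definition plus_fock :: "'a fock \<Rightarrow> 'a fock \<Rightarrow> 'a fock" is "(+)"
  by (rule fock_rel_add)
lift_definition minus_fock :: "'a fock \<Rightarrow> 'a fock \<Rightarrow> 'a fock" is "(-)"
  by (rule fock_rel_diff)
lift_definition uminus_fock :: "'a fock \<Rightarrow> 'a fock" is uminus
  by (rule fock_rel_minus)

instance
  by standard (transfer, simp add: algebra_simps fock_rel_refl)+

end

lift_definition fock_scale :: "complex \<Rightarrow> 'a::real_inner fock \<Rightarrow> 'a fock" is free_scale
  by (rule fock_rel_scale)

interpretation fock: vector_space fock_scale
  by unfold_locales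
    (transfer, simp add: free.scale_right_distrib free.scale_left_distrib fock_rel_refl)+

lift_definition tensor :: "'a::real_inner cplx list \<Rightarrow> 'a fock" is
  "\<lambda>w. Poly_Mapping.single w 1" .

abbreviation vacuum :: "'a::real_inner fock" where
  "vacuum \<equiv> tensor []"

lemma tensor_add:
  "i < length w \<Longrightarrow> tensor (w[i := x + y]) = tensor (w[i := x]) + tensor (w[i := y])"
  by transfer (rule fock_rel_single_add)

lemma tensor_scale:
  "i < length w \<Longrightarrow> tensor (w[i := cplx_scale c x]) = fock_scale c (tensor (w[i := x]))"
  by transfer (use fock_rel_single_scale[where a = 1] in simp)


subsection \<open>Linear extension from words\<close>

definition free_extend :: "('a cplx list \<Rightarrow> 'a free) \<Rightarrow> 'a free \<Rightarrow> 'a free" where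
  "free_extend F p =
     (\<Sum>w\<in>Poly_Mapping.keys p. free_scale (Poly_Mapping.lookup p w) (F w))"

lemma free_extend_superset:
  assumes "finite A" "Poly_Mapping.keys p \<subseteq> A"
  shows "free_extend F p = (\<Sum>w\<in>A. free_scale (Poly_Mapping.lookup p w) (F w))"
  unfolding free_extend_def
  by (rule sum.mono_neutral_left) (use assms in \<open>auto simp: in_keys_iff\<close>)

lemma free_extend_diff: "free_extend F (p - r) = free_extend F p - free_extend F r"
proof -
  let ?A = "Poly_Mapping.keys p \<union> Poly_Mapping.keys r"
  have "Poly_Mapping.keys (p - r) \<subseteq> ?A"
    by (auto simp: in_keys_iff lookup_minus)
  then show ?thesis
    by (simp add: free_extend_superset[of ?A] lookup_minus free.scale_left_diff_distrib
        sum_subtractf)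
qed

lemma free_extend_scale: "free_extend F (free_scale c p) = free_scale c (free_extend F p)"
proof -
  have "Poly_Mapping.keys (free_scale c p) \<subseteq> Poly_Mapping.keys p"
    by (auto simp: in_keys_iff)
  then show ?thesis
    by (simp add: free_extend_superset[of "Poly_Mapping.keys p"] free.scale_sum_right)
qed

lemma free_extend_add: "free_extend F (p + r) = free_extend F p + free_extend F r"
  using free_extend_diff[of F p "- r"] free_extend_scale[of F "-1" r] by simp

lemma free_extend_single [simp]:
  "free_extend F (Poly_Mapping.single w a) = free_scale a (F w)"
  by (simp add: free_extend_superset[of "{w}"])

lemma free_extend_respects:
  assumes add: "\<And>w i x y. i < length w \<Longrightarrow> fock_rel (F (w[i := x + y])) (F (w[i := x]) + F (w[i := y]))"
    and scale: "\<And>w i c x. i < length w \<Longrightarrow> fock_rel (F (w[i := cplx_scale c x])) (free_scale c (F (w[i := x])))"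
    and rel: "fock_rel p r"
  shows "fock_rel (free_extend F p) (free_extend F r)"
proof -
  have "p - r \<in> free.span multilinear_relations"
    using rel by (simp add: fock_rel_def)
  then have "free_extend F (p - r) \<in> free.span multilinear_relations"
  proof (induction rule: free.span_induct_alt)
    case base
    show ?case by (simp add: free_extend_def free.span_zero)
  next
    case (step c g s)
    from step(1) have "free_extend F g \<in> free.span multilinear_relations"
    proof cases
      case (add i w x y)
      then show ?thesis
        using assms(1)[of i w x y] by (simp add: free_extend_diff fock_rel_def flip: diff_diff_eq)
    next
      case (scale i w c x)
      then show ?thesis
        using assms(2)[of i w c x] by (simp add: free_extend_diff fock_rel_def)
    qed
    then show ?case
      using step(2) by (simp add: free_extend_add free_extend_scale free.span_add free.span_scale)
  qed
  then show ?thesis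
    by (simp add: fock_rel_def free_extend_diff)
qed


subsection \<open>The full Fock space inner product\<close>

definition word_inner :: "'a::real_inner cplx list \<Rightarrow> 'a cplx list \<Rightarrow> complex" where
  "word_inner v w =
     (if length v = length w then \<Prod>k<length v. cplx_inner (v ! k) (w ! k) else 0)"

definition free_inner :: "'a::real_inner free \<Rightarrow> 'a free \<Rightarrow> complex" where
  "free_inner p r = (\<Sum>v\<in>Poly_Mapping.keys p. \<Sum>w\<in>Poly_Mapping.keys r.
     cnj (Poly_Mapping.lookup p v) * Poly_Mapping.lookup r w * word_inner v w)"

lemma word_inner_commute: "word_inner v w = cnj (word_inner w v)"
  by (auto simp: word_inner_def cnj_prod intro!: prod.cong cplx_inner_commute)

lemma free_inner_commute: "free_inner p r = cnj (free_inner r p)"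
  unfolding free_inner_def
  by (subst sum.swap) (auto simp: cnj_sum mult_ac intro!: sum.cong word_inner_commute)

lemma free_inner_superset:
  assumes "finite A" "Poly_Mapping.keys r \<subseteq> A"
  shows "free_inner p r = (\<Sum>v\<in>Poly_Mapping.keys p. \<Sum>w\<in>A.
     cnj (Poly_Mapping.lookup p v) * Poly_Mapping.lookup r w * word_inner v w)"
  unfolding free_inner_def
  by (intro sum.cong refl sum.mono_neutral_left) (use assms in \<open>auto simp: in_keys_iff\<close>)

lemma free_inner_diff_right: "free_inner p (r - s) = free_inner p r - free_inner p s"
proof -
  let ?A = "Poly_Mapping.keys r \<union> Poly_Mapping.keys s"
  have "Poly_Mapping.keys (r - s) \<subseteq> ?A"
    by (auto simp: in_keys_iff lookup_minus)
  then show ?thesis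
    by (simp add: free_inner_superset[of ?A] lookup_minus algebra_simps sum_subtractf)
qed

lemma free_inner_scale_right: "free_inner p (free_scale c r) = c * free_inner p r"
proof -
  have "Poly_Mapping.keys (free_scale c r) \<subseteq> Poly_Mapping.keys r"
    by (auto simp: in_keys_iff)
  then show ?thesis
    by (simp add: free_inner_superset[of "Poly_Mapping.keys r"] sum_distrib_left mult_ac)
qed

lemma free_inner_add_right: "free_inner p (r + s) = free_inner p r + free_inner p s"
  using free_inner_diff_right[of p r "- s"] free_inner_scale_right[of p "-1" s] by simp

lemma free_inner_single_right: "free_inner p (Poly_Mapping.single w a) =
  (\<Sum>v\<in>Poly_Mapping.keys p. cnj (Poly_Mapping.lookup p v) * a * word_inner v w)"
  by (simp add: free_inner_superset[of "{w}"])

lemma word_inner_update: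
  assumes "i < length w" "length v = length w"
  shows "word_inner v (w[i := x]) =
    cplx_inner (v ! i) x * (\<Prod>k\<in>{..<length w} - {i}. cplx_inner (v ! k) (w ! k))"
proof -
  have "word_inner v (w[i := x]) = (\<Prod>k<length w. cplx_inner (v ! k) (w[i := x] ! k))"
    using assms by (simp add: word_inner_def)
  also have "\<dots> = cplx_inner (v ! i) x *
      (\<Prod>k\<in>{..<length w} - {i}. cplx_inner (v ! k) (w[i := x] ! k))"
    using assms by (subst prod.remove[of _ i]) auto
  also have "(\<Prod>k\<in>{..<length w} - {i}. cplx_inner (v ! k) (w[i := x] ! k)) =
      (\<Prod>k\<in>{..<length w} - {i}. cplx_inner (v ! k) (w ! k))"
    by (rule prod.cong) auto
  finally show ?thesis .
qed

lemma word_inner_update_add: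
  assumes "i < length w"
  shows "word_inner v (w[i := x + y]) = word_inner v (w[i := x]) + word_inner v (w[i := y])"
proof (cases "length v = length w")
  case True
  with assms show ?thesis
    by (simp add: word_inner_update cplx_inner_add_right algebra_simps)
qed (simp add: word_inner_def)

lemma word_inner_update_scale:
  assumes "i < length w"
  shows "word_inner v (w[i := cplx_scale c x]) = c * word_inner v (w[i := x])"
proof (cases "length v = length w")
  case True
  with assms show ?thesis
    by (simp add: word_inner_update cplx_inner_scale_right algebra_simps)
qed (simp add: word_inner_def)

lemma free_inner_respects_right:
  assumes "fock_rel r r'"
  shows "free_inner p r = free_inner p r'"
proof -
  have "r - r' \<in> free.span multilinear_relations"
    using assms by (simp add: fock_rel_def)
  then have "free_inner p (r - r') = 0"
  proof (induction rule: free.span_induct_alt)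
    case base
    show ?case by (simp add: free_inner_def)
  next
    case (step c g s)
    from step(1) have "free_inner p g = 0"
    proof cases
      case (add i w x y)
      then show ?thesis
        by (simp add: free_inner_diff_right free_inner_single_right word_inner_update_add
            distrib_left sum.distrib)
    next
      case (scale i w c x)
      then show ?thesis
        by (simp add: free_inner_diff_right free_inner_single_right word_inner_update_scale mult_ac)
    qed
    then show ?case
      using step(2) by (simp add: free_inner_add_right free_inner_scale_right)
  qed
  then show ?thesis
    by (simp add: free_inner_diff_right)
qed

lift_definition fock_inner :: "'a::real_inner fock \<Rightarrow> 'a fock \<Rightarrow> complex" is free_inner
  by (metis free_inner_commute free_inner_respects_right)

lemma fock_inner_tensor:
  "fock_inner (tensor v) (tensor w) =
     (if length v = length w then \<Prod>k<length v. cplx_inner (v ! k) (w ! k) else 0)"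
  by transfer (simp add: free_inner_def word_inner_def)


subsection \<open>The deformed inner product\<close>

definition perm_inv :: "nat \<Rightarrow> (nat \<Rightarrow> nat) \<Rightarrow> nat" where
  "perm_inv n \<pi> = card {(i, j). i < j \<and> j < n \<and> \<pi> i > \<pi> j}"

definition perm_cinv :: "nat \<Rightarrow> (nat \<Rightarrow> nat) \<Rightarrow> nat" where
  "perm_cinv n \<pi> = card {(i, j). i < j \<and> j < n \<and> \<pi> i < \<pi> j}"

definition word_sym :: "real \<Rightarrow> real \<Rightarrow> 'a cplx list \<Rightarrow> 'a free" where
  "word_sym q t w = (\<Sum>\<pi> | \<pi> permutes {..<length w}.
     Poly_Mapping.single (permute_list \<pi> w)
       (of_real (q ^ perm_inv (length w) \<pi> * t ^ perm_cinv (length w) \<pi>)))"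

lemma permute_list_update:
  assumes "\<pi> permutes {..<length w}" "i < length w"
  shows "permute_list \<pi> (w[i := x]) = (permute_list \<pi> w)[inv \<pi> i := x]"
proof (rule nth_equalityI)
  fix k
  assume "k < length (permute_list \<pi> (w[i := x]))"
  then have "k < length w" "inv \<pi> i = k \<longleftrightarrow> i = \<pi> k" "\<pi> k < length w"
    using permutes_in_image[OF assms(1), of k] permutes_inv_eq[OF assms(1)] by auto
  then show "permute_list \<pi> (w[i := x]) ! k = (permute_list \<pi> w)[inv \<pi> i := x] ! k"
    using assms by (cases "i = \<pi> k") (simp_all add: permute_list_nth)
qed simp

lemma inv_permutes_less:
  assumes "\<pi> permutes {..<n}" "i < (n::nat)"
  shows "inv \<pi> i < n"
  using permutes_in_image[OF permutes_inv[OF assms(1)], of i] assms(2) by simp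

lemma free_scale_sum_single:
  "free_scale c (\<Sum>k\<in>A. Poly_Mapping.single (f k) (a k)) =
     (\<Sum>k\<in>A. Poly_Mapping.single (f k) (c * a k))"
  by (simp add: free.scale_sum_right)

lift_definition fock_sym :: "real \<Rightarrow> real \<Rightarrow> 'a::real_inner fock \<Rightarrow> 'a fock" is
  "\<lambda>q t. free_extend (word_sym q t)"
proof (rule free_extend_respects, goal_cases)
  case (1 q t p r w i x y)
  then show ?case
    by (auto simp: word_sym_def permute_list_update inv_permutes_less simp flip: sum.distrib
        intro!: fock_rel_sum fock_rel_single_add)
next
  case (2 q t p r w i c x)
  then show ?case
    by (auto simp: word_sym_def permute_list_update inv_permutes_less free_scale_sum_single
        intro!: fock_rel_sum fock_rel_single_scale)
qed

definition qt_inner :: "real \<Rightarrow> real \<Rightarrow> 'a::real_inner fock \<Rightarrow> 'a fock \<Rightarrow> complex" where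
  "qt_inner q t \<eta> \<xi> = fock_inner \<eta> (fock_sym q t \<xi>)"

definition qt_norm :: "real \<Rightarrow> real \<Rightarrow> 'a::real_inner fock \<Rightarrow> real" where
  "qt_norm q t \<xi> = sqrt (Re (qt_inner q t \<xi> \<xi>))"


subsection \<open>Creation and annihilation operators on the algebraic Fock space\<close>

lift_definition fock_create :: "'a::real_inner \<Rightarrow> 'a fock \<Rightarrow> 'a fock" is
  "\<lambda>f. free_extend (\<lambda>w. Poly_Mapping.single (cplx_of f # w) 1)"
proof (rule free_extend_respects, goal_cases)
  case (1 f p r w i x y)
  then show ?case
    using fock_rel_single_add[of "Suc i" "cplx_of f # w" x y 1] by simp
next
  case (2 f p r w i c x)
  then show ?case
    using fock_rel_single_scale[of "Suc i" "cplx_of f # w" c x 1]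
    by simp
qed

text \<open>Positions are counted from \<open>0\<close>, so the exponents \<open>k - 1\<close> and \<open>n - k\<close> of the
  \<open>k\<close>-th factor become \<open>k\<close> and \<open>n - 1 - k\<close>.\<close>

definition word_delete :: "nat \<Rightarrow> 'b list \<Rightarrow> 'b list" where
  "word_delete k w = take k w @ drop (Suc k) w"

definition word_annihilate :: "real \<Rightarrow> real \<Rightarrow> 'a::real_inner \<Rightarrow> 'a cplx list \<Rightarrow> 'a free" where
  "word_annihilate q t f w = (\<Sum>k<length w. Poly_Mapping.single (word_delete k w)
     (of_real (q ^ k * t ^ (length w - 1 - k)) * cplx_inner (cplx_of f) (w ! k)))"

lemma length_word_delete: "k < length w \<Longrightarrow> length (word_delete k w) = length w - 1"
  by (simp add: word_delete_def)

lemma nth_word_delete: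
  "k < length w \<Longrightarrow> j < length w - 1 \<Longrightarrow> word_delete k w ! j = w ! (if j < k then j else Suc j)"
  by (simp add: word_delete_def nth_append)

lemma word_delete_update:
  assumes "i < length w" "k < length w"
  shows "word_delete k (w[i := x]) =
    (if i = k then word_delete k w else (word_delete k w)[(if i < k then i else i - 1) := x])"
  by (rule nth_equalityI)
    (use assms in \<open>auto simp: length_word_delete nth_word_delete nth_list_update\<close>)

lift_definition fock_annihilate :: "real \<Rightarrow> real \<Rightarrow> 'a::real_inner \<Rightarrow> 'a fock \<Rightarrow> 'a fock" is
  "\<lambda>q t f. free_extend (word_annihilate q t f)"
proof (rule free_extend_respects, goal_cases)
  case (1 q t f p r w i x y)
  show ?case
    unfolding word_annihilate_def sum.distrib[symmetric] length_list_update
  proof (rule fock_rel_sum, goal_cases)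
    case (1 k)
    with \<open>i < length w\<close> show ?case
      by (cases "i = k") (auto simp: word_delete_update length_word_delete cplx_inner_add_right
          distrib_left single_add intro!: fock_rel_refl fock_rel_single_add)
  qed
next
  case (2 q t f p r w i c x)
  show ?case
    unfolding word_annihilate_def free_scale_sum_single length_list_update
  proof (rule fock_rel_sum, goal_cases)
    case (1 k)
    with \<open>i < length w\<close> show ?case
      by (cases "i = k") (auto simp: word_delete_update length_word_delete cplx_inner_scale_right
          mult_ac intro!: fock_rel_refl fock_rel_single_scale)
  qed
qed

subsection \<open>Values on elementary tensors\<close>

lemma fock_create_tensor: "fock_create f (tensor w) = tensor (cplx_of f # w)"
  by transfer (simp add: fock_rel_refl)

lemma abs_fock_sum: "abs_fock (\<Sum>k\<in>A. f k) = (\<Sum>k\<in>A. abs_fock (f k))"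
  by (induction A rule: infinite_finite_induct)
    (simp_all flip: zero_fock.abs_eq plus_fock.abs_eq)

lemma abs_fock_single: "abs_fock (Poly_Mapping.single w c) = fock_scale c (tensor w)"
  by (simp add: tensor.abs_eq fock_scale.abs_eq)

lemma fock_annihilate_tensor:
  "fock_annihilate q t f (tensor w) =
     (\<Sum>k<length w. fock_scale (of_real (q ^ k * t ^ (length w - 1 - k)) * cplx_inner (cplx_of f) (w ! k))
        (tensor (take k w @ drop (Suc k) w)))"
proof -
  have "fock_annihilate q t f (tensor w) = abs_fock (word_annihilate q t f w)"
    by (simp add: tensor.abs_eq fock_annihilate.abs_eq)
  then show ?thesis
    by (simp only: word_annihilate_def abs_fock_sum abs_fock_single word_delete_def)
qed

lemma fock_sym_tensor:
  "fock_sym q t (tensor w) = (\<Sum>\<pi> | \<pi> permutes {..<length w}.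
     fock_scale (of_real (q ^ perm_inv (length w) \<pi> * t ^ perm_cinv (length w) \<pi>))
       (tensor (permute_list \<pi> w)))"
proof -
  have "fock_sym q t (tensor w) = abs_fock (word_sym q t w)"
    by (simp add: tensor.abs_eq fock_sym.abs_eq)
  then show ?thesis
    by (simp only: word_sym_def abs_fock_sum abs_fock_single)
qed


section \<open>The completed Fock space and its operators\<close>

text \<open>Cauchy sequences in the algebraic Fock space modulo null sequences. The vector space
  operations, the inner product and the continuous extension of an operator are computed on
  representatives.\<close>

definition cauchy_seqs :: "real \<Rightarrow> real \<Rightarrow> (nat \<Rightarrow> 'a::real_inner fock) set" where
  "cauchy_seqs q t = {x. \<forall>e>0. \<exists>N. \<forall>m\<ge>N. \<forall>n\<ge>N. qt_norm q t (x m - x n) < e}"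

definition null_rel :: "real \<Rightarrow> real \<Rightarrow> ((nat \<Rightarrow> 'a::real_inner fock) \<times> (nat \<Rightarrow> 'a fock)) set" where
  "null_rel q t = {(x, y). x \<in> cauchy_seqs q t \<and> y \<in> cauchy_seqs q t \<and>
     (\<lambda>n. qt_norm q t (x n - y n)) \<longlonglongrightarrow> 0}"

type_synonym 'a compl = "(nat \<Rightarrow> 'a fock) set"

definition qt_fock :: "real \<Rightarrow> real \<Rightarrow> 'a::real_inner compl set" where
  "qt_fock q t = cauchy_seqs q t // null_rel q t"

definition qt_embed :: "real \<Rightarrow> real \<Rightarrow> 'a::real_inner fock \<Rightarrow> 'a compl" where
  "qt_embed q t \<xi> = null_rel q t `` {\<lambda>_. \<xi>}"

definition compl_add :: "real \<Rightarrow> real \<Rightarrow> 'a::real_inner compl \<Rightarrow> 'a compl \<Rightarrow> 'a compl" where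
  "compl_add q t X Y = (\<Union>x\<in>X. \<Union>y\<in>Y. null_rel q t `` {\<lambda>n. x n + y n})"

definition compl_scale :: "real \<Rightarrow> real \<Rightarrow> complex \<Rightarrow> 'a::real_inner compl \<Rightarrow> 'a compl" where
  "compl_scale q t c X = (\<Union>x\<in>X. null_rel q t `` {\<lambda>n. fock_scale c (x n)})"

definition compl_inner :: "real \<Rightarrow> real \<Rightarrow> 'a::real_inner compl \<Rightarrow> 'a compl \<Rightarrow> complex" where
  "compl_inner q t X Y = (THE c. \<forall>x\<in>X. \<forall>y\<in>Y. (\<lambda>n. qt_inner q t (x n) (y n)) \<longlonglongrightarrow> c)"

definition compl_norm :: "real \<Rightarrow> real \<Rightarrow> 'a::real_inner compl \<Rightarrow> real" where
  "compl_norm q t X = sqrt (Re (compl_inner q t X X))"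

definition compl_extend ::
    "real \<Rightarrow> real \<Rightarrow> ('a::real_inner fock \<Rightarrow> 'a fock) \<Rightarrow> 'a compl \<Rightarrow> 'a compl" where
  "compl_extend q t T X = (\<Union>x\<in>X. null_rel q t `` {\<lambda>n. T (x n)})"

definition bounded_operator :: "real \<Rightarrow> real \<Rightarrow> ('a::real_inner compl \<Rightarrow> 'a compl) \<Rightarrow> bool" where
  "bounded_operator q t T \<longleftrightarrow>
     (\<forall>X\<in>qt_fock q t. T X \<in> qt_fock q t) \<and>
     (\<forall>X\<in>qt_fock q t. \<forall>Y\<in>qt_fock q t. T (compl_add q t X Y) = compl_add q t (T X) (T Y)) \<and>
     (\<forall>c. \<forall>X\<in>qt_fock q t. T (compl_scale q t c X) = compl_scale q t c (T X)) \<and>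
     (\<exists>C. \<forall>X\<in>qt_fock q t. compl_norm q t (T X) \<le> C * compl_norm q t X)"

definition self_adjoint :: "real \<Rightarrow> real \<Rightarrow> ('a::real_inner compl \<Rightarrow> 'a compl) \<Rightarrow> bool" where
  "self_adjoint q t T \<longleftrightarrow> bounded_operator q t T \<and>
     (\<forall>X\<in>qt_fock q t. \<forall>Y\<in>qt_fock q t. compl_inner q t X (T Y) = compl_inner q t (T X) Y)"

definition qt_create :: "real \<Rightarrow> real \<Rightarrow> 'a::real_inner \<Rightarrow> 'a compl \<Rightarrow> 'a compl" where
  "qt_create q t f = compl_extend q t (fock_create f)"

definition qt_annihilate :: "real \<Rightarrow> real \<Rightarrow> 'a::real_inner \<Rightarrow> 'a compl \<Rightarrow> 'a compl" where
  "qt_annihilate q t f = compl_extend q t (fock_annihilate q t f)"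

definition qt_gaussian :: "real \<Rightarrow> real \<Rightarrow> 'a::real_inner \<Rightarrow> 'a compl \<Rightarrow> 'a compl" where
  "qt_gaussian q t h X = compl_add q t (qt_annihilate q t h X) (qt_create q t h X)"

definition vacuum_state :: "real \<Rightarrow> real \<Rightarrow> ('a::real_inner compl \<Rightarrow> 'a compl) \<Rightarrow> complex" where
  "vacuum_state q t b =
     compl_inner q t (qt_embed q t vacuum) (b (qt_embed q t vacuum))"

definition is_distribution ::
    "real \<Rightarrow> real \<Rightarrow> ('a::real_inner compl \<Rightarrow> 'a compl) \<Rightarrow> real measure \<Rightarrow> bool" where
  "is_distribution q t s \<mu> \<longleftrightarrow> real_distribution \<mu> \<and>
     (\<forall>n. integrable \<mu> (\<lambda>x. x ^ n) \<and>
       complex_of_real (\<integral>x. x ^ n \<partial>\<mu>) = vacuum_state q t (s ^^ n))"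


section \<open>Pair partitions\<close>

definition pair_partitions :: "nat \<Rightarrow> nat set set set" where
  "pair_partitions m = {V. partition_on {1..m} V \<and> (\<forall>B\<in>V. card B = 2)}"

definition crossings :: "nat set set \<Rightarrow> nat" where
  "crossings V =
     card {(B, C). B \<in> V \<and> C \<in> V \<and> Min B < Min C \<and> Min C < Max B \<and> Max B < Max C}"

definition nestings :: "nat set set \<Rightarrow> nat" where
  "nestings V =
     card {(B, C). B \<in> V \<and> C \<in> V \<and> Min B < Min C \<and> Min C < Max C \<and> Max C < Max B}"


section \<open>The continued fraction and the Hermite polynomials\<close>

definition qt_bracket :: "real \<Rightarrow> real \<Rightarrow> nat \<Rightarrow> real" where
  "qt_bracket q t n = (\<Sum>i=1..n. q ^ (i - 1) * t ^ (n - i))"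

text \<open>\<open>cfrac_approx b N k\<close> is the fraction with partial numerators \<open>b k z, b (k + 1) z, \<dots>\<close>, cut
  off after \<open>N\<close> levels; the limit is taken in the formal power series topology, that is,
  every coefficient is eventually constant.\<close>

fun cfrac_approx :: "(nat \<Rightarrow> real) \<Rightarrow> nat \<Rightarrow> nat \<Rightarrow> real fps" where
  "cfrac_approx b 0 k = 1"
| "cfrac_approx b (Suc N) k = 1 / (1 - fps_const (b k) * fps_X * cfrac_approx b N (Suc k))"

definition qt_cfrac :: "real \<Rightarrow> real \<Rightarrow> real fps" where
  "qt_cfrac q t = lim (\<lambda>N. cfrac_approx (qt_bracket q t) N 1)"

fun qt_hermite :: "real \<Rightarrow> real \<Rightarrow> nat \<Rightarrow> real poly" where
  "qt_hermite q t 0 = 1"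
| "qt_hermite q t (Suc 0) = [:0, 1:]"
| "qt_hermite q t (Suc (Suc n)) =
     [:0, 1:] * qt_hermite q t (Suc n) - smult (qt_bracket q t (Suc n)) (qt_hermite q t n)"

text \<open>Integrability is required explicitly because the integral of a non-integrable function is
  \<open>0\<close> by convention.\<close>

definition orthogonalizes :: "real measure \<Rightarrow> (nat \<Rightarrow> real poly) \<Rightarrow> bool" where
  "orthogonalizes \<mu> H \<longleftrightarrow>
     (\<forall>m n. integrable \<mu> (\<lambda>x. poly (H m) x * poly (H n) x)) \<and>
     (\<forall>m n. m \<noteq> n \<longrightarrow> (\<integral>x. poly (H m) x * poly (H n) x \<partial>\<mu>) = 0)"

end

(*
  The kernel q^inv(pi) t^cinv(pi) of tau sigma^-1 is a product over pairs of 2x2 kernels, hence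
  positive for |q| <= t, which makes the deformed form positive. The relation
  a(f) a(f)* = q a(f)* a(f) + |f|^2 t^N then bounds a(f)*, degree by degree. On the powers of h the
  Gaussian element acts as the Jacobi matrix with weights [k], so its moments count weighted lattice
  paths; these also count pair partitions (by closing the last block) and are the coefficients of
  the continued fraction. Since the Gaussian element is bounded by some R, the moment functional is
  nonnegative on the products (R + x)^k (R - x)^l, so Bernstein polynomials and Helly's theorem give
  a representing measure. It is unique because the moments grow at most geometrically, and the
  Hermite polynomials are orthogonal because H_n of the Gaussian element maps the vacuum to the n-th
  power of e.
*)

theory Submission
  imports Defs
begin

section \<open>Positivity of the inner products\<close>

text \<open>The tensor powers are quotients without a chosen basis, and the underlying space may be
  infinite-dimensional. A given vector involves only finitely many letters, so positivity is reduced
  to Gram matrices of finitely many words, for which a finite orthonormal family suffices. The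
  outcome is semidefiniteness; null vectors are identified with zero in the completion through
  \<open>null_rel\<close>. The weight is a function on the symmetric group. Averaging over the group
  turns it into a kernel in two permutations, and only in this form does the factorization over
  pairs become visible. Bounding creation looks circular: the commutation relation controls its norm
  by that of annihilation, which is the same number and not yet known to be finite. Induction on the
  degree breaks the circle, and |q| < 1 keeps the constants below the sum of a geometric series. The
  distribution is obtained from positivity of the vacuum functional on polynomials, a statement
  about vectors of the algebraic space; the completed space is reached through
  representatives.\<close>

text \<open>Gram-Schmidt followed by Parseval's identity. The induction carries the orthonormality
  of \<open>E\<close> and the expansion of every vector of \<open>S\<close>; what is kept at the end
  is that the inner product on \<open>S\<close> is a finite sum of products.\<close>

lemma orthonormal_expansion_exists:
  fixes S :: "'a::real_inner set"
  assumes "finite S"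
  shows "\<exists>E. finite E \<and> (\<forall>x\<in>S. \<forall>y\<in>S. x \<bullet> y = (\<Sum>e\<in>E. (x \<bullet> e) * (y \<bullet> e)))"
proof -
  have "\<exists>E. finite E \<and> (\<forall>e\<in>E. \<forall>e'\<in>E. e \<bullet> e' = (if e = e' then 1 else 0)) \<and>
          (\<forall>x\<in>S. x = (\<Sum>e\<in>E. (x \<bullet> e) *\<^sub>R e))"
    using assms
  proof (induction S rule: finite_induct)
    case empty
    then show ?case by auto
  next
    case (insert x S)
    then obtain E where E: "finite E" "\<And>e e'. e \<in> E \<Longrightarrow> e' \<in> E \<Longrightarrow> e \<bullet> e' = (if e = e' then 1 else 0)"
      "\<And>x. x \<in> S \<Longrightarrow> x = (\<Sum>e\<in>E. (x \<bullet> e) *\<^sub>R e)" by blast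
    define y where "y = x - (\<Sum>e\<in>E. (x \<bullet> e) *\<^sub>R e)"
    have yE: "y \<bullet> e = 0" if "e \<in> E" for e
    proof -
      have "(\<Sum>e'\<in>E. (x \<bullet> e') *\<^sub>R e') \<bullet> e = (\<Sum>e'\<in>E. if e' = e then x \<bullet> e else 0)"
        unfolding inner_sum_left by (rule sum.cong) (use E(2) that in auto)
      then show ?thesis using that E(1) by (simp add: y_def inner_diff_left)
    qed
    show ?case
    proof (cases "y = 0")
      case True
      then have "x = (\<Sum>e\<in>E. (x \<bullet> e) *\<^sub>R e)" by (simp add: y_def)
      then show ?thesis using E by (intro exI[of _ E]) auto
    next
      case False
      define u where "u = y /\<^sub>R norm y"
      have uu: "u \<bullet> u = 1" using False by (simp add: u_def dot_square_norm power2_eq_square)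
      have uE: "u \<bullet> e = 0" "e \<bullet> u = 0" if "e \<in> E" for e
        using yE[OF that] by (simp_all add: u_def inner_commute)
      have "u \<notin> E" using uE uu by force
      \<comment> \<open>Since \<open>u\<close> is orthogonal to \<open>E\<close>, only the residual
        \<open>y\<close> contributes, so the new term of the expansion restores exactly
        \<open>y\<close>.\<close>
      have xu: "x \<bullet> u = norm y"
      proof -
        have "x = y + (\<Sum>e\<in>E. (x \<bullet> e) *\<^sub>R e)" by (simp add: y_def)
        then have "x \<bullet> u = y \<bullet> u + (\<Sum>e\<in>E. (x \<bullet> e) *\<^sub>R e) \<bullet> u" by (metis inner_add_left)
        also have "\<dots> = y \<bullet> u" by (simp add: inner_sum_left uE)
        also have "\<dots> = norm y" using False
          by (simp add: u_def dot_square_norm power2_eq_square)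
        finally show ?thesis .
      qed
      have "z = (\<Sum>e\<in>insert u E. (z \<bullet> e) *\<^sub>R e)" if "z \<in> insert x S" for z
      proof (cases "z = x")
        case True
        have "(\<Sum>e\<in>insert u E. (x \<bullet> e) *\<^sub>R e) = (x \<bullet> u) *\<^sub>R u + (\<Sum>e\<in>E. (x \<bullet> e) *\<^sub>R e)"
          using E(1) \<open>u \<notin> E\<close> by simp
        also have "(x \<bullet> u) *\<^sub>R u = y" using False by (simp add: xu) (simp add: u_def)
        finally show ?thesis using True by (simp add: y_def)
      next
        case False
        then have z: "z = (\<Sum>e\<in>E. (z \<bullet> e) *\<^sub>R e)" using that E(3) by auto
        have "z \<bullet> u = (\<Sum>e\<in>E. (z \<bullet> e) *\<^sub>R e) \<bullet> u" using z by simp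
        then have "z \<bullet> u = 0" by (simp add: inner_sum_left uE)
        then show ?thesis using z E(1) \<open>u \<notin> E\<close> by simp
      qed
      moreover have "e \<bullet> e' = (if e = e' then 1 else 0)" if "e \<in> insert u E" "e' \<in> insert u E" for e e'
        using that E(2)[of e e'] uu uE \<open>u \<notin> E\<close> by (cases "e = u"; cases "e' = u") auto
      ultimately show ?thesis using E(1) by (intro exI[of _ "insert u E"]) blast
    qed
  qed
  then obtain E where E: "finite E" "\<And>e e'. e \<in> E \<Longrightarrow> e' \<in> E \<Longrightarrow> e \<bullet> e' = (if e = e' then 1 else 0)"
      "\<And>x. x \<in> S \<Longrightarrow> x = (\<Sum>e\<in>E. (x \<bullet> e) *\<^sub>R e)" by blast
  have "x \<bullet> y = (\<Sum>e\<in>E. (x \<bullet> e) * (y \<bullet> e))" if "x \<in> S" "y \<in> S" for x y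
  proof -
    have "x \<bullet> y = (\<Sum>e\<in>E. (x \<bullet> e) *\<^sub>R e) \<bullet> y" using E(3)[OF that(1)] by simp
    also have "\<dots> = (\<Sum>e\<in>E. (x \<bullet> e) * (e \<bullet> y))" by (simp add: inner_sum_left)
    finally show ?thesis by (simp add: inner_commute)
  qed
  then show ?thesis using E(1) by blast
qed

text \<open>One real orthonormal family serves the real and imaginary parts of all vectors at once,
  and the two real coordinates combine into a complex one.\<close>

lemma cplx_inner_expansion_exists:
  fixes S :: "'a::real_inner cplx set"
  assumes "finite S"
  shows "\<exists>E :: 'a set. finite E \<and> (\<forall>x\<in>S. \<forall>y\<in>S. cplx_inner x y =
      (\<Sum>e\<in>E. cnj (Complex (fst x \<bullet> e) (snd x \<bullet> e)) * Complex (fst y \<bullet> e) (snd y \<bullet> e)))"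
proof -
  obtain E where E: "finite E"
    "\<And>x y. x \<in> fst ` S \<union> snd ` S \<Longrightarrow> y \<in> fst ` S \<union> snd ` S \<Longrightarrow> x \<bullet> y = (\<Sum>e\<in>E. (x \<bullet> e) * (y \<bullet> e))"
    using orthonormal_expansion_exists[of "fst ` S \<union> snd ` S"] assms by auto
  have "cplx_inner x y =
      (\<Sum>e\<in>E. cnj (Complex (fst x \<bullet> e) (snd x \<bullet> e)) * Complex (fst y \<bullet> e) (snd y \<bullet> e))"
    if "x \<in> S" "y \<in> S" for x y
    using that by (simp add: cplx_inner_def complex_eq_iff E(2) sum.distrib sum_subtractf algebra_simps)
  then show ?thesis using E(1) by blast
qed

lemma word_inner_Cons:
  "word_inner (x # v) (y # w) = cplx_inner x y * word_inner v w"
  by (simp add: word_inner_def prod.lessThan_Suc_shift del: prod.lessThan_Suc)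

text \<open>A Schur product argument: the inner product of the first letters is expanded in an
  orthonormal family, each coordinate is absorbed into the coefficients, and the tails are shorter
  words. At length 0 the sum is the squared modulus of the sum of the coefficients. The family
  \<open>g\<close> need not be injective, so permuted copies of words may coincide.\<close>

lemma word_inner_gram_nonneg:
  fixes g :: "'i \<Rightarrow> 'a::real_inner cplx list"
  assumes "finite A" "\<And>i. i \<in> A \<Longrightarrow> length (g i) = n"
  shows "0 \<le> Re (\<Sum>i\<in>A. \<Sum>j\<in>A. cnj (c i) * c j * word_inner (g i) (g j))"
  using assms(2)
proof (induction n arbitrary: g c)
  case 0
  then have "(\<Sum>i\<in>A. \<Sum>j\<in>A. cnj (c i) * c j * word_inner (g i) (g j)) =
      cnj (\<Sum>i\<in>A. c i) * (\<Sum>j\<in>A. c j)"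
    by (simp add: sum_product cnj_sum word_inner_def)
  also have "\<dots> = of_real ((cmod (\<Sum>i\<in>A. c i))\<^sup>2)"
    by (metis complex_norm_square mult.commute)
  finally have "(\<Sum>i\<in>A. \<Sum>j\<in>A. cnj (c i) * c j * word_inner (g i) (g j)) = of_real ((cmod (\<Sum>i\<in>A. c i))\<^sup>2)" .
  then show ?case by (simp only: Re_complex_of_real zero_le_power2)
next
  case (Suc n)
  have "finite (hd ` g ` A)" using assms(1) by simp
  from cplx_inner_expansion_exists[OF this] obtain E :: "'a set" where E: "finite E"
    "\<forall>x\<in>hd ` g ` A. \<forall>y\<in>hd ` g ` A. cplx_inner x y =
      (\<Sum>e\<in>E. cnj (Complex (fst x \<bullet> e) (snd x \<bullet> e)) * Complex (fst y \<bullet> e) (snd y \<bullet> e))"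
    by (elim exE conjE) (rule that)
  define d where "d e i = Complex (fst (hd (g i)) \<bullet> e) (snd (hd (g i)) \<bullet> e)" for e i
  have W: "word_inner (g i) (g j) = (\<Sum>e\<in>E. cnj (d e i) * d e j) * word_inner (tl (g i)) (tl (g j))"
    if "i \<in> A" "j \<in> A" for i j
  proof -
    have "g i = hd (g i) # tl (g i)" "g j = hd (g j) # tl (g j)"
      using Suc.prems[of i] Suc.prems[of j] that by (cases "g i"; cases "g j"; simp)+
    then have "word_inner (g i) (g j) = cplx_inner (hd (g i)) (hd (g j)) * word_inner (tl (g i)) (tl (g j))"
      by (metis word_inner_Cons)
    then show ?thesis using E(2) that by (simp add: d_def)
  qed
  have "(\<Sum>i\<in>A. \<Sum>j\<in>A. cnj (c i) * c j * word_inner (g i) (g j)) =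
    (\<Sum>i\<in>A. \<Sum>j\<in>A. \<Sum>e\<in>E. cnj (c i * d e i) * (c j * d e j) * word_inner (tl (g i)) (tl (g j)))"
    by (intro sum.cong refl) (simp add: W sum_distrib_left sum_distrib_right mult_ac)
  also have "\<dots> = (\<Sum>e\<in>E. \<Sum>i\<in>A. \<Sum>j\<in>A. cnj (c i * d e i) * (c j * d e j) * word_inner (tl (g i)) (tl (g j)))"
    by (subst (2) sum.swap, subst sum.swap) (rule refl)
  finally have eq: "(\<Sum>i\<in>A. \<Sum>j\<in>A. cnj (c i) * c j * word_inner (g i) (g j)) = \<dots>" .
  have "0 \<le> Re (\<Sum>i\<in>A. \<Sum>j\<in>A. cnj (c i * d e i) * (c j * d e j) * word_inner (tl (g i)) (tl (g j)))" for e
    by (rule Suc.IH) (use Suc.prems in auto)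
  then show ?case unfolding eq by (subst Re_sum) (intro sum_nonneg)
qed

subsection \<open>The permutation kernel\<close>

text \<open>The deformed inner product of two elementary tensors (see
  \<open>qt_inner_tensor\<close>), studied on words so that the combinatorics stays outside the
  quotient.\<close>

definition word_kernel :: "real \<Rightarrow> real \<Rightarrow> 'a::real_inner cplx list \<Rightarrow> 'a cplx list \<Rightarrow> complex" where
  "word_kernel q t v w = (\<Sum>\<pi> | \<pi> permutes {..<length w}.
     of_real (q ^ perm_inv (length w) \<pi> * t ^ perm_cinv (length w) \<pi>) * word_inner v (permute_list \<pi> w))"

definition pairs_below :: "nat \<Rightarrow> (nat \<times> nat) set" where
  "pairs_below n = {(a, b). a < b \<and> b < n}"

lemma finite_pairs_below [simp]: "finite (pairs_below n)"
  by (rule finite_subset[of _ "{..<n} \<times> {..<n}"]) (auto simp: pairs_below_def)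

text \<open>An unordered pair \<open>{i, j}\<close> is an inversion of \<open>\<tau> \<sigma>\<^sup>-\<^sup>1\<close> iff \<open>\<sigma>\<close> and \<open>\<tau>\<close> order the
  pair \<open>{a, b} = \<sigma>\<^sup>-\<^sup>1 {i, j}\<close> differently.\<close>

lemma card_pairs_comp_inv:
  assumes \<sigma>: "\<sigma> permutes {..<n}" and \<tau>: "\<tau> permutes {..<n}"
  shows "perm_inv n (\<tau> \<circ> inv \<sigma>) = card {(a, b) \<in> pairs_below n. (\<sigma> a < \<sigma> b) \<noteq> (\<tau> a < \<tau> b)}"
    and "perm_cinv n (\<tau> \<circ> inv \<sigma>) = card {(a, b) \<in> pairs_below n. (\<sigma> a < \<sigma> b) = (\<tau> a < \<tau> b)}"
proof -
  have lt: "\<sigma> a < n \<longleftrightarrow> a < n" "inv \<sigma> a < n \<longleftrightarrow> a < n" for a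
    using permutes_in_image[OF \<sigma>, of a] permutes_in_image[OF permutes_inv[OF \<sigma>], of a] by auto
  have inv[simp]: "\<sigma> (inv \<sigma> a) = a" "inv \<sigma> (\<sigma> a) = a" for a
    using permutes_inverses[OF \<sigma>] by auto
  have injt: "\<tau> a = \<tau> b \<longleftrightarrow> a = b" for a b using permutes_inj[OF \<tau>] by (auto simp: inj_def)
  have injs: "\<sigma> a = \<sigma> b \<longleftrightarrow> a = b" for a b using permutes_inj[OF \<sigma>] by (auto simp: inj_def)
  \<comment> \<open>Pairs are stored in increasing order, so \<sigma> is applied to both entries and
    the result is sorted; \<open>g\<close> does the same with the inverse permutation.\<close>
  define f where "f = (\<lambda>(a, b). if \<sigma> a < \<sigma> b then (\<sigma> a, \<sigma> b) else (\<sigma> b, \<sigma> a))"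
  define g where "g = (\<lambda>(i, j). if inv \<sigma> i < inv \<sigma> j then (inv \<sigma> i, inv \<sigma> j) else (inv \<sigma> j, inv \<sigma> i))"
  have inji: "inv \<sigma> a = inv \<sigma> b \<longleftrightarrow> a = b" for a b by (metis inv(1))
  have bij: "bij_betw f (pairs_below n) (pairs_below n)"
  proof (rule bij_betw_byWitness[where f' = g])
    have "f (a, b) \<in> pairs_below n \<and> g (f (a, b)) = (a, b)" if "(a, b) \<in> pairs_below n" for a b
      using that injs[of a b] lt(1)[of a] lt(1)[of b] by (auto simp: f_def g_def pairs_below_def)
    then show "\<forall>x\<in>pairs_below n. g (f x) = x" "f ` pairs_below n \<subseteq> pairs_below n" by auto
    have "g (i, j) \<in> pairs_below n \<and> f (g (i, j)) = (i, j)" if "(i, j) \<in> pairs_below n" for i j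
      using that inji[of i j] lt(2)[of i] lt(2)[of j] by (auto simp: f_def g_def pairs_below_def)
    then show "\<forall>x\<in>pairs_below n. f (g x) = x" "g ` pairs_below n \<subseteq> pairs_below n" by auto
  qed
  have card_eq: "card {x \<in> pairs_below n. Q (f x)} = card {y \<in> pairs_below n. Q y}" for Q
  proof -
    have "f ` {x \<in> pairs_below n. Q (f x)} = {y \<in> pairs_below n. Q y}"
    proof (intro equalityI subsetI)
      fix y assume "y \<in> f ` {x \<in> pairs_below n. Q (f x)}"
      then show "y \<in> {y \<in> pairs_below n. Q y}" using bij_betwE[OF bij] by auto
    next
      fix y assume y: "y \<in> {y \<in> pairs_below n. Q y}"
      then have "y \<in> f ` pairs_below n" using bij_betw_imp_surj_on[OF bij] by simp
      then obtain x where "x \<in> pairs_below n" "y = f x" by (rule imageE)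
      with y show "y \<in> f ` {x \<in> pairs_below n. Q (f x)}" by simp
    qed
    moreover have "inj_on f {x \<in> pairs_below n. Q (f x)}"
      using bij by (auto simp: bij_betw_def inj_on_def)
    from card_image[OF this] calculation show ?thesis by simp
  qed
  define Q1 where "Q1 = (\<lambda>(i, j). \<tau> (inv \<sigma> i) > \<tau> (inv \<sigma> j))"
  define Q2 where "Q2 = (\<lambda>(i, j). \<tau> (inv \<sigma> i) < \<tau> (inv \<sigma> j))"
  have Q: "Q1 (f (a, b)) \<longleftrightarrow> (\<sigma> a < \<sigma> b) \<noteq> (\<tau> a < \<tau> b)"
    "Q2 (f (a, b)) \<longleftrightarrow> (\<sigma> a < \<sigma> b) = (\<tau> a < \<tau> b)" if "(a, b) \<in> pairs_below n" for a b
    using that injt[of a b] by (auto simp: f_def Q1_def Q2_def pairs_below_def)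
  have "perm_inv n (\<tau> \<circ> inv \<sigma>) = card {y \<in> pairs_below n. Q1 y}"
    unfolding perm_inv_def by (rule arg_cong[where f = card]) (auto simp: pairs_below_def Q1_def)
  also have "\<dots> = card {x \<in> pairs_below n. Q1 (f x)}" by (simp only: card_eq)
  also have "{x \<in> pairs_below n. Q1 (f x)} = {(a, b) \<in> pairs_below n. (\<sigma> a < \<sigma> b) \<noteq> (\<tau> a < \<tau> b)}"
  proof (rule set_eqI)
    fix x show "x \<in> {x \<in> pairs_below n. Q1 (f x)} \<longleftrightarrow> x \<in> {(a, b) \<in> pairs_below n. (\<sigma> a < \<sigma> b) \<noteq> (\<tau> a < \<tau> b)}"
      using Q(1)[of "fst x" "snd x"] by (cases x) auto
  qed
  finally show "perm_inv n (\<tau> \<circ> inv \<sigma>) = card {(a, b) \<in> pairs_below n. (\<sigma> a < \<sigma> b) \<noteq> (\<tau> a < \<tau> b)}" .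
  have "perm_cinv n (\<tau> \<circ> inv \<sigma>) = card {y \<in> pairs_below n. Q2 y}"
    unfolding perm_cinv_def by (rule arg_cong[where f = card]) (auto simp: pairs_below_def Q2_def)
  also have "\<dots> = card {x \<in> pairs_below n. Q2 (f x)}" by (simp only: card_eq)
  also have "{x \<in> pairs_below n. Q2 (f x)} = {(a, b) \<in> pairs_below n. (\<sigma> a < \<sigma> b) = (\<tau> a < \<tau> b)}"
  proof (rule set_eqI)
    fix x show "x \<in> {x \<in> pairs_below n. Q2 (f x)} \<longleftrightarrow> x \<in> {(a, b) \<in> pairs_below n. (\<sigma> a < \<sigma> b) = (\<tau> a < \<tau> b)}"
      using Q(2)[of "fst x" "snd x"] by (cases x) auto
  qed
  finally show "perm_cinv n (\<tau> \<circ> inv \<sigma>) = card {(a, b) \<in> pairs_below n. (\<sigma> a < \<sigma> b) = (\<tau> a < \<tau> b)}" .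
qed

lemma word_inner_permute:
  assumes "\<sigma> permutes {..<length v}" "length v = length w"
  shows "word_inner (permute_list \<sigma> v) (permute_list \<sigma> w) = word_inner v w"
proof -
  have "word_inner (permute_list \<sigma> v) (permute_list \<sigma> w) =
    (\<Prod>k<length v. cplx_inner (v ! \<sigma> k) (w ! \<sigma> k))"
    using assms by (simp add: word_inner_def permute_list_nth)
  also have "\<dots> = (\<Prod>k<length v. cplx_inner (v ! k) (w ! k))"
    using prod.permute[OF assms(1), of "\<lambda>k. cplx_inner (v ! k) (w ! k)"] by (simp add: o_def)
  finally show ?thesis using assms by (simp add: word_inner_def)
qed

definition inv_weight :: "real \<Rightarrow> real \<Rightarrow> nat \<Rightarrow> (nat \<Rightarrow> nat) \<Rightarrow> real" where
  "inv_weight q t n \<pi> = q ^ perm_inv n \<pi> * t ^ perm_cinv n \<pi>"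

text \<open>Permuting both words by the same \<sigma> leaves the undeformed product unchanged, and
  \<tau> = \<pi> \<circ> \<sigma> replaces the summation variable. Each of the \<open>fact n\<close>
  choices of \<sigma> gives the same value.\<close>

lemma word_kernel_symmetrized:
  assumes "length v = n" "length w = n"
  shows "fact n * word_kernel q t v w = (\<Sum>\<sigma> | \<sigma> permutes {..<n}. \<Sum>\<tau> | \<tau> permutes {..<n}.
    of_real (inv_weight q t n (\<tau> \<circ> inv \<sigma>)) * word_inner (permute_list \<sigma> v) (permute_list \<tau> w))"
proof -
  have "word_kernel q t v w = (\<Sum>\<tau> | \<tau> permutes {..<n}.
    of_real (inv_weight q t n (\<tau> \<circ> inv \<sigma>)) * word_inner (permute_list \<sigma> v) (permute_list \<tau> w))"
    if \<sigma>: "\<sigma> permutes {..<n}" for \<sigma>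
  proof -
    have "word_kernel q t v w = (\<Sum>\<pi> | \<pi> permutes {..<n}.
      of_real (inv_weight q t n \<pi>) * word_inner (permute_list \<sigma> v) (permute_list (\<pi> \<circ> \<sigma>) w))"
      unfolding word_kernel_def assms inv_weight_def
      by (intro sum.cong refl) (use assms \<sigma> in \<open>simp add: permute_list_compose word_inner_permute\<close>)
    also have "\<dots> = (\<Sum>\<tau> | \<tau> permutes {..<n}.
      of_real (inv_weight q t n (\<tau> \<circ> inv \<sigma>)) * word_inner (permute_list \<sigma> v) (permute_list (\<tau> \<circ> inv \<sigma> \<circ> \<sigma>) w))"
      by (rule sum_permutations_compose_right[OF permutes_inv[OF \<sigma>]])
    also have "\<dots> = (\<Sum>\<tau> | \<tau> permutes {..<n}.
      of_real (inv_weight q t n (\<tau> \<circ> inv \<sigma>)) * word_inner (permute_list \<sigma> v) (permute_list \<tau> w))"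
      using permutes_inv_o(2)[OF \<sigma>] by (simp add: o_assoc[symmetric])
    finally show ?thesis .
  qed
  then have "(\<Sum>\<sigma> | \<sigma> permutes {..<n}. word_kernel q t v w) =
    (\<Sum>\<sigma> | \<sigma> permutes {..<n}. \<Sum>\<tau> | \<tau> permutes {..<n}.
    of_real (inv_weight q t n (\<tau> \<circ> inv \<sigma>)) * word_inner (permute_list \<sigma> v) (permute_list \<tau> w))"
    by (intro sum.cong) auto
  then show ?thesis by (simp add: card_permutations)
qed

definition order_sign :: "(nat \<times> nat) set \<Rightarrow> (nat \<Rightarrow> nat) \<Rightarrow> real" where
  "order_sign X \<sigma> = (\<Prod>(a, b)\<in>X. if \<sigma> a < \<sigma> b then 1 else - 1)"

text \<open>Each pair contributes \<open>t\<close> or \<open>q\<close>, that is \<open>(t + q)/2 + (t - q)/2 \<epsilon>(\<sigma>) \<epsilon>(\<tau>)\<close>, and expanding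
  the product exhibits the weight as a positive combination of rank-one kernels.\<close>

lemma inv_weight_comp_inv:
  assumes \<sigma>: "\<sigma> permutes {..<n}" and \<tau>: "\<tau> permutes {..<n}"
  shows "inv_weight q t n (\<tau> \<circ> inv \<sigma>) = (\<Sum>X\<in>Pow (pairs_below n).
    ((t - q) / 2) ^ card X * ((t + q) / 2) ^ card (pairs_below n - X) * (order_sign X \<sigma> * order_sign X \<tau>))"
proof -
  let ?P = "pairs_below n"
  define s where "s \<sigma> x = (case x of (a, b) \<Rightarrow> (if \<sigma> a < \<sigma> b then (1::real) else - 1))"
    for \<sigma> :: "nat \<Rightarrow> nat" and x
  have "inv_weight q t n (\<tau> \<circ> inv \<sigma>) =
    (\<Prod>x\<in>?P. if (case x of (a, b) \<Rightarrow> (\<sigma> a < \<sigma> b) = (\<tau> a < \<tau> b)) then t else q)"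
    by (simp add: inv_weight_def card_pairs_comp_inv[OF \<sigma> \<tau>] prod.If_cases Int_def
        mult.commute Compl_eq)
      (intro arg_cong2[where f = "(*)"] arg_cong2[where f = power] arg_cong[where f = card] refl; auto)
  also have "\<dots> = (\<Prod>x\<in>?P. (t - q) / 2 * (s \<sigma> x * s \<tau> x) + (t + q) / 2)"
    by (intro prod.cong refl) (auto simp: s_def diff_divide_distrib add_divide_distrib split: if_splits)
  also have "\<dots> = (\<Sum>X\<in>Pow ?P. (\<Prod>x\<in>X. (t - q) / 2 * (s \<sigma> x * s \<tau> x)) * (\<Prod>x\<in>?P - X. (t + q) / 2))"
    by (rule prod_add) simp
  also have "\<dots> = (\<Sum>X\<in>Pow ?P. ((t - q) / 2) ^ card X * ((t + q) / 2) ^ card (?P - X) *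
      (order_sign X \<sigma> * order_sign X \<tau>))"
    by (intro sum.cong refl) (simp only: prod.distrib prod_constant order_sign_def s_def mult_ac)
  finally show ?thesis .
qed

text \<open>After multiplication by \<open>fact n\<close> and expansion of the weight, every set
  \<open>X\<close> of pairs contributes an undeformed Gram sum over the index set
  \<open>A \<times> S_n\<close>, with coefficients \<open>c i\<close> times
  \<open>order_sign X \<sigma>\<close>. The factor \<open>C X\<close> in front of it is nonnegative
  because both t - q and t + q are.\<close>

lemma word_kernel_gram_nonneg_degree:
  fixes g :: "'i \<Rightarrow> 'a::real_inner cplx list"
  assumes "\<bar>q\<bar> \<le> t" "finite A" "\<And>i. i \<in> A \<Longrightarrow> length (g i) = n"
  shows "0 \<le> Re (\<Sum>i\<in>A. \<Sum>j\<in>A. cnj (c i) * c j * word_kernel q t (g i) (g j))"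
proof -
  let ?S = "{\<sigma>. \<sigma> permutes {..<n}}" and ?P = "pairs_below n"
  define C where "C X = ((t - q) / 2) ^ card X * ((t + q) / 2) ^ card (?P - X)" for X
  define W where "W i \<sigma> j \<tau> = word_inner (permute_list \<sigma> (g i)) (permute_list \<tau> (g j))" for i j \<sigma> \<tau>
  have C: "0 \<le> C X" for X using assms(1) by (auto simp: C_def intro!: mult_nonneg_nonneg)
  have fS: "finite ?S" by (simp add: finite_permutations)
  define T where "T X = (\<Sum>x\<in>A \<times> ?S. \<Sum>y\<in>A \<times> ?S. cnj (c (fst x) * order_sign X (snd x)) *
    (c (fst y) * order_sign X (snd y)) *
    word_inner (permute_list (snd x) (g (fst x))) (permute_list (snd y) (g (fst y))))" for X
  have T: "0 \<le> Re (T X)" for X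
    unfolding T_def by (rule word_inner_gram_nonneg[where n = n]) (use assms fS in auto)
  have T': "T X = (\<Sum>i\<in>A. \<Sum>\<sigma>\<in>?S. \<Sum>j\<in>A. \<Sum>\<tau>\<in>?S.
    cnj (c i) * c j * of_real (order_sign X \<sigma> * order_sign X \<tau>) * W i \<sigma> j \<tau>)" for X
    unfolding T_def W_def sum.cartesian_product' by (simp add: mult_ac)
  have "fact n * (\<Sum>i\<in>A. \<Sum>j\<in>A. cnj (c i) * c j * word_kernel q t (g i) (g j)) =
    (\<Sum>i\<in>A. \<Sum>j\<in>A. cnj (c i) * c j * (fact n * word_kernel q t (g i) (g j)))"
    by (simp add: sum_distrib_left mult_ac)
  also have "\<dots> = (\<Sum>i\<in>A. \<Sum>j\<in>A. cnj (c i) * c j * (\<Sum>\<sigma>\<in>?S. \<Sum>\<tau>\<in>?S.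
    of_real (inv_weight q t n (\<tau> \<circ> inv \<sigma>)) * W i \<sigma> j \<tau>))"
    unfolding W_def by (intro sum.cong refl) (use assms(3) in \<open>simp add: word_kernel_symmetrized\<close>)
  also have "\<dots> = (\<Sum>i\<in>A. \<Sum>j\<in>A. \<Sum>\<sigma>\<in>?S. \<Sum>\<tau>\<in>?S. \<Sum>X\<in>Pow ?P. of_real (C X) *
    (cnj (c i) * c j * of_real (order_sign X \<sigma> * order_sign X \<tau>) * W i \<sigma> j \<tau>))"
    unfolding sum_distrib_left
    by (intro sum.cong refl)
      (simp add: inv_weight_comp_inv C_def sum_distrib_left sum_distrib_right mult_ac)
  also have "\<dots> = (\<Sum>i\<in>A. \<Sum>\<sigma>\<in>?S. \<Sum>j\<in>A. \<Sum>\<tau>\<in>?S. \<Sum>X\<in>Pow ?P. of_real (C X) *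
    (cnj (c i) * c j * of_real (order_sign X \<sigma> * order_sign X \<tau>) * W i \<sigma> j \<tau>))"
    by (intro sum.cong refl sum.swap)
  also have "\<dots> = (\<Sum>X\<in>Pow ?P. of_real (C X) * T X)"
    unfolding T' sum_distrib_left
    by (subst (4) sum.swap, subst (3) sum.swap, subst (2) sum.swap, subst sum.swap) (rule refl)
  finally have "fact n * (\<Sum>i\<in>A. \<Sum>j\<in>A. cnj (c i) * c j * word_kernel q t (g i) (g j)) =
     (\<Sum>X\<in>Pow ?P. of_real (C X) * T X)" .
  then have "Re (of_real (fact n) * (\<Sum>i\<in>A. \<Sum>j\<in>A. cnj (c i) * c j * word_kernel q t (g i) (g j))) =
     Re (\<Sum>X\<in>Pow ?P. of_real (C X) * T X)" unfolding of_real_fact by (rule arg_cong)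
  then have "fact n * Re (\<Sum>i\<in>A. \<Sum>j\<in>A. cnj (c i) * c j * word_kernel q t (g i) (g j)) =
     (\<Sum>X\<in>Pow ?P. C X * Re (T X))" by (simp only: Re_sum Re_complex_of_real Im_complex_of_real
      times_complex.sel mult_zero_left diff_zero)
  also have "\<dots> \<ge> 0" using C T by (intro sum_nonneg mult_nonneg_nonneg)
  finally have "fact n * 0 \<le> fact n * Re (\<Sum>i\<in>A. \<Sum>j\<in>A. cnj (c i) * c j * word_kernel q t (g i) (g j))"
    by (simp only: mult_zero_right)
  then show ?thesis by (rule mult_left_le_imp_le) (rule fact_gt_zero)
qed

lemma word_kernel_length_neq: "length v \<noteq> length w \<Longrightarrow> word_kernel q t v w = 0"
  by (simp add: word_kernel_def word_inner_def)

text \<open>Words of different lengths are orthogonal, so the Gram sum splits into blocks of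
  constant length.\<close>

lemma word_kernel_gram_nonneg:
  fixes A :: "'a::real_inner cplx list set"
  assumes "\<bar>q\<bar> \<le> t" "finite A"
  shows "0 \<le> Re (\<Sum>v\<in>A. \<Sum>w\<in>A. cnj (c v) * c w * word_kernel q t v w)"
proof -
  let ?A = "\<lambda>n. {v \<in> A. length v = n}"
  have "(\<Sum>v\<in>A. \<Sum>w\<in>A. cnj (c v) * c w * word_kernel q t v w) =
    (\<Sum>n\<in>length ` A. \<Sum>v\<in>?A n. \<Sum>w\<in>A. cnj (c v) * c w * word_kernel q t v w)"
    by (rule sum.image_gen) fact
  also have "\<dots> = (\<Sum>n\<in>length ` A. \<Sum>v\<in>?A n. \<Sum>w\<in>?A n. cnj (c v) * c w * word_kernel q t v w)"
    by (rule sum.cong[OF refl], rule sum.cong[OF refl], rule sum.mono_neutral_right) (use assms(2) in auto, metis word_kernel_length_neq)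
  finally have *: "(\<Sum>v\<in>A. \<Sum>w\<in>A. cnj (c v) * c w * word_kernel q t v w) =
    (\<Sum>n\<in>length ` A. \<Sum>v\<in>?A n. \<Sum>w\<in>?A n. cnj (c v) * c w * word_kernel q t v w)" .
  have "0 \<le> Re (\<Sum>v\<in>?A n. \<Sum>w\<in>?A n. cnj (c v) * c w * word_kernel q t v w)" for n
    by (rule word_kernel_gram_nonneg_degree[where g = "\<lambda>v. v" and n = n]) (use assms in auto)
  then show ?thesis unfolding * by (subst Re_sum) (intro sum_nonneg)
qed

text \<open>Hermitian symmetry rests on the weight being the same for a permutation and its inverse,
  which the expansion \<open>inv_weight_comp_inv\<close> shows by its symmetry in \<sigma> and
  \<tau>.\<close>

lemma word_kernel_commute: "word_kernel q t v w = cnj (word_kernel q t w v)"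
proof (cases "length v = length w")
  case True
  let ?S = "{\<sigma>. \<sigma> permutes {..<length w}}"
  have "cnj (fact (length w) * word_kernel q t w v) = (\<Sum>\<sigma>\<in>?S. \<Sum>\<tau>\<in>?S.
    of_real (inv_weight q t (length w) (\<tau> \<circ> inv \<sigma>)) * word_inner (permute_list \<tau> v) (permute_list \<sigma> w))"
    using True word_kernel_symmetrized[of w "length w" v q t] by (simp only: cnj_sum complex_cnj_mult complex_cnj_fact
        complex_cnj_complex_of_real word_inner_commute[symmetric])
  also have "\<dots> = (\<Sum>\<tau>\<in>?S. \<Sum>\<sigma>\<in>?S.
    of_real (inv_weight q t (length w) (\<tau> \<circ> inv \<sigma>)) * word_inner (permute_list \<tau> v) (permute_list \<sigma> w))"
    by (rule sum.swap)
  also have "\<dots> = (\<Sum>\<tau>\<in>?S. \<Sum>\<sigma>\<in>?S.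
    of_real (inv_weight q t (length w) (\<sigma> \<circ> inv \<tau>)) * word_inner (permute_list \<tau> v) (permute_list \<sigma> w))"
    by (intro sum.cong refl) (simp add: inv_weight_comp_inv mult_ac)
  also have "\<dots> = fact (length w) * word_kernel q t v w"
    using True by (simp add: word_kernel_symmetrized[of v "length w"])
  finally show ?thesis by simp
qed (simp add: word_kernel_length_neq)

subsection \<open>Expansion of the kernel along its first factor\<close>

text \<open>Inverse of the usual decomposition of a permutation of n + 1 points into the image
  \<open>k\<close> of the first point and the standardization \<sigma> of the remaining values;
  values from \<open>k\<close> on are shifted up to make room.\<close>

definition insert_first :: "nat \<Rightarrow> (nat \<Rightarrow> nat) \<Rightarrow> nat \<Rightarrow> nat" where
  "insert_first k \<sigma> i = (case i of 0 \<Rightarrow> k | Suc j \<Rightarrow> if \<sigma> j < k then \<sigma> j else Suc (\<sigma> j))"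

lemma insert_first_permutes:
  assumes "\<sigma> permutes {..<n}" "k \<le> n"
  shows "insert_first k \<sigma> permutes {..<Suc n}"
proof (rule bij_imp_permutes)
  have lt: "\<sigma> j < n \<longleftrightarrow> j < n" for j using permutes_in_image[OF assms(1), of j] by simp
  have outside: "\<sigma> j = j" if "\<not> j < n" for j using permutes_not_in[OF assms(1)] that by simp
  have inj: "\<sigma> i = \<sigma> j \<longleftrightarrow> i = j" for i j using permutes_inj[OF assms(1)] by (auto simp: inj_def)
  have "inj_on (insert_first k \<sigma>) {..<Suc n}"
    by (auto simp: inj_on_def insert_first_def inj split: nat.splits if_splits)
  moreover have "insert_first k \<sigma> ` {..<Suc n} \<subseteq> {..<Suc n}"
  proof (rule image_subsetI)
    fix i assume "i \<in> {..<Suc n}"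
    then show "insert_first k \<sigma> i \<in> {..<Suc n}"
      using lt[of "i - 1"] assms(2) by (cases i) (simp_all add: insert_first_def)
  qed
  ultimately show "bij_betw (insert_first k \<sigma>) {..<Suc n} {..<Suc n}"
    by (simp add: bij_betw_def endo_inj_surj)
  show "insert_first k \<sigma> i = i" if "i \<notin> {..<Suc n}" for i
    using that outside[of "i - 1"] assms(2) by (cases i) (simp_all add: insert_first_def)
qed

text \<open>Injectivity is read off pointwise; surjectivity follows by counting, both sides having
  (n + 1)! elements.\<close>

lemma bij_betw_insert_first:
  "bij_betw (\<lambda>(k, \<sigma>). insert_first k \<sigma>) ({..<Suc n} \<times> {\<sigma>. \<sigma> permutes {..<n}}) {\<pi>. \<pi> permutes {..<Suc n}}"
    (is "bij_betw ?f ?A ?B")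
proof -
  have "inj_on ?f ?A"
  proof (rule inj_onI, clarify)
    fix k \<sigma> k' \<sigma>'
    assume eq: "insert_first k \<sigma> = insert_first k' \<sigma>'"
    from fun_cong[OF eq, of 0] have "k = k'" by (simp add: insert_first_def)
    moreover have "\<sigma> j = \<sigma>' j" for j
      using fun_cong[OF eq, of "Suc j"] \<open>k = k'\<close> by (auto simp: insert_first_def split: if_splits)
    ultimately show "k = k' \<and> \<sigma> = \<sigma>'" by auto
  qed
  moreover have "?f ` ?A \<subseteq> ?B" by (auto intro: insert_first_permutes)
  moreover have "card ?A = card ?B" by (simp add: card_cartesian_product card_permutations)
  moreover have "finite ?B" by (simp add: finite_permutations)
  ultimately show ?thesis by (simp add: bij_betw_def card_image card_subset_eq)
qed

lemma card_permutes_less: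
  assumes "\<sigma> permutes {..<n}" "k \<le> n"
  shows "card {j. j < n \<and> \<sigma> j < k} = k" "card {j. j < n \<and> \<not> \<sigma> j < k} = n - k"
proof -
  have "\<sigma> ` {j. j < n \<and> \<sigma> j < k} = {..<k}"
  proof (intro equalityI subsetI)
    fix x assume "x \<in> {..<k}"
    then have "x < n" "x < k" using assms(2) by auto
    then have "inv \<sigma> x < n" "\<sigma> (inv \<sigma> x) = x"
      using permutes_inverses[OF assms(1)] inv_permutes_less[OF assms(1)] by auto
    then show "x \<in> \<sigma> ` {j. j < n \<and> \<sigma> j < k}" using \<open>x < k\<close> by (intro image_eqI[of _ _ "inv \<sigma> x"]) auto
  qed auto
  from card_image[OF inj_on_subset[OF permutes_inj[OF assms(1)]], of "{j. j < n \<and> \<sigma> j < k}"] this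
  show 1: "card {j. j < n \<and> \<sigma> j < k} = k" by simp
  have "card ({..<n} - {j. j < n \<and> \<sigma> j < k}) = n - k" by (subst card_Diff_subset) (use 1 in auto)
  also have "{..<n} - {j. j < n \<and> \<sigma> j < k} = {j. j < n \<and> \<not> \<sigma> j < k}" by auto
  finally show "card {j. j < n \<and> \<not> \<sigma> j < k} = n - k" .
qed

text \<open>The pairs starting at position 0 are inversions for the \<open>k\<close> smaller values
  and non-inversions for the other n - k; all remaining pairs keep their order since the shift of
  values is increasing.\<close>

lemma perm_inv_insert_first:
  assumes "\<sigma> permutes {..<n}" "k \<le> n"
  shows "perm_inv (Suc n) (insert_first k \<sigma>) = k + perm_inv n \<sigma>"
    and "perm_cinv (Suc n) (insert_first k \<sigma>) = (n - k) + perm_cinv n \<sigma>"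
proof -
  let ?g = "\<lambda>j. (0 :: nat, Suc j)" and ?h = "\<lambda>(i, j). (Suc i, Suc j)"
  have fin: "finite {(i, j). i < j \<and> j < n \<and> P i j}" for P
    by (rule finite_subset[of _ "{..<n} \<times> {..<n}"]) auto
  have card: "card (?g ` X \<union> ?h ` Y) = card X + card Y" if "finite X" "finite Y" for X and Y :: "(nat \<times> nat) set"
  proof -
    have "card (?g ` X \<union> ?h ` Y) = card (?g ` X) + card (?h ` Y)"
      by (rule card_Un_disjoint) (use that in auto)
    also have "card (?g ` X) = card X" by (rule card_image) (auto simp: inj_on_def)
    also have "card (?h ` Y) = card Y" by (rule card_image) (auto simp: inj_on_def)
    finally show ?thesis .
  qed
  have "{(i, j). i < j \<and> j < Suc n \<and> insert_first k \<sigma> i > insert_first k \<sigma> j} =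
    ?g ` {j. j < n \<and> \<sigma> j < k} \<union> ?h ` {(i, j). i < j \<and> j < n \<and> \<sigma> i > \<sigma> j}" (is "?L = _ \<union> _")
  proof (rule set_eqI, clarify)
    fix i j show "(i, j) \<in> ?L \<longleftrightarrow> (i, j) \<in> ?g ` {j. j < n \<and> \<sigma> j < k} \<union> ?h ` {(i, j). i < j \<and> j < n \<and> \<sigma> i > \<sigma> j}"
      by (cases i; cases j) (auto simp: insert_first_def image_iff)
  qed
  then show "perm_inv (Suc n) (insert_first k \<sigma>) = k + perm_inv n \<sigma>"
    unfolding perm_inv_def using card_permutes_less[OF assms] fin by (simp add: card)
  have "{(i, j). i < j \<and> j < Suc n \<and> insert_first k \<sigma> i < insert_first k \<sigma> j} =
    ?g ` {j. j < n \<and> \<not> \<sigma> j < k} \<union> ?h ` {(i, j). i < j \<and> j < n \<and> \<sigma> i < \<sigma> j}" (is "?L = _ \<union> _")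
  proof (rule set_eqI, clarify)
    fix i j show "(i, j) \<in> ?L \<longleftrightarrow> (i, j) \<in> ?g ` {j. j < n \<and> \<not> \<sigma> j < k} \<union> ?h ` {(i, j). i < j \<and> j < n \<and> \<sigma> i < \<sigma> j}"
      by (cases i; cases j) (auto simp: insert_first_def image_iff)
  qed
  then show "perm_cinv (Suc n) (insert_first k \<sigma>) = (n - k) + perm_cinv n \<sigma>"
    unfolding perm_cinv_def using card_permutes_less[OF assms] fin by (simp add: card)
qed

lemma permute_list_insert_first:
  assumes "\<sigma> permutes {..<n}" "k \<le> n" "length w = Suc n"
  shows "permute_list (insert_first k \<sigma>) w = w ! k # permute_list \<sigma> (word_delete k w)"
proof (rule nth_equalityI)
  show "length (permute_list (insert_first k \<sigma>) w) = length (w ! k # permute_list \<sigma> (word_delete k w))"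
    using assms by (simp add: length_word_delete)
next
  fix i assume "i < length (permute_list (insert_first k \<sigma>) w)"
  then have i: "i < Suc n" using assms by simp
  have lt: "\<sigma> j < n \<longleftrightarrow> j < n" for j using permutes_in_image[OF assms(1), of j] by simp
  have perm: "\<sigma> permutes {..<length (word_delete k w)}" using assms by (simp add: length_word_delete)
  have perm': "insert_first k \<sigma> permutes {..<length w}" using insert_first_permutes[OF assms(1,2)] assms(3) by simp
  show "permute_list (insert_first k \<sigma>) w ! i = (w ! k # permute_list \<sigma> (word_delete k w)) ! i"
  proof (cases i)
    case 0
    then show ?thesis using assms by (simp add: permute_list_nth[OF perm'] insert_first_def)
  next
    case (Suc j)
    then show ?thesis using i assms lt[of j]
      by (simp add: permute_list_nth[OF perm'] permute_list_nth[OF perm] length_word_delete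
          nth_word_delete insert_first_def)
  qed
qed

text \<open>The permutations are sorted by the letter of \<open>w\<close> they move to the front.
  The resulting weights are those of \<open>fock_annihilate\<close>, so this is the adjointness of
  creation and annihilation on elementary tensors.\<close>

lemma word_kernel_Cons:
  "word_kernel q t (x # v) w = (\<Sum>k<length w. of_real (q ^ k * t ^ (length w - 1 - k)) *
     cplx_inner x (w ! k) * word_kernel q t v (word_delete k w))"
proof (cases "length w")
  case 0
  then show ?thesis by (simp add: word_kernel_length_neq)
next
  case (Suc n)
  let ?S = "{\<sigma>. \<sigma> permutes {..<n}}"
  have weight: "q ^ perm_inv (Suc n) (insert_first k \<sigma>) * t ^ perm_cinv (Suc n) (insert_first k \<sigma>) =
    (q ^ k * t ^ (n - k)) * (q ^ perm_inv n \<sigma> * t ^ perm_cinv n \<sigma>)"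
    if "\<sigma> permutes {..<n}" "k \<le> n" for k \<sigma>
    by (simp only: perm_inv_insert_first[OF that] power_add mult_ac)
  have "word_kernel q t (x # v) w = (\<Sum>(k, \<sigma>)\<in>{..<Suc n} \<times> ?S.
    of_real (q ^ perm_inv (Suc n) (insert_first k \<sigma>) * t ^ perm_cinv (Suc n) (insert_first k \<sigma>)) *
    word_inner (x # v) (permute_list (insert_first k \<sigma>) w))"
    unfolding word_kernel_def Suc
    by (subst sum.reindex_bij_betw[OF bij_betw_insert_first, symmetric]) (simp add: case_prod_beta)
  also have "\<dots> = (\<Sum>k<Suc n. \<Sum>\<sigma>\<in>?S. of_real (q ^ k * t ^ (n - k)) * cplx_inner x (w ! k) *
    (of_real (q ^ perm_inv n \<sigma> * t ^ perm_cinv n \<sigma>) * word_inner v (permute_list \<sigma> (word_delete k w))))"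
    unfolding sum.cartesian_product[symmetric]
    by (intro sum.cong refl) (simp add: Suc weight permute_list_insert_first word_inner_Cons mult_ac)
  also have "\<dots> = (\<Sum>k<Suc n. of_real (q ^ k * t ^ (n - k)) * cplx_inner x (w ! k) *
     word_kernel q t v (word_delete k w))"
    unfolding sum_distrib_left[symmetric]
    by (intro sum.cong refl) (simp add: word_kernel_def length_word_delete Suc)
  finally show ?thesis by (simp add: Suc)
qed

section \<open>The deformed semi-inner product on the algebraic Fock space\<close>

lemma fock_tensor_expansion:
  obtains A c where "finite A" "\<xi> = (\<Sum>w\<in>A. fock_scale (c w) (tensor w))"
proof -
  obtain p where p: "\<xi> = abs_fock p"
    by (metis Quotient3_abs_rep Quotient3_fock)
  have "p = (\<Sum>w\<in>Poly_Mapping.keys p. Poly_Mapping.single w (Poly_Mapping.lookup p w))"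
    by (rule poly_mapping_eqI) (auto simp: lookup_sum lookup_single when_def in_keys_iff sum.If_cases
        Int_def split: if_splits)
  then have "\<xi> = (\<Sum>w\<in>Poly_Mapping.keys p. fock_scale (Poly_Mapping.lookup p w) (tensor w))"
    unfolding p by (metis (no_types, lifting) abs_fock_sum abs_fock_single sum.cong)
  then show ?thesis using that finite_keys by blast
qed

lemma fock_induct:
  assumes "P 0" "\<And>c w \<xi>. P \<xi> \<Longrightarrow> P (fock_scale c (tensor w) + \<xi>)"
  shows "P \<xi>"
proof -
  obtain A c where A: "finite A" and \<xi>: "\<xi> = (\<Sum>w\<in>A. fock_scale (c w) (tensor w))"
    by (rule fock_tensor_expansion)
  show ?thesis unfolding \<xi> using A by (induction A rule: finite_induct) (auto intro: assms)
qed

section \<open>Linear maps and sesquilinearity on the algebraic Fock space\<close>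

definition fock_linear :: "('a::real_inner fock \<Rightarrow> 'a fock) \<Rightarrow> bool" where
  "fock_linear T \<longleftrightarrow> (\<forall>x y. T (x + y) = T x + T y) \<and> (\<forall>c x. T (fock_scale c x) = fock_scale c (T x))"

lemma fock_linearD:
  assumes "fock_linear T"
  shows "T (x + y) = T x + T y" "T (fock_scale c x) = fock_scale c (T x)"
  using assms by (auto simp: fock_linear_def)

lemma fock_linear_0: "fock_linear T \<Longrightarrow> T 0 = 0"
  using fock_linearD(2)[of T 0 0] by simp

lemma fock_linear_diff: "fock_linear T \<Longrightarrow> T (x - y) = T x - T y"
  using fock_linearD(1)[of T "x - y" y] by simp

lemma fock_linear_uminus: "fock_linear T \<Longrightarrow> T (- x) = - T x"
  using fock_linear_diff[of T 0 x] by (simp add: fock_linear_0)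

lemma fock_linear_sum: "fock_linear T \<Longrightarrow> T (\<Sum>i\<in>A. f i) = (\<Sum>i\<in>A. T (f i))"
  by (induction A rule: infinite_finite_induct) (auto simp: fock_linear_0 fock_linearD)

lemma fock_linear_eqI:
  assumes "fock_linear S" "fock_linear T" "\<And>w. S (tensor w) = T (tensor w)"
  shows "S \<xi> = T \<xi>"
  by (induction \<xi> rule: fock_induct) (simp_all add: assms fock_linear_0 fock_linearD)

lemma fock_linear_sym: "fock_linear (fock_sym q t)"
  unfolding fock_linear_def
  by (intro conjI allI; transfer; simp add: free_extend_add free_extend_scale fock_rel_refl)

lemma fock_linear_create: "fock_linear (fock_create f)"
  unfolding fock_linear_def
  by (intro conjI allI; transfer; simp add: free_extend_add free_extend_scale fock_rel_refl)

lemma fock_linear_annihilate: "fock_linear (fock_annihilate q t f)"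
  unfolding fock_linear_def
  by (intro conjI allI; transfer; simp add: free_extend_add free_extend_scale fock_rel_refl)

text \<open>The function g(N) of the number operator N. It is used for t^N and for the square root
  of 1 - t^N.\<close>

lift_definition degree_mult :: "(nat \<Rightarrow> complex) \<Rightarrow> 'a::real_inner fock \<Rightarrow> 'a fock" is
  "\<lambda>g. free_extend (\<lambda>w. Poly_Mapping.single w (g (length w)))"
proof (rule free_extend_respects, goal_cases)
  case (1 g p r w i x y)
  then show ?case using fock_rel_single_add[of i w x y "g (length w)"] by simp
next
  case (2 g p r w i c x)
  then show ?case using fock_rel_single_scale[of i w c x "g (length w)"] by simp
qed

lemma fock_linear_degree_mult: "fock_linear (degree_mult g)"
  unfolding fock_linear_def
  by (intro conjI allI; transfer; simp add: free_extend_add free_extend_scale fock_rel_refl)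

lemma degree_mult_tensor: "degree_mult g (tensor w) = fock_scale (g (length w)) (tensor w)"
  by transfer (simp add: fock_rel_refl)

lemma fock_inner_commute: "fock_inner \<eta> \<xi> = cnj (fock_inner \<xi> \<eta>)"
  by transfer (rule free_inner_commute)

lemma fock_inner_add_right: "fock_inner \<eta> (x + y) = fock_inner \<eta> x + fock_inner \<eta> y"
  by transfer (rule free_inner_add_right)

lemma fock_inner_scale_right: "fock_inner \<eta> (fock_scale c x) = c * fock_inner \<eta> x"
  by transfer (rule free_inner_scale_right)

lemma fock_inner_add_left: "fock_inner (x + y) \<xi> = fock_inner x \<xi> + fock_inner y \<xi>"
  by (metis fock_inner_commute fock_inner_add_right complex_cnj_add)

lemma fock_inner_scale_left: "fock_inner (fock_scale c x) \<xi> = cnj c * fock_inner x \<xi>"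
  by (metis fock_inner_commute fock_inner_scale_right complex_cnj_mult)

lemma qt_inner_add_right: "qt_inner q t \<eta> (x + y) = qt_inner q t \<eta> x + qt_inner q t \<eta> y"
  by (simp add: qt_inner_def fock_linearD[OF fock_linear_sym] fock_inner_add_right)

lemma qt_inner_scale_right: "qt_inner q t \<eta> (fock_scale c x) = c * qt_inner q t \<eta> x"
  by (simp add: qt_inner_def fock_linearD[OF fock_linear_sym] fock_inner_scale_right)

lemma qt_inner_add_left: "qt_inner q t (x + y) \<xi> = qt_inner q t x \<xi> + qt_inner q t y \<xi>"
  by (simp add: qt_inner_def fock_inner_add_left)

lemma qt_inner_scale_left: "qt_inner q t (fock_scale c x) \<xi> = cnj c * qt_inner q t x \<xi>"
  by (simp add: qt_inner_def fock_inner_scale_left)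

lemma qt_inner_0_right [simp]: "qt_inner q t \<eta> 0 = 0"
  using qt_inner_scale_right[of q t \<eta> 0 0] by simp

lemma qt_inner_0_left [simp]: "qt_inner q t 0 \<xi> = 0"
  using qt_inner_scale_left[of q t 0 0 \<xi>] by simp

lemma qt_inner_diff_right: "qt_inner q t \<eta> (x - y) = qt_inner q t \<eta> x - qt_inner q t \<eta> y"
  using qt_inner_add_right[of q t \<eta> "x - y" y] by simp

lemma qt_inner_diff_left: "qt_inner q t (x - y) \<xi> = qt_inner q t x \<xi> - qt_inner q t y \<xi>"
  using qt_inner_add_left[of q t "x - y" y \<xi>] by simp

lemma qt_inner_sum_right: "qt_inner q t \<eta> (\<Sum>i\<in>A. f i) = (\<Sum>i\<in>A. qt_inner q t \<eta> (f i))"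
  by (induction A rule: infinite_finite_induct) (auto simp: qt_inner_add_right)

lemma qt_inner_sum_left: "qt_inner q t (\<Sum>i\<in>A. f i) \<xi> = (\<Sum>i\<in>A. qt_inner q t (f i) \<xi>)"
  by (induction A rule: infinite_finite_induct) (auto simp: qt_inner_add_left)

lemma fock_inner_sum_right: "fock_inner \<eta> (\<Sum>i\<in>A. f i) = (\<Sum>i\<in>A. fock_inner \<eta> (f i))"
proof (induction A rule: infinite_finite_induct)
  case (infinite A)
  then show ?case using fock_inner_scale_right[of \<eta> 0 0] by simp
next
  case empty
  then show ?case using fock_inner_scale_right[of \<eta> 0 0] by simp
qed (auto simp: fock_inner_add_right)

lemma qt_inner_tensor: "qt_inner q t (tensor v) (tensor w) = word_kernel q t v w"
  unfolding qt_inner_def fock_sym_tensor fock_inner_sum_right fock_inner_scale_right word_kernel_def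
    fock_inner_tensor word_inner_def ..

lemma qt_inner_eqI:
  assumes S: "fock_linear S" and T: "fock_linear T"
    and eq: "\<And>v w. qt_inner q t (S (tensor v)) (tensor w) = qt_inner q t (tensor v) (T (tensor w))"
  shows "qt_inner q t (S \<eta>) \<xi> = qt_inner q t \<eta> (T \<xi>)"
proof (induction \<eta> rule: fock_induct)
  case 1
  show ?case by (simp add: fock_linear_0[OF S])
next
  case (2 c v \<eta>)
  have "qt_inner q t (S (tensor v)) \<xi> = qt_inner q t (tensor v) (T \<xi>)"
    by (induction \<xi> rule: fock_induct)
      (simp_all add: fock_linear_0[OF T] fock_linearD[OF T] qt_inner_add_right qt_inner_scale_right eq)
  then show ?case
    using 2 by (simp add: fock_linearD[OF S] qt_inner_add_left qt_inner_scale_left)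
qed

lemma qt_inner_commute: "qt_inner q t \<eta> \<xi> = cnj (qt_inner q t \<xi> \<eta>)"
proof (induction \<eta> rule: fock_induct)
  case (2 c v \<eta>)
  have "qt_inner q t (tensor v) \<xi> = cnj (qt_inner q t \<xi> (tensor v))"
  proof (induction \<xi> rule: fock_induct)
    case (2 c w \<xi>)
    then show ?case
      by (simp add: qt_inner_add_right qt_inner_scale_right qt_inner_add_left qt_inner_scale_left
        qt_inner_tensor word_kernel_commute[of q t v w])
  qed simp
  then show ?case using 2
      by (simp add: qt_inner_add_right qt_inner_scale_right qt_inner_add_left qt_inner_scale_left)
qed simp

lemma qt_inner_create_left:
  "qt_inner q t (fock_create f \<eta>) \<xi> = qt_inner q t \<eta> (fock_annihilate q t f \<xi>)"
  by (rule qt_inner_eqI[OF fock_linear_create fock_linear_annihilate])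
    (simp add: fock_create_tensor fock_annihilate_tensor qt_inner_sum_right qt_inner_scale_right
      qt_inner_tensor word_kernel_Cons word_delete_def)

lemma qt_inner_create_right:
  "qt_inner q t \<eta> (fock_create f \<xi>) = qt_inner q t (fock_annihilate q t f \<eta>) \<xi>"
  using qt_inner_create_left[of q t f \<xi> \<eta>] by (metis qt_inner_commute)

lemma qt_inner_degree_mult:
  "qt_inner q t (degree_mult g \<eta>) \<xi> = qt_inner q t \<eta> (degree_mult (\<lambda>n. cnj (g n)) \<xi>)"
proof (rule qt_inner_eqI[OF fock_linear_degree_mult fock_linear_degree_mult])
  fix v w :: "'a cplx list"
  show "qt_inner q t (degree_mult g (tensor v)) (tensor w) =
    qt_inner q t (tensor v) (degree_mult (\<lambda>n. cnj (g n)) (tensor w))"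
    by (cases "length v = length w")
      (simp_all add: degree_mult_tensor qt_inner_scale_left qt_inner_scale_right qt_inner_tensor
        word_kernel_length_neq)
qed

text \<open>Annihilation applied to \<open>cplx_of f # w\<close> either deletes the new letter, with
  weight t to the length of \<open>w\<close>, or a later one. In the latter case the exponent of q
  has grown by one while that of t is unchanged.\<close>

lemma fock_annihilate_create:
  "fock_annihilate q t f (fock_create f \<xi>) =
     fock_scale (of_real q) (fock_create f (fock_annihilate q t f \<xi>)) +
     fock_scale (of_real (f \<bullet> f)) (degree_mult (\<lambda>n. of_real (t ^ n)) \<xi>)"
proof (rule fock_linear_eqI[where S = "\<lambda>\<xi>. fock_annihilate q t f (fock_create f \<xi>)"])
  fix w :: "'a cplx list"
  let ?n = "length w"
  have "fock_annihilate q t f (fock_create f (tensor w)) =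
     fock_scale (of_real (t ^ ?n) * of_real (f \<bullet> f)) (tensor w) +
     (\<Sum>k<?n. fock_scale (of_real (q ^ Suc k * t ^ (?n - Suc k)) * cplx_inner (cplx_of f) (w ! k))
        (tensor (cplx_of f # (take k w @ drop (Suc k) w))))"
    unfolding fock_create_tensor fock_annihilate_tensor
    by (simp add: sum.lessThan_Suc_shift del: sum.lessThan_Suc)
  also have "(\<Sum>k<?n. fock_scale (of_real (q ^ Suc k * t ^ (?n - Suc k)) * cplx_inner (cplx_of f) (w ! k))
        (tensor (cplx_of f # (take k w @ drop (Suc k) w)))) =
     fock_scale (of_real q) (fock_create f (fock_annihilate q t f (tensor w)))"
    by (simp add: fock_annihilate_tensor fock_linear_sum[OF fock_linear_create]
        fock_linearD[OF fock_linear_create] fock_create_tensor fock.scale_sum_right mult_ac)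
  finally show "fock_annihilate q t f (fock_create f (tensor w)) =
     fock_scale (of_real q) (fock_create f (fock_annihilate q t f (tensor w))) +
     fock_scale (of_real (f \<bullet> f)) (degree_mult (\<lambda>n. of_real (t ^ n)) (tensor w))"
    by (simp add: degree_mult_tensor mult_ac add.commute)
qed (simp_all add: fock_linear_def fock_linearD[OF fock_linear_create] fock.scale_right_distrib
    fock_linearD[OF fock_linear_annihilate] fock_linearD[OF fock_linear_degree_mult] mult_ac add_ac)

lemma qt_inner_self_nonneg:
  assumes "\<bar>q\<bar> \<le> t"
  shows "0 \<le> Re (qt_inner q t \<xi> \<xi>)"
proof -
  obtain A c where A: "finite A" and \<xi>: "\<xi> = (\<Sum>w\<in>A. fock_scale (c w) (tensor w))"
    by (rule fock_tensor_expansion)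
  have "qt_inner q t \<xi> \<xi> = (\<Sum>v\<in>A. \<Sum>w\<in>A. cnj (c v) * c w * word_kernel q t v w)"
    unfolding \<xi> qt_inner_sum_left qt_inner_sum_right
    by (simp add: qt_inner_scale_left qt_inner_scale_right qt_inner_tensor mult_ac) (rule sum.swap)
  then show ?thesis using word_kernel_gram_nonneg[OF assms A] by simp
qed

lemma qt_inner_self_real: "qt_inner q t \<xi> \<xi> = of_real (Re (qt_inner q t \<xi> \<xi>))"
  using qt_inner_commute[of q t \<xi> \<xi>] by (simp add: complex_eq_iff)

section \<open>The seminorm and the Cauchy-Schwarz inequality\<close>

locale qt_param =
  fixes q t :: real
  assumes abs_q_less_t: "\<bar>q\<bar> < t" and t_le_1: "t \<le> 1"
begin

lemma t_pos: "0 < t" using abs_q_less_t by simp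

lemma qt_inner_self_ge_0: "0 \<le> Re (qt_inner q t \<xi> \<xi>)"
  by (rule qt_inner_self_nonneg) (use abs_q_less_t in simp)

lemma qt_norm_square: "(qt_norm q t \<xi>)\<^sup>2 = Re (qt_inner q t \<xi> \<xi>)"
  unfolding qt_norm_def using qt_inner_self_ge_0[of \<xi>] by simp

lemma qt_norm_nonneg [simp]: "0 \<le> qt_norm q t \<xi>"
  unfolding qt_norm_def using qt_inner_self_ge_0[of \<xi>] by simp

lemma qt_inner_self: "qt_inner q t \<xi> \<xi> = of_real ((qt_norm q t \<xi>)\<^sup>2)"
  unfolding qt_norm_square by (rule qt_inner_self_real)

lemma qt_norm_0 [simp]: "qt_norm q t 0 = 0"
  by (simp add: qt_norm_def)

lemma qt_norm_scale: "qt_norm q t (fock_scale c \<xi>) = cmod c * qt_norm q t \<xi>"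
proof (rule power2_eq_imp_eq)
  have "qt_inner q t (fock_scale c \<xi>) (fock_scale c \<xi>) = of_real ((cmod c * qt_norm q t \<xi>)\<^sup>2)"
    by (simp add: qt_inner_scale_left qt_inner_scale_right qt_inner_self power_mult_distrib
        complex_norm_square[unfolded of_real_power] mult_ac)
  then show "(qt_norm q t (fock_scale c \<xi>))\<^sup>2 = (cmod c * qt_norm q t \<xi>)\<^sup>2"
    by (simp only: qt_norm_square Re_complex_of_real)
qed auto

text \<open>The form is only known to be semidefinite, so \<xi> cannot always be normalized. The
  multiplier \<open>?l\<close> aligns the phase of the cross term, leaving a real quadratic in
  \<open>r\<close>; its minimum is used when b > 0.\<close>

lemma qt_Cauchy_Schwarz: "cmod (qt_inner q t \<eta> \<xi>) \<le> qt_norm q t \<eta> * qt_norm q t \<xi>"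
proof -
  define B where "B = qt_inner q t \<eta> \<xi>"
  define a b where "a = (qt_norm q t \<eta>)\<^sup>2" and "b = (qt_norm q t \<xi>)\<^sup>2"
  have B': "qt_inner q t \<xi> \<eta> = cnj B" unfolding B_def by (rule qt_inner_commute)
  have ab: "qt_inner q t \<eta> \<eta> = of_real a" "qt_inner q t \<xi> \<xi> = of_real b"
    by (simp_all add: a_def b_def qt_inner_self)
  have quad: "0 \<le> a - 2 * r * (cmod B)\<^sup>2 + r\<^sup>2 * (cmod B)\<^sup>2 * b" for r
  proof -
    let ?l = "- of_real r * cnj B"
    have "qt_inner q t (\<eta> + fock_scale ?l \<xi>) (\<eta> + fock_scale ?l \<xi>) =
      of_real a - 2 * of_real r * (B * cnj B) + (of_real r)\<^sup>2 * (B * cnj B) * of_real b"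
      by (simp add: qt_inner_diff_left qt_inner_diff_right qt_inner_scale_left qt_inner_scale_right
          ab B_def[symmetric] B' algebra_simps power2_eq_square)
    also have "\<dots> = of_real (a - 2 * r * (cmod B)\<^sup>2 + r\<^sup>2 * (cmod B)\<^sup>2 * b)"
      by (simp add: complex_norm_square[unfolded of_real_power])
    finally have "Re (qt_inner q t (\<eta> + fock_scale ?l \<xi>) (\<eta> + fock_scale ?l \<xi>)) =
      a - 2 * r * (cmod B)\<^sup>2 + r\<^sup>2 * (cmod B)\<^sup>2 * b" by simp
    then show ?thesis using qt_inner_self_ge_0 by metis
  qed
  have "(cmod B)\<^sup>2 \<le> a * b"
  proof (cases "b = 0")
    case True
    have "(cmod B)\<^sup>2 = 0"
    proof (rule ccontr)
      assume "(cmod B)\<^sup>2 \<noteq> 0"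
      \<comment> \<open>With b = 0 this choice of \<open>r\<close> makes the quadratic equal to
        -1.\<close>
      then show False using quad[of "(a + 1) / (2 * (cmod B)\<^sup>2)"] True by simp
    qed
    then show ?thesis using True by simp
  next
    case False
    then have "0 < b" by (simp add: b_def)
    moreover have "0 \<le> a - (cmod B)\<^sup>2 / b"
      using quad[of "1 / b"] \<open>0 < b\<close> by (simp add: power2_eq_square field_simps)
    ultimately show ?thesis by (simp add: field_simps)
  qed
  then have "(cmod B)\<^sup>2 \<le> (qt_norm q t \<eta> * qt_norm q t \<xi>)\<^sup>2"
    by (simp add: a_def b_def power_mult_distrib)
  then show ?thesis unfolding B_def by (rule power2_le_imp_le) simp
qed

lemma qt_norm_triangle: "qt_norm q t (\<eta> + \<xi>) \<le> qt_norm q t \<eta> + qt_norm q t \<xi>"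
proof (rule power2_le_imp_le)
  have "Re (qt_inner q t \<eta> \<xi>) \<le> qt_norm q t \<eta> * qt_norm q t \<xi>"
    using qt_Cauchy_Schwarz[of \<eta> \<xi>] complex_Re_le_cmod order_trans by blast
  moreover have "Re (qt_inner q t \<xi> \<eta>) = Re (qt_inner q t \<eta> \<xi>)"
    by (subst qt_inner_commute) simp
  ultimately show "(qt_norm q t (\<eta> + \<xi>))\<^sup>2 \<le> (qt_norm q t \<eta> + qt_norm q t \<xi>)\<^sup>2"
    by (simp add: qt_norm_square qt_inner_add_left qt_inner_add_right power2_sum)
qed simp

lemma qt_norm_minus: "qt_norm q t (- \<xi>) = qt_norm q t \<xi>"
  using qt_norm_scale[of "-1" \<xi>] by simp

lemma qt_norm_minus_commute: "qt_norm q t (\<eta> - \<xi>) = qt_norm q t (\<xi> - \<eta>)"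
  using qt_norm_minus[of "\<eta> - \<xi>"] by simp

text \<open>Since t \<le> 1, the operator 1 - t^N is the square of the self-adjoint
  \<open>degree_mult ?g\<close>, so the difference of the two sides is a square norm. This replaces
  an orthogonal decomposition by degree.\<close>

lemma qt_norm_degree_mult_le:
  "Re (qt_inner q t \<xi> (degree_mult (\<lambda>n. of_real (t ^ n)) \<xi>)) \<le> (qt_norm q t \<xi>)\<^sup>2"
proof -
  let ?g = "\<lambda>n. of_real (sqrt (1 - t ^ n))" and ?t = "\<lambda>n. complex_of_real (t ^ n)"
  have eq: "degree_mult ?g (degree_mult ?g \<xi>) + degree_mult ?t \<xi> = \<xi>"
  proof (rule fock_linear_eqI[where T = "\<lambda>\<xi>. \<xi>" and S = "\<lambda>\<xi>. degree_mult ?g (degree_mult ?g \<xi>) + degree_mult ?t \<xi>"])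
    fix w :: "'a cplx list"
    have "t ^ length w \<le> 1" using t_pos t_le_1 by (simp add: power_le_one)
    then have "complex_of_real (sqrt (1 - t ^ length w)) * of_real (sqrt (1 - t ^ length w)) + of_real (t ^ length w) = 1"
      by (simp flip: of_real_mult of_real_add)
    then show "degree_mult ?g (degree_mult ?g (tensor w)) + degree_mult ?t (tensor w) = tensor w"
      by (simp only: degree_mult_tensor fock_linearD[OF fock_linear_degree_mult] fock.scale_scale
          fock.scale_left_distrib[symmetric] fock.scale_one)
  qed (simp_all add: fock_linear_def fock_linearD[OF fock_linear_degree_mult] fock.scale_right_distrib add_ac)
  have "0 \<le> Re (qt_inner q t (degree_mult ?g \<xi>) (degree_mult ?g \<xi>))"
    by (rule qt_inner_self_ge_0)
  also have "qt_inner q t (degree_mult ?g \<xi>) (degree_mult ?g \<xi>) = qt_inner q t \<xi> (degree_mult ?g (degree_mult ?g \<xi>))"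
    by (subst qt_inner_degree_mult) simp
  also have "\<dots> = qt_inner q t \<xi> (\<xi> - degree_mult ?t \<xi>)"
    using eq by (metis add_diff_cancel_right')
  finally show ?thesis by (simp add: qt_inner_diff_right qt_norm_square)
qed

end

subsection \<open>Boundedness of the creation and annihilation operators\<close>

abbreviation degree_at_most :: "nat \<Rightarrow> 'a::real_inner fock set" where
  "degree_at_most m \<equiv> fock.span (tensor ` {w. length w \<le> m})"

lemma degree_at_most_exists: "\<exists>m. \<xi> \<in> degree_at_most m"
proof -
  obtain A c where A: "finite A" and \<xi>: "\<xi> = (\<Sum>w\<in>A. fock_scale (c w) (tensor w))"
    by (rule fock_tensor_expansion)
  have "\<xi> \<in> degree_at_most (Max (length ` A))"
    unfolding \<xi> using A by (intro fock.span_sum fock.span_scale fock.span_base imageI) simp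
  then show ?thesis ..
qed

lemma annihilate_degree_at_most:
  assumes "\<xi> \<in> degree_at_most m"
  shows "fock_annihilate q t f \<xi> \<in> degree_at_most (m - 1)"
  using assms
proof (induction rule: fock.span_induct_alt)
  case base
  show ?case by (simp add: fock_linear_0[OF fock_linear_annihilate] fock.span_zero)
next
  case (step c x y)
  then obtain w where w: "x = tensor w" "length w \<le> m" by auto
  have "fock_annihilate q t f x \<in> degree_at_most (m - 1)"
    unfolding w(1) fock_annihilate_tensor using w(2)
    by (intro fock.span_sum fock.span_scale fock.span_base) auto
  then show ?case using step
    by (simp add: fock_linearD[OF fock_linear_annihilate] fock.span_add fock.span_scale)
qed

lemma annihilate_degree_0:
  assumes "\<xi> \<in> degree_at_most 0"
  shows "fock_annihilate q t f \<xi> = 0"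
  using assms
  by (induction rule: fock.span_induct_alt)
    (auto simp: fock_linear_0[OF fock_linear_annihilate] fock_linearD[OF fock_linear_annihilate]
      fock_annihilate_tensor)

context qt_param
begin

text \<open>The usual bound for an adjoint, localized at one vector: creation has to be controlled
  only on \<open>fock_annihilate q t f \<xi>\<close>, which is what an induction on the degree can
  supply.\<close>

lemma annihilate_bound_from_create:
  assumes "qt_norm q t (fock_create f (fock_annihilate q t f \<xi>)) \<le> C * qt_norm q t (fock_annihilate q t f \<xi>)"
    and "0 \<le> C"
  shows "qt_norm q t (fock_annihilate q t f \<xi>) \<le> C * qt_norm q t \<xi>"
proof -
  let ?\<eta> = "fock_annihilate q t f \<xi>"
  have "(qt_norm q t ?\<eta>)\<^sup>2 = Re (qt_inner q t (fock_create f ?\<eta>) \<xi>)"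
    by (simp add: qt_norm_square qt_inner_create_left)
  also have "\<dots> \<le> qt_norm q t (fock_create f ?\<eta>) * qt_norm q t \<xi>"
    using qt_Cauchy_Schwarz complex_Re_le_cmod order_trans by blast
  also have "\<dots> \<le> (C * qt_norm q t ?\<eta>) * qt_norm q t \<xi>"
    by (intro mult_right_mono assms(1)) simp
  finally have "qt_norm q t ?\<eta> * qt_norm q t ?\<eta> \<le> qt_norm q t ?\<eta> * (C * qt_norm q t \<xi>)"
    by (simp add: power2_eq_square mult_ac)
  then show ?thesis
    using mult_le_cancel_left_pos[of "qt_norm q t ?\<eta>"] qt_norm_nonneg[of ?\<eta>] assms(2)
      mult_nonneg_nonneg[of C "qt_norm q t \<xi>"]
    by (cases "qt_norm q t ?\<eta> = 0") auto
qed

text \<open>By \<open>a(f) a(f)\<^sup>* = q a(f)\<^sup>* a(f) + \<parallel>f\<parallel>\<^sup>2 t\<^sup>N\<close>, a bound on degree at most \<open>m\<close> yields one on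
  degree at most \<open>m + 1\<close>, since \<open>a(f)\<close> lowers the degree.\<close>

lemma create_bound_degree:
  assumes "\<xi> \<in> degree_at_most m"
  shows "(qt_norm q t (fock_create f \<xi>))\<^sup>2 \<le> (\<Sum>i\<le>m. \<bar>q\<bar> ^ i) * (norm f)\<^sup>2 * (qt_norm q t \<xi>)\<^sup>2"
  using assms
proof (induction m arbitrary: \<xi>)
  case (0 \<xi>)
  have "(qt_norm q t (fock_create f \<xi>))\<^sup>2 =
      (f \<bullet> f) * Re (qt_inner q t \<xi> (degree_mult (\<lambda>n. of_real (t ^ n)) \<xi>))"
    by (simp add: qt_norm_square qt_inner_create_left fock_annihilate_create annihilate_degree_0[OF 0]
        fock_linear_0[OF fock_linear_create] qt_inner_scale_right del: of_real_power)
  then show ?case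
    using mult_left_mono[OF qt_norm_degree_mult_le[of \<xi>], of "f \<bullet> f"]
    by (simp add: dot_square_norm)
next
  case (Suc m \<xi>)
  let ?\<eta> = "fock_annihilate q t f \<xi>" and ?C = "(\<Sum>i\<le>m. \<bar>q\<bar> ^ i)"
  have C: "0 \<le> ?C" by (simp add: sum_nonneg)
  have "(qt_norm q t (fock_create f ?\<eta>))\<^sup>2 \<le> ?C * (norm f)\<^sup>2 * (qt_norm q t ?\<eta>)\<^sup>2"
    using annihilate_degree_at_most[OF Suc.prems] by (intro Suc.IH) simp
  also have "\<dots> = (sqrt ?C * norm f * qt_norm q t ?\<eta>)\<^sup>2"
    using C by (simp add: power_mult_distrib)
  finally have "qt_norm q t (fock_create f ?\<eta>) \<le> (sqrt ?C * norm f) * qt_norm q t ?\<eta>"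
    by (rule power2_le_imp_le) (simp add: C)
  then have "qt_norm q t ?\<eta> \<le> (sqrt ?C * norm f) * qt_norm q t \<xi>"
    by (rule annihilate_bound_from_create) (simp add: C)
  then have "(qt_norm q t ?\<eta>)\<^sup>2 \<le> ((sqrt ?C * norm f) * qt_norm q t \<xi>)\<^sup>2"
    by (rule power_mono) simp
  then have \<eta>: "(qt_norm q t ?\<eta>)\<^sup>2 \<le> ?C * (norm f)\<^sup>2 * (qt_norm q t \<xi>)\<^sup>2"
    using C by (simp add: power_mult_distrib)
  have "(qt_norm q t (fock_create f \<xi>))\<^sup>2 = q * (qt_norm q t ?\<eta>)\<^sup>2 +
      (f \<bullet> f) * Re (qt_inner q t \<xi> (degree_mult (\<lambda>n. of_real (t ^ n)) \<xi>))"
    unfolding qt_norm_square qt_inner_create_left[of q t f \<xi> "fock_create f \<xi>"]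
    by (simp add: fock_annihilate_create qt_inner_add_right qt_inner_scale_right qt_inner_create_right
        del: of_real_power)
  \<comment> \<open>Passing to |q| treats both signs of q together; for negative q the first term
    was already at most 0.\<close>
  also have "\<dots> \<le> \<bar>q\<bar> * (qt_norm q t ?\<eta>)\<^sup>2 + (norm f)\<^sup>2 * (qt_norm q t \<xi>)\<^sup>2"
    using mult_left_mono[OF qt_norm_degree_mult_le[of \<xi>], of "f \<bullet> f"]
    by (intro add_mono mult_right_mono) (auto simp: dot_square_norm)
  also have "\<dots> \<le> \<bar>q\<bar> * (?C * (norm f)\<^sup>2 * (qt_norm q t \<xi>)\<^sup>2) + (norm f)\<^sup>2 * (qt_norm q t \<xi>)\<^sup>2"
    using \<eta> by (intro add_mono mult_left_mono) auto
  also have "\<dots> = (\<bar>q\<bar> * ?C + 1) * (norm f)\<^sup>2 * (qt_norm q t \<xi>)\<^sup>2"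
    by (simp add: algebra_simps)
  also have "\<bar>q\<bar> * ?C + 1 = (\<Sum>i\<le>Suc m. \<bar>q\<bar> ^ i)"
    by (subst sum.atMost_Suc_shift) (simp add: sum_distrib_left)
  finally show ?case .
qed

text \<open>The geometric series bounds all the sums of \<open>create_bound_degree\<close> at once,
  and the square root undoes the squares there. The series converges because |q| < t \<le>
  1.\<close>

definition create_const :: "'a::real_inner \<Rightarrow> real" where
  "create_const f = sqrt (1 / (1 - \<bar>q\<bar>)) * norm f"

lemma create_const_nonneg: "0 \<le> create_const f"
  using abs_q_less_t t_le_1 by (simp add: create_const_def)

lemma create_bound: "qt_norm q t (fock_create f \<xi>) \<le> create_const f * qt_norm q t \<xi>"
proof -
  obtain m where m: "\<xi> \<in> degree_at_most m" using degree_at_most_exists by blast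
  have q: "\<bar>q\<bar> < 1" using abs_q_less_t t_le_1 by simp
  have "(\<Sum>i\<le>m. \<bar>q\<bar> ^ i) \<le> suminf (\<lambda>i. \<bar>q\<bar> ^ i)"
    by (rule sum_le_suminf) (use q in auto)
  then have "(\<Sum>i\<le>m. \<bar>q\<bar> ^ i) \<le> 1 / (1 - \<bar>q\<bar>)"
    using q suminf_geometric[of "\<bar>q\<bar>"] by simp
  then have "(\<Sum>i\<le>m. \<bar>q\<bar> ^ i) * ((norm f)\<^sup>2 * (qt_norm q t \<xi>)\<^sup>2) \<le> 1 / (1 - \<bar>q\<bar>) * ((norm f)\<^sup>2 * (qt_norm q t \<xi>)\<^sup>2)"
    by (rule mult_right_mono) simp
  with create_bound_degree[OF m, of f] have "(qt_norm q t (fock_create f \<xi>))\<^sup>2 \<le> (create_const f * qt_norm q t \<xi>)\<^sup>2"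
    using q by (simp add: create_const_def power_mult_distrib mult_ac)
  then show ?thesis by (rule power2_le_imp_le) (simp add: create_const_nonneg)
qed

lemma annihilate_bound: "qt_norm q t (fock_annihilate q t f \<xi>) \<le> create_const f * qt_norm q t \<xi>"
  by (rule annihilate_bound_from_create[OF create_bound create_const_nonneg])

subsection \<open>The completion\<close>

definition fock_bounded :: "('a::real_inner fock \<Rightarrow> 'a fock) \<Rightarrow> bool" where
  "fock_bounded T \<longleftrightarrow> fock_linear T \<and> (\<exists>C. \<forall>\<xi>. qt_norm q t (T \<xi>) \<le> C * qt_norm q t \<xi>)"

lemma fock_bounded_linear: "fock_bounded T \<Longrightarrow> fock_linear T"
  by (simp add: fock_bounded_def)

lemma fock_bounded_create: "fock_bounded (fock_create f)"
  unfolding fock_bounded_def using fock_linear_create create_bound by blast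

lemma fock_bounded_annihilate: "fock_bounded (fock_annihilate q t f)"
  unfolding fock_bounded_def using fock_linear_annihilate annihilate_bound by blast

lemma fock_bounded_add:
  assumes "fock_bounded S" "fock_bounded T"
  shows "fock_bounded (\<lambda>\<xi>. S \<xi> + T \<xi>)"
proof -
  obtain C D where C: "\<And>\<xi>. qt_norm q t (S \<xi>) \<le> C * qt_norm q t \<xi>" and D: "\<And>\<xi>. qt_norm q t (T \<xi>) \<le> D * qt_norm q t \<xi>"
    using assms unfolding fock_bounded_def by blast
  have "qt_norm q t (S \<xi> + T \<xi>) \<le> (C + D) * qt_norm q t \<xi>" for \<xi>
    using qt_norm_triangle[of "S \<xi>" "T \<xi>"] C[of \<xi>] D[of \<xi>] by (simp add: distrib_right)
  moreover have "fock_linear (\<lambda>\<xi>. S \<xi> + T \<xi>)"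
    using assms by (auto simp: fock_bounded_def fock_linear_def fock.scale_right_distrib add_ac)
  ultimately show ?thesis unfolding fock_bounded_def by blast
qed

lemma qt_norm_diff_triangle: "qt_norm q t (x - z) \<le> qt_norm q t (x - y) + qt_norm q t (y - z)"
  using qt_norm_triangle[of "x - y" "y - z"] by simp

lemma qt_norm_diff_ineq: "\<bar>qt_norm q t x - qt_norm q t y\<bar> \<le> qt_norm q t (x - y)"
  using qt_norm_triangle[of "x - y" y] qt_norm_triangle[of "y - x" x] qt_norm_minus_commute[of x y] by simp

lemma cauchy_seqsD:
  "x \<in> cauchy_seqs q t \<Longrightarrow> 0 < e \<Longrightarrow> \<exists>N. \<forall>m\<ge>N. \<forall>n\<ge>N. qt_norm q t (x m - x n) < e"
  by (simp add: cauchy_seqs_def)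

lemma cauchy_seqs_norm_Cauchy:
  assumes "x \<in> cauchy_seqs q t"
  shows "Cauchy (\<lambda>n. qt_norm q t (x n))"
  unfolding Cauchy_def
proof (intro allI impI)
  fix e :: real assume "0 < e"
  then obtain N where "\<forall>m\<ge>N. \<forall>n\<ge>N. qt_norm q t (x m - x n) < e" using cauchy_seqsD[OF assms] by blast
  then show "\<exists>M. \<forall>m\<ge>M. \<forall>n\<ge>M. dist (qt_norm q t (x m)) (qt_norm q t (x n)) < e"
    by (metis dist_real_def order_le_less_trans qt_norm_diff_ineq)
qed

lemma cauchy_seqs_bounded:
  assumes "x \<in> cauchy_seqs q t"
  obtains B where "0 < B" "\<And>n. qt_norm q t (x n) \<le> B"
proof -
  have "Bseq (\<lambda>n. qt_norm q t (x n))"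
    using cauchy_seqs_norm_Cauchy[OF assms] by (rule Cauchy_Bseq)
  then show ?thesis using that by (auto elim!: BseqE)
qed

lemma cauchy_seqs_const: "(\<lambda>_. \<xi>) \<in> cauchy_seqs q t"
  by (simp add: cauchy_seqs_def)

lemma cauchy_seqs_add:
  assumes "x \<in> cauchy_seqs q t" "y \<in> cauchy_seqs q t"
  shows "(\<lambda>n. x n + y n) \<in> cauchy_seqs q t"
  unfolding cauchy_seqs_def
proof (intro CollectI allI impI)
  fix e :: real assume "0 < e"
  then have "0 < e / 2" by simp
  then obtain M N where M: "\<forall>m\<ge>M. \<forall>n\<ge>M. qt_norm q t (x m - x n) < e / 2"
    and N: "\<forall>m\<ge>N. \<forall>n\<ge>N. qt_norm q t (y m - y n) < e / 2"
    using cauchy_seqsD assms by metis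
  have "qt_norm q t (x m + y m - (x n + y n)) < e" if "m \<ge> max M N" "n \<ge> max M N" for m n
    using qt_norm_triangle[of "x m - x n" "y m - y n"] M[rule_format, of m n] N[rule_format, of m n] that
    by (simp add: algebra_simps)
  then show "\<exists>N. \<forall>m\<ge>N. \<forall>n\<ge>N. qt_norm q t (x m + y m - (x n + y n)) < e" by blast
qed

lemma cauchy_seqs_bounded_image:
  assumes "fock_bounded T" "x \<in> cauchy_seqs q t"
  shows "(\<lambda>n. T (x n)) \<in> cauchy_seqs q t"
  unfolding cauchy_seqs_def
proof (intro CollectI allI impI)
  fix e :: real assume "0 < e"
  obtain C where C: "\<And>\<xi>. qt_norm q t (T \<xi>) \<le> C * qt_norm q t \<xi>"
    using assms(1) by (auto simp: fock_bounded_def)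
  have "0 < e / (\<bar>C\<bar> + 1)" using \<open>0 < e\<close> by simp
  then obtain N where N: "\<forall>m\<ge>N. \<forall>n\<ge>N. qt_norm q t (x m - x n) < e / (\<bar>C\<bar> + 1)"
    using cauchy_seqsD[OF assms(2)] by blast
  have "qt_norm q t (T (x m) - T (x n)) < e" if "m \<ge> N" "n \<ge> N" for m n
  proof -
    have "qt_norm q t (T (x m) - T (x n)) \<le> C * qt_norm q t (x m - x n)"
      using C[of "x m - x n"] by (simp add: fock_linear_diff[OF fock_bounded_linear[OF assms(1)]])
    also have "\<dots> \<le> (\<bar>C\<bar> + 1) * qt_norm q t (x m - x n)" by (rule mult_right_mono) auto
    also have "\<dots> < e" using N[rule_format, OF that] by (simp add: field_simps)
    finally show ?thesis .
  qed
  then show "\<exists>N. \<forall>m\<ge>N. \<forall>n\<ge>N. qt_norm q t (T (x m) - T (x n)) < e" by blast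
qed

lemma fock_bounded_scale: "fock_bounded (fock_scale c)"
  unfolding fock_bounded_def fock_linear_def
  by (auto simp: fock.scale_right_distrib mult.commute qt_norm_scale)

lemma null_relD:
  assumes "(x, y) \<in> null_rel q t"
  shows "x \<in> cauchy_seqs q t" "y \<in> cauchy_seqs q t" "(\<lambda>n. qt_norm q t (x n - y n)) \<longlonglongrightarrow> 0"
  using assms by (auto simp: null_rel_def)

lemma equiv_null_rel: "equiv (cauchy_seqs q t) (null_rel q t)"
proof (rule equivI)
  show "null_rel q t \<subseteq> cauchy_seqs q t \<times> cauchy_seqs q t" by (auto simp: null_rel_def)
  show "refl_on (cauchy_seqs q t) (null_rel q t)" by (auto simp: refl_on_def null_rel_def)
  show "sym (null_rel q t)"
    by (auto simp: sym_def null_rel_def qt_norm_minus_commute)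
  show "trans (null_rel q t)"
  proof (rule transI)
    fix x y z assume xy: "(x, y) \<in> null_rel q t" and yz: "(y, z) \<in> null_rel q t"
    have "(\<lambda>n. qt_norm q t (x n - z n)) \<longlonglongrightarrow> 0"
    proof (rule Lim_null_comparison)
      show "\<forall>\<^sub>F n in sequentially. norm (qt_norm q t (x n - z n)) \<le> qt_norm q t (x n - y n) + qt_norm q t (y n - z n)"
        using qt_norm_diff_triangle by (auto intro!: always_eventually)
      show "(\<lambda>n. qt_norm q t (x n - y n) + qt_norm q t (y n - z n)) \<longlonglongrightarrow> 0"
        using tendsto_add[OF null_relD(3)[OF xy] null_relD(3)[OF yz]] by simp
    qed
    then show "(x, z) \<in> null_rel q t" using xy yz by (auto simp: null_rel_def)
  qed
qed

lemma null_rel_add: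
  assumes "(x, x') \<in> null_rel q t" "(y, y') \<in> null_rel q t"
  shows "(\<lambda>n. x n + y n, \<lambda>n. x' n + y' n) \<in> null_rel q t"
proof -
  have "(\<lambda>n. qt_norm q t (x n + y n - (x' n + y' n))) \<longlonglongrightarrow> 0"
  proof (rule Lim_null_comparison)
    show "\<forall>\<^sub>F n in sequentially. norm (qt_norm q t (x n + y n - (x' n + y' n))) \<le> qt_norm q t (x n - x' n) + qt_norm q t (y n - y' n)"
    proof (intro always_eventually allI)
      fix n show "norm (qt_norm q t (x n + y n - (x' n + y' n))) \<le> qt_norm q t (x n - x' n) + qt_norm q t (y n - y' n)"
        using qt_norm_triangle[of "x n - x' n" "y n - y' n"] by (simp add: algebra_simps)
    qed
    show "(\<lambda>n. qt_norm q t (x n - x' n) + qt_norm q t (y n - y' n)) \<longlonglongrightarrow> 0"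
      using tendsto_add[OF null_relD(3)[OF assms(1)] null_relD(3)[OF assms(2)]] by simp
  qed
  then show ?thesis using assms by (auto simp: null_rel_def cauchy_seqs_add)
qed

lemma null_rel_bounded_image:
  assumes "fock_bounded T" "(x, x') \<in> null_rel q t"
  shows "(\<lambda>n. T (x n), \<lambda>n. T (x' n)) \<in> null_rel q t"
proof -
  obtain C where C: "\<And>\<xi>. qt_norm q t (T \<xi>) \<le> C * qt_norm q t \<xi>"
    using assms(1) by (auto simp: fock_bounded_def)
  have "(\<lambda>n. qt_norm q t (T (x n) - T (x' n))) \<longlonglongrightarrow> 0"
  proof (rule Lim_null_comparison)
    show "\<forall>\<^sub>F n in sequentially. norm (qt_norm q t (T (x n) - T (x' n))) \<le> C * qt_norm q t (x n - x' n)"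
      using C by (auto intro!: always_eventually simp flip: fock_linear_diff[OF fock_bounded_linear[OF assms(1)]])
    show "(\<lambda>n. C * qt_norm q t (x n - x' n)) \<longlonglongrightarrow> 0"
      using tendsto_mult_right_zero[OF null_relD(3)[OF assms(2)]] .
  qed
  then show ?thesis using assms by (auto simp: null_rel_def cauchy_seqs_bounded_image)
qed

text \<open>Naming the class of a sequence lets the operations, defined as unions over
  representatives, be rewritten as equations between representatives.\<close>

definition compl_class :: "(nat \<Rightarrow> 'a::real_inner fock) \<Rightarrow> 'a compl" where
  "compl_class x = null_rel q t `` {x}"

lemma compl_class_eqI: "(x, y) \<in> null_rel q t \<Longrightarrow> compl_class x = compl_class y"
  unfolding compl_class_def by (rule equiv_class_eq[OF equiv_null_rel])

lemma compl_class_self: "x \<in> cauchy_seqs q t \<Longrightarrow> x \<in> compl_class x"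
  unfolding compl_class_def by (rule equiv_class_self[OF equiv_null_rel])

lemma mem_compl_class: "y \<in> compl_class x \<longleftrightarrow> (x, y) \<in> null_rel q t"
  by (simp add: compl_class_def)

lemma compl_class_in_qt_fock: "x \<in> cauchy_seqs q t \<Longrightarrow> compl_class x \<in> qt_fock q t"
  unfolding compl_class_def qt_fock_def by (rule quotientI)

lemma qt_fock_cases:
  assumes "X \<in> qt_fock q t"
  obtains x where "x \<in> cauchy_seqs q t" "X = compl_class x"
  using assms unfolding qt_fock_def compl_class_def by (elim quotientE) auto

lemma qt_embed_eq: "qt_embed q t \<xi> = compl_class (\<lambda>_. \<xi>)"
  by (simp add: qt_embed_def compl_class_def)

text \<open>All choices of representatives yield the same class and at least one choice exists, so
  the union collapses to that class.\<close>

lemma compl_add_class: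
  assumes "x \<in> cauchy_seqs q t" "y \<in> cauchy_seqs q t"
  shows "compl_add q t (compl_class x) (compl_class y) = compl_class (\<lambda>n. x n + y n)"
proof -
  have "null_rel q t `` {\<lambda>n. x' n + y' n} = compl_class (\<lambda>n. x n + y n)"
    if "x' \<in> compl_class x" "y' \<in> compl_class y" for x' y'
    using compl_class_eqI[OF null_rel_add, symmetric] that
    by (simp add: mem_compl_class compl_class_def[symmetric])
  then show ?thesis
    unfolding compl_add_def using compl_class_self[OF assms(1)] compl_class_self[OF assms(2)] by blast
qed

lemma compl_extend_class:
  assumes "fock_bounded T" "x \<in> cauchy_seqs q t"
  shows "compl_extend q t T (compl_class x) = compl_class (\<lambda>n. T (x n))"
proof -
  have "null_rel q t `` {\<lambda>n. T (x' n)} = compl_class (\<lambda>n. T (x n))" if "x' \<in> compl_class x" for x'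
    using compl_class_eqI[OF null_rel_bounded_image[OF assms(1)], symmetric] that
    by (simp add: mem_compl_class compl_class_def[symmetric])
  then show ?thesis unfolding compl_extend_def using compl_class_self[OF assms(2)] by blast
qed

lemma compl_scale_class:
  "x \<in> cauchy_seqs q t \<Longrightarrow> compl_scale q t c (compl_class x) = compl_class (\<lambda>n. fock_scale c (x n))"
  using compl_extend_class[OF fock_bounded_scale, of x c] by (simp add: compl_scale_def compl_extend_def)

lemma qt_inner_diff_bound:
  "cmod (qt_inner q t x y - qt_inner q t x' y') \<le> qt_norm q t (x - x') * qt_norm q t y + qt_norm q t x' * qt_norm q t (y - y')"
proof -
  have "qt_inner q t x y - qt_inner q t x' y' = qt_inner q t (x - x') y + qt_inner q t x' (y - y')"
    by (simp add: qt_inner_diff_left qt_inner_diff_right)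
  then show ?thesis
    using norm_triangle_ineq[of "qt_inner q t (x - x') y" "qt_inner q t x' (y - y')"]
      qt_Cauchy_Schwarz[of "x - x'" y] qt_Cauchy_Schwarz[of x' "y - y'"] by simp
qed

lemma qt_inner_convergent:
  assumes x: "x \<in> cauchy_seqs q t" and y: "y \<in> cauchy_seqs q t"
  shows "convergent (\<lambda>n. qt_inner q t (x n) (y n))"
proof (rule Cauchy_convergent)
  obtain B where B: "0 < B" "\<And>n. qt_norm q t (x n) \<le> B" using cauchy_seqs_bounded[OF x] by blast
  obtain D where D: "0 < D" "\<And>n. qt_norm q t (y n) \<le> D" using cauchy_seqs_bounded[OF y] by blast
  show "Cauchy (\<lambda>n. qt_inner q t (x n) (y n))"
    unfolding Cauchy_def
  proof (intro allI impI)
    fix e :: real assume "0 < e"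
    then have "0 < e / (2 * D)" "0 < e / (2 * B)" using B D by auto
    then obtain M N where M: "\<forall>m\<ge>M. \<forall>n\<ge>M. qt_norm q t (x m - x n) < e / (2 * D)"
      and N: "\<forall>m\<ge>N. \<forall>n\<ge>N. qt_norm q t (y m - y n) < e / (2 * B)"
      using cauchy_seqsD x y by metis
    have "dist (qt_inner q t (x m) (y m)) (qt_inner q t (x n) (y n)) < e"
      if "m \<ge> max M N" "n \<ge> max M N" for m n
    proof -
      have "qt_norm q t (x m - x n) * qt_norm q t (y m) \<le> qt_norm q t (x m - x n) * D"
        by (rule mult_left_mono[OF D(2)]) simp
      also have "\<dots> < e / 2" using M[rule_format, of m n] that D(1) by (simp add: field_simps)
      finally have 1: "qt_norm q t (x m - x n) * qt_norm q t (y m) < e / 2" .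
      have "qt_norm q t (x n) * qt_norm q t (y m - y n) \<le> B * qt_norm q t (y m - y n)"
        by (rule mult_right_mono[OF B(2)]) simp
      also have "\<dots> < e / 2" using N[rule_format, of m n] that B(1) by (simp add: field_simps)
      finally show ?thesis
        using 1 qt_inner_diff_bound[of "x m" "y m" "x n" "y n"] by (simp add: dist_norm)
    qed
    then show "\<exists>M. \<forall>m\<ge>M. \<forall>n\<ge>M. dist (qt_inner q t (x m) (y m)) (qt_inner q t (x n) (y n)) < e" by blast
  qed
qed

lemma qt_inner_null_rel:
  assumes x: "(x, x') \<in> null_rel q t" and y: "(y, y') \<in> null_rel q t"
  shows "(\<lambda>n. qt_inner q t (x n) (y n) - qt_inner q t (x' n) (y' n)) \<longlonglongrightarrow> 0"
proof -
  obtain B where B: "0 < B" "\<And>n. qt_norm q t (x' n) \<le> B"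
    using cauchy_seqs_bounded[OF null_relD(2)[OF x]] by blast
  obtain D where D: "0 < D" "\<And>n. qt_norm q t (y n) \<le> D"
    using cauchy_seqs_bounded[OF null_relD(1)[OF y]] by blast
  show ?thesis
  proof (rule Lim_null_comparison)
    show "\<forall>\<^sub>F n in sequentially. norm (qt_inner q t (x n) (y n) - qt_inner q t (x' n) (y' n)) \<le>
      qt_norm q t (x n - x' n) * D + B * qt_norm q t (y n - y' n)"
      by (intro always_eventually allI order_trans[OF qt_inner_diff_bound] add_mono mult_left_mono mult_right_mono B D)
        (use B(1) in auto)
    show "(\<lambda>n. qt_norm q t (x n - x' n) * D + B * qt_norm q t (y n - y' n)) \<longlonglongrightarrow> 0"
      using tendsto_add[OF tendsto_mult_left_zero[OF null_relD(3)[OF x]] tendsto_mult_right_zero[OF null_relD(3)[OF y]]]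
      by simp
  qed
qed

text \<open>The definite description asks for a common limit along all pairs of representatives. By
  \<open>qt_inner_null_rel\<close> the limit along one pair is that along every pair, and uniqueness
  of limits identifies it.\<close>

lemma compl_inner_eqI:
  assumes x: "x \<in> cauchy_seqs q t" and y: "y \<in> cauchy_seqs q t"
    and lim: "(\<lambda>n. qt_inner q t (x n) (y n)) \<longlonglongrightarrow> c"
  shows "compl_inner q t (compl_class x) (compl_class y) = c"
  unfolding compl_inner_def
proof (rule the_equality)
  show "\<forall>x'\<in>compl_class x. \<forall>y'\<in>compl_class y. (\<lambda>n. qt_inner q t (x' n) (y' n)) \<longlonglongrightarrow> c"
  proof (intro ballI)
    fix x' y' assume "x' \<in> compl_class x" "y' \<in> compl_class y"
    then have "(\<lambda>n. qt_inner q t (x n) (y n) - qt_inner q t (x' n) (y' n)) \<longlonglongrightarrow> 0"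
      by (intro qt_inner_null_rel) (auto simp: mem_compl_class)
    from tendsto_diff[OF lim this] show "(\<lambda>n. qt_inner q t (x' n) (y' n)) \<longlonglongrightarrow> c" by simp
  qed
  show "c' = c" if "\<forall>x'\<in>compl_class x. \<forall>y'\<in>compl_class y. (\<lambda>n. qt_inner q t (x' n) (y' n)) \<longlonglongrightarrow> c'" for c'
    using that compl_class_self[OF x] compl_class_self[OF y] lim LIMSEQ_unique by blast
qed

lemma compl_inner_class:
  assumes x: "x \<in> cauchy_seqs q t" and y: "y \<in> cauchy_seqs q t"
  shows "(\<lambda>n. qt_inner q t (x n) (y n)) \<longlonglongrightarrow> compl_inner q t (compl_class x) (compl_class y)"
  using qt_inner_convergent[OF x y] compl_inner_eqI[OF x y] by (metis convergent_LIMSEQ_iff)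

lemma compl_norm_class:
  assumes x: "x \<in> cauchy_seqs q t"
  shows "(\<lambda>n. qt_norm q t (x n)) \<longlonglongrightarrow> compl_norm q t (compl_class x)"
  unfolding compl_norm_def qt_norm_def by (intro tendsto_intros compl_inner_class x)

lemma compl_extend_bounded_operator:
  fixes T :: "'a::real_inner fock \<Rightarrow> 'a fock"
  assumes T: "fock_bounded T"
  shows "bounded_operator q t (compl_extend q t T)"
  unfolding bounded_operator_def
proof (intro conjI ballI allI)
  note simps = compl_extend_class[OF T] compl_add_class compl_scale_class
    cauchy_seqs_bounded_image[OF T] cauchy_seqs_add cauchy_seqs_bounded_image[OF fock_bounded_scale]
    fock_linearD[OF fock_bounded_linear[OF T]]
  show "compl_extend q t T X \<in> qt_fock q t" if "X \<in> qt_fock q t" for X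
    using that by (elim qt_fock_cases) (simp add: simps compl_class_in_qt_fock)
  show "compl_extend q t T (compl_add q t X Y) = compl_add q t (compl_extend q t T X) (compl_extend q t T Y)"
    if "X \<in> qt_fock q t" "Y \<in> qt_fock q t" for X Y
    using that by (elim qt_fock_cases) (simp add: simps)
  show "compl_extend q t T (compl_scale q t c X) = compl_scale q t c (compl_extend q t T X)"
    if "X \<in> qt_fock q t" for c X
    using that by (elim qt_fock_cases) (simp add: simps)
next
  obtain C where C: "\<And>\<xi>. qt_norm q t (T \<xi>) \<le> C * qt_norm q t \<xi>"
    using T by (auto simp: fock_bounded_def)
  have "compl_norm q t (compl_extend q t T X) \<le> C * compl_norm q t X" if X: "X \<in> qt_fock q t" for X
  proof -
    obtain x where x: "x \<in> cauchy_seqs q t" "X = compl_class x" using X by (rule qt_fock_cases)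
    show ?thesis unfolding x(2) compl_extend_class[OF T x(1)]
      by (rule LIMSEQ_le[OF compl_norm_class[OF cauchy_seqs_bounded_image[OF T x(1)]]
        tendsto_mult_left[OF compl_norm_class[OF x(1)]]]) (use C in auto)
  qed
  then show "\<exists>C. \<forall>X\<in>qt_fock q t. compl_norm q t (compl_extend q t T X) \<le> C * compl_norm q t X" by blast
qed

subsection \<open>The Gaussian element\<close>

definition fock_gaussian :: "'a::real_inner \<Rightarrow> 'a fock \<Rightarrow> 'a fock" where
  "fock_gaussian h \<xi> = fock_annihilate q t h \<xi> + fock_create h \<xi>"

lemma fock_bounded_gaussian: "fock_bounded (fock_gaussian h)"
  unfolding fock_gaussian_def[abs_def]
  by (rule fock_bounded_add[OF fock_bounded_annihilate fock_bounded_create])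

lemma fock_linear_gaussian: "fock_linear (fock_gaussian h)"
  by (rule fock_bounded_linear[OF fock_bounded_gaussian])

lemma qt_inner_gaussian: "qt_inner q t (fock_gaussian h \<eta>) \<xi> = qt_inner q t \<eta> (fock_gaussian h \<xi>)"
  by (simp add: fock_gaussian_def qt_inner_add_left qt_inner_add_right qt_inner_create_left qt_inner_create_right)

lemma fock_gaussian_bound:
  "qt_norm q t (fock_gaussian h \<xi>) \<le> 2 * create_const h * qt_norm q t \<xi>"
  using qt_norm_triangle[of "fock_annihilate q t h \<xi>" "fock_create h \<xi>"]
    create_bound[of h \<xi>] annihilate_bound[of h \<xi>] by (simp add: fock_gaussian_def)

lemma qt_gaussian_class:
  "x \<in> cauchy_seqs q t \<Longrightarrow> qt_gaussian q t h (compl_class x) = compl_class (\<lambda>n. fock_gaussian h (x n))"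
  by (simp add: qt_gaussian_def qt_annihilate_def qt_create_def compl_extend_class fock_bounded_create
      fock_bounded_annihilate compl_add_class cauchy_seqs_bounded_image fock_gaussian_def)

lemma qt_gaussian_eq_extend:
  "X \<in> qt_fock q t \<Longrightarrow> qt_gaussian q t h X = compl_extend q t (fock_gaussian h) X"
  by (elim qt_fock_cases) (simp add: qt_gaussian_class compl_extend_class fock_bounded_gaussian)

lemma qt_gaussian_self_adjoint: "self_adjoint q t (qt_gaussian q t h)"
  unfolding self_adjoint_def
proof (intro conjI ballI)
  \<comment> \<open>Closure of the carrier under the operations: the Gaussian element is rewritten
    as an extension only at arguments in \<open>qt_fock q t\<close>.\<close>
  have add: "compl_add q t X Y \<in> qt_fock q t" if "X \<in> qt_fock q t" "Y \<in> qt_fock q t" for X Y :: "'a compl"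
    using that by (elim qt_fock_cases) (simp add: compl_add_class cauchy_seqs_add compl_class_in_qt_fock)
  have scale: "compl_scale q t c X \<in> qt_fock q t" if "X \<in> qt_fock q t" for c and X :: "'a compl"
    using that by (elim qt_fock_cases)
      (simp add: compl_scale_class cauchy_seqs_bounded_image[OF fock_bounded_scale] compl_class_in_qt_fock)
  show "bounded_operator q t (qt_gaussian q t h)"
    using compl_extend_bounded_operator[OF fock_bounded_gaussian[of h]]
    by (simp add: bounded_operator_def qt_gaussian_eq_extend add scale)
next
  fix X Y :: "'a compl" assume X: "X \<in> qt_fock q t" and Y: "Y \<in> qt_fock q t"
  obtain x where x: "x \<in> cauchy_seqs q t" "X = compl_class x" using X by (rule qt_fock_cases)
  obtain y where y: "y \<in> cauchy_seqs q t" "Y = compl_class y" using Y by (rule qt_fock_cases)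
  note cauchy = cauchy_seqs_bounded_image[OF fock_bounded_gaussian]
  show "compl_inner q t X (qt_gaussian q t h Y) = compl_inner q t (qt_gaussian q t h X) Y"
    unfolding x(2) y(2) qt_gaussian_class[OF x(1)] qt_gaussian_class[OF y(1)]
    using compl_inner_class[OF cauchy[OF x(1)] y(1), of h]
    by (intro compl_inner_eqI x y cauchy) (simp add: qt_inner_gaussian)
qed

lemma qt_gaussian_funpow_embed:
  "(qt_gaussian q t h ^^ n) (qt_embed q t \<xi>) = qt_embed q t ((fock_gaussian h ^^ n) \<xi>)"
  by (induction n) (simp_all add: qt_embed_eq qt_gaussian_class cauchy_seqs_const)

lemma vacuum_state_gaussian:
  "vacuum_state q t (qt_gaussian q t h ^^ n) = qt_inner q t vacuum ((fock_gaussian h ^^ n) vacuum)"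
  unfolding vacuum_state_def qt_gaussian_funpow_embed unfolding qt_embed_eq
  by (rule compl_inner_eqI[OF cauchy_seqs_const cauchy_seqs_const]) simp

end

section \<open>Pair partitions and weighted lattice paths\<close>

text \<open>\<open>path_weight b m k\<close> sums over lattice paths with \<open>m\<close> steps \<open>\<plusminus>1\<close> from height \<open>0\<close> to height
  \<open>k\<close> that stay nonnegative; a descending step from height \<open>i\<close> has weight \<open>b i\<close>.\<close>

fun path_weight :: "(nat \<Rightarrow> real) \<Rightarrow> nat \<Rightarrow> nat \<Rightarrow> real" where
  "path_weight b 0 k = (if k = 0 then 1 else 0)"
| "path_weight b (Suc m) k = (if k = 0 then 0 else path_weight b m (k - 1)) + b (Suc k) * path_weight b m (Suc k)"

lemma path_weight_above: "m < k \<Longrightarrow> path_weight b m k = 0"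
  by (induction m arbitrary: k) auto

lemma path_weight_parity: "odd (m + k) \<Longrightarrow> path_weight b m k = 0"
  by (induction m arbitrary: k) (auto simp: odd_pos)

lemma qt_bracket_0 [simp]: "qt_bracket q t 0 = 0"
  by (simp add: qt_bracket_def)

lemma qt_bracket_lessThan: "qt_bracket q t n = (\<Sum>k<n. q ^ k * t ^ (n - 1 - k))"
  unfolding qt_bracket_def
  by (rule sum.reindex_bij_witness[where i = Suc and j = "\<lambda>i. i - 1"]) auto

lemma qt_bracket_Suc: "qt_bracket q t (Suc n) = t ^ n + q * qt_bracket q t n"
  by (simp add: qt_bracket_lessThan sum.lessThan_Suc_shift sum_distrib_left mult_ac del: sum.lessThan_Suc)

text \<open>Reading \<open>{1..m}\<close> from left to right, a pair partition is built from partial matchings, whose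
  unmatched points \<open>S\<close> are blocks opened but not yet closed; a pair \<open>B\<close> crosses the open block
  starting at \<open>s\<close> if \<open>Min B < s < Max B\<close> and is nested in it if \<open>s < Min B\<close>.\<close>

definition matchings :: "nat set \<Rightarrow> nat set set set" where
  "matchings A = {V. partition_on A V \<and> (\<forall>B\<in>V. card B = 2)}"

definition block_weight :: "real \<Rightarrow> real \<Rightarrow> nat set \<Rightarrow> nat set \<Rightarrow> real" where
  "block_weight q t B C =
     (if Min B < Min C \<and> Min C < Max B \<and> Max B < Max C then q else 1) *
     (if Min B < Min C \<and> Min C < Max C \<and> Max C < Max B then t else 1)"

definition open_weight :: "real \<Rightarrow> real \<Rightarrow> nat set \<Rightarrow> nat \<Rightarrow> real" where
  "open_weight q t B s = (if Min B < s \<and> s < Max B then q else 1) * (if s < Min B then t else 1)"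

text \<open>For ordered pairs (B, C) and (C, B) at most one factor differs from 1, since the block
  with the smaller minimum must come first. An open block ends to the right of all closed ones, so
  its relation to them is settled by its starting point.\<close>

definition matching_weight :: "real \<Rightarrow> real \<Rightarrow> nat set \<Rightarrow> nat set set \<Rightarrow> real" where
  "matching_weight q t S V = (\<Prod>B\<in>V. \<Prod>C\<in>V. block_weight q t B C) * (\<Prod>B\<in>V. \<Prod>s\<in>S. open_weight q t B s)"

definition matching_sum :: "real \<Rightarrow> real \<Rightarrow> nat set \<Rightarrow> nat set \<Rightarrow> real" where
  "matching_sum q t A S = (\<Sum>V\<in>matchings A. matching_weight q t S V)"

lemma matchings_block:
  assumes "V \<in> matchings A" "B \<in> V"
  shows "B \<subseteq> A" "Min B \<in> A" "Max B \<in> A" "Min B < Max B" "finite B"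
proof -
  have card: "card B = 2" using assms by (auto simp: matchings_def)
  then show fin: "finite B" by (metis card.infinite zero_neq_numeral)
  have ne: "B \<noteq> {}" using card by auto
  show sub: "B \<subseteq> A" using assms partition_onD1 by (auto simp: matchings_def)
  then show "Min B \<in> A" "Max B \<in> A" using Min_in[OF fin ne] Max_in[OF fin ne] by auto
  show "Min B < Max B"
  proof (rule ccontr)
    assume "\<not> Min B < Max B"
    moreover have "Min B \<le> x" "x \<le> Max B" if "x \<in> B" for x using fin that by auto
    ultimately have "B \<subseteq> {Min B}" by fastforce
    then have "card B \<le> 1" using card_mono[of "{Min B}" B] by simp
    then show False using card by simp
  qed
qed

lemma finite_matching: "finite A \<Longrightarrow> V \<in> matchings A \<Longrightarrow> finite V"
  using matchings_block(1) by (meson PowI finite_Pow_iff finite_subset subsetI)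

lemma finite_matchings: "finite A \<Longrightarrow> finite (matchings A)"
  by (rule finite_subset[of _ "Pow (Pow A)"]) (auto dest: matchings_block(1))

lemma matchings_empty [simp]: "matchings {} = {{}}"
  by (auto simp: matchings_def partition_on_empty)

lemma matchings_Union: "V \<in> matchings A \<Longrightarrow> \<Union>V = A"
  by (auto simp: matchings_def partition_on_def)

lemma bij_betw_matchings_insert:
  assumes M: "M \<notin> A"
  shows "bij_betw (\<lambda>(a, V). insert {a, M} V) (SIGMA a:A. matchings (A - {a})) (matchings (insert M A))"
    (is "bij_betw ?f ?X ?Y")
proof (rule bij_betwI')
  fix x y assume xy: "x \<in> ?X" "y \<in> ?X"
  obtain a V b W where x: "x = (a, V)" and y: "y = (b, W)" by (cases x; cases y)
  have a: "a \<in> A" "V \<in> matchings (A - {a})" and b: "b \<in> A" "W \<in> matchings (A - {b})"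
    using xy by (auto simp: x y)
  have nV: "{c, M} \<notin> V" "{c, M} \<notin> W" for c
    using matchings_Union[OF a(2)] matchings_Union[OF b(2)] M by auto
  show "(?f x = ?f y) \<longleftrightarrow> x = y"
  proof
    assume eq: "?f x = ?f y"
    then have "{a, M} \<in> insert {b, M} W" by (auto simp: x y)
    then have "{a, M} = {b, M}" using nV by auto
    moreover have "a \<noteq> M" "b \<noteq> M" using a b M by auto
    ultimately have "a = b" by (auto simp: doubleton_eq_iff)
    moreover have "V = W" using eq nV(1)[of a] nV(2)[of a] \<open>a = b\<close> by (simp add: x y insert_ident)
    ultimately show "x = y" by (simp add: x y)
  qed auto
next
  fix x assume "x \<in> ?X"
  then obtain a V where x: "x = (a, V)" "a \<in> A" "V \<in> matchings (A - {a})" by auto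
  have "disjnt {a, M} (\<Union>V)" using matchings_Union[OF x(3)] M by (auto simp: disjnt_def)
  moreover have "insert M A - {a, M} = A - {a}" using M by auto
  moreover have "a \<noteq> M" using x(2) M by auto
  then have "card {a, M} = 2" by simp
  ultimately show "?f x \<in> ?Y"
    using x by (simp add: matchings_def partition_on_insert)
next
  fix V assume V: "V \<in> ?Y"
  then obtain B where B: "B \<in> V" "M \<in> B" using matchings_Union[OF V] by blast
  have "card B = 2" using V B by (auto simp: matchings_def)
  then obtain a where a: "B = {a, M}" "a \<noteq> M" using B(2) by (auto simp: card_2_iff)
  then have "a \<in> A" using matchings_block(1)[OF V B(1)] by auto
  have ins: "V = insert {a, M} (V - {B})" using B a by auto
  have part: "partition_on (insert M A) V" using V by (simp add: matchings_def)
  have "disjnt {a, M} (\<Union>(V - {B}))"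
    using partition_onD2[OF part] B(1) unfolding a(1)[symmetric] by (auto simp: disjnt_def disjoint_def)
  then have "partition_on (insert M A - {a, M}) (V - {B})"
    using part ins partition_on_insert by metis
  moreover have "insert M A - {a, M} = A - {a}" using M by auto
  ultimately have "V - {B} \<in> matchings (A - {a})" using V by (auto simp: matchings_def)
  then show "\<exists>x\<in>?X. V = ?f x" using \<open>a \<in> A\<close> ins by (intro bexI[of _ "(a, V - {B})"]) auto
qed

text \<open>As \<open>M\<close> lies to the right of everything, the block {a, M} meets the pairs of
  \<open>V\<close> exactly as an open block starting at \<open>a\<close> would. An open point s > a
  lies inside {a, M} and yields a crossing, while s < a encloses the block and yields a
  nesting.\<close>

lemma matching_weight_insert:
  assumes a: "a \<in> A" "V \<in> matchings (A - {a})" and M: "\<And>x. x \<in> A \<union> S \<Longrightarrow> x < M"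
    and fin: "finite A" "finite S" and disj: "S \<inter> A = {}"
  shows "matching_weight q t S (insert {a, M} V) =
    (\<Prod>s\<in>S. if a < s then q else t) * matching_weight q t (insert a S) V"
proof -
  let ?B = "{a, M}"
  have aM: "a < M" using a M by auto
  then have mm: "Min ?B = a" "Max ?B = M" by auto
  have notin: "?B \<notin> V" using matchings_Union[OF a(2)] M by auto
  have finV: "finite V" using finite_matching[OF _ a(2)] fin by simp
  have C: "Min C \<noteq> a" "Min C < Max C" "Max C < M" "Min C < M" if "C \<in> V" for C
    using matchings_block[OF a(2) that] M by auto
  have "block_weight q t ?B C * block_weight q t C ?B = open_weight q t C a" if "C \<in> V" for C
    using C[OF that] aM unfolding block_weight_def open_weight_def mm by auto
  then have 1: "(\<Prod>C\<in>V. block_weight q t ?B C) * (\<Prod>C\<in>V. block_weight q t C ?B) = (\<Prod>C\<in>V. open_weight q t C a)"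
    by (simp flip: prod.distrib)
  have 2: "open_weight q t ?B s = (if a < s then q else t)" if "s \<in> S" for s
  proof -
    have "s \<noteq> a" "s < M" using that disj a M by auto
    then show ?thesis unfolding open_weight_def mm by auto
  qed
  have 3: "block_weight q t ?B ?B = 1" by (simp add: block_weight_def)
  have aS: "a \<notin> S" using disj a by auto
  have "matching_weight q t S (insert ?B V) =
    ((\<Prod>C\<in>V. block_weight q t ?B C) * (\<Prod>C\<in>V. block_weight q t C ?B)) *
    (\<Prod>B\<in>V. \<Prod>C\<in>V. block_weight q t B C) *
    ((\<Prod>s\<in>S. open_weight q t ?B s) * (\<Prod>B\<in>V. \<Prod>s\<in>S. open_weight q t B s))"
    unfolding matching_weight_def using finV notin 3 by (simp add: prod.distrib mult_ac)
  also have "\<dots> = (\<Prod>s\<in>S. if a < s then q else t) * matching_weight q t (insert a S) V"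
    unfolding 1 matching_weight_def using fin aS by (simp add: prod.distrib 2 mult_ac)
  finally show ?thesis .
qed

lemma matching_sum_insert_matched:
  assumes M: "\<And>x. x \<in> A \<union> S \<Longrightarrow> x < M" and fin: "finite A" "finite S" and disj: "S \<inter> A = {}"
  shows "matching_sum q t (insert M A) S =
    (\<Sum>a\<in>A. (\<Prod>s\<in>S. if a < s then q else t) * matching_sum q t (A - {a}) (insert a S))"
proof -
  have "M \<notin> A" using M by auto
  then have "matching_sum q t (insert M A) S =
    (\<Sum>x\<in>(SIGMA a:A. matchings (A - {a})). matching_weight q t S (case x of (a, V) \<Rightarrow> insert {a, M} V))"
    unfolding matching_sum_def by (rule sum.reindex_bij_betw[OF bij_betw_matchings_insert, symmetric])
  also have "\<dots> = (\<Sum>a\<in>A. \<Sum>V\<in>matchings (A - {a}). matching_weight q t S (insert {a, M} V))"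
    by (subst sum.Sigma) (use fin finite_matchings in \<open>auto simp: case_prod_beta\<close>)
  also have "\<dots> = (\<Sum>a\<in>A. \<Sum>V\<in>matchings (A - {a}).
      (\<Prod>s\<in>S. if a < s then q else t) * matching_weight q t (insert a S) V)"
    by (intro sum.cong refl matching_weight_insert[OF _ _ M]) (use fin disj in auto)
  finally show ?thesis by (simp add: matching_sum_def sum_distrib_left)
qed

text \<open>A block opened to the right of all closed pairs neither crosses nor encloses any of
  them.\<close>

lemma matching_sum_insert_open:
  assumes M: "\<And>x. x \<in> A \<Longrightarrow> x < M" and fin: "finite S" and MS: "M \<notin> S"
  shows "matching_sum q t A (insert M S) = matching_sum q t A S"
  unfolding matching_sum_def
proof (rule sum.cong[OF refl])
  fix V assume V: "V \<in> matchings A"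
  have "open_weight q t B M = 1" if "B \<in> V" for B
    using matchings_block[OF V that] M by (auto simp: open_weight_def dest: less_asym)
  then show "matching_weight q t (insert M S) V = matching_weight q t S V"
    using fin MS by (simp add: matching_weight_def)
qed

text \<open>Closing the open block at \<open>a\<close> costs q for each open point to its right and
  t for each one to its left. In the induction a new largest point \<open>M\<close> adds the choice
  a = M, of weight t^n, and one factor q to every other choice, as in
  \<open>qt_bracket_Suc\<close>.\<close>

lemma sum_open_positions:
  assumes "finite S"
  shows "(\<Sum>a\<in>S. \<Prod>s\<in>S - {a}. if a < s then q else t) = qt_bracket q t (card (S :: nat set))"
  using assms
proof (induction S rule: finite_linorder_max_induct)
  case (insert M S)
  have "M \<notin> S" using insert by auto
  have "(\<Sum>a\<in>insert M S. \<Prod>s\<in>insert M S - {a}. if a < s then q else t) =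
    (\<Prod>s\<in>S. if M < s then q else t) + (\<Sum>a\<in>S. \<Prod>s\<in>insert M S - {a}. if a < s then q else t)"
    using insert \<open>M \<notin> S\<close> by simp
  also have "(\<Prod>s\<in>S. if M < s then q else t) = (\<Prod>s\<in>S. t)"
    using insert by (intro prod.cong) auto
  also have "(\<Sum>a\<in>S. \<Prod>s\<in>insert M S - {a}. if a < s then q else t) =
    (\<Sum>a\<in>S. q * (\<Prod>s\<in>S - {a}. if a < s then q else t))"
  proof (rule sum.cong[OF refl])
    fix a assume "a \<in> S"
    then have "insert M S - {a} = insert M (S - {a})" "a < M" using insert \<open>M \<notin> S\<close> by auto
    then show "(\<Prod>s\<in>insert M S - {a}. if a < s then q else t) = q * (\<Prod>s\<in>S - {a}. if a < s then q else t)"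
      using insert \<open>M \<notin> S\<close> by simp
  qed
  also have "\<dots> = q * qt_bracket q t (card S)" by (simp add: insert sum_distrib_left[symmetric])
  finally show ?case using insert \<open>M \<notin> S\<close> by (simp add: qt_bracket_Suc)
qed simp

definition open_sets :: "nat \<Rightarrow> nat \<Rightarrow> nat set set" where
  "open_sets m k = {S. S \<subseteq> {1..m} \<and> card S = k}"

lemma finite_open_sets [simp]: "finite (open_sets m k)"
  by (rule finite_subset[of _ "Pow {1..m}"]) (auto simp: open_sets_def)

lemma open_setsD:
  assumes "S \<in> open_sets m k" shows "S \<subseteq> {1..m}" "card S = k" "finite S" "Suc m \<notin> S"
  using assms finite_subset[of S "{1..m}"] by (auto simp: open_sets_def)

lemma open_sets_Suc:
  "open_sets (Suc m) k = open_sets m k \<union> (if k = 0 then {} else insert (Suc m) ` open_sets m (k - 1))"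
proof (intro equalityI subsetI)
  fix S assume S: "S \<in> open_sets (Suc m) k"
  note S' = open_setsD[OF S]
  show "S \<in> open_sets m k \<union> (if k = 0 then {} else insert (Suc m) ` open_sets m (k - 1))"
  proof (cases "Suc m \<in> S")
    case True
    then have "S = insert (Suc m) (S - {Suc m})" "S - {Suc m} \<in> open_sets m (k - 1)" "k \<noteq> 0"
      using S' by (auto simp: open_sets_def card_gt_0_iff)
    then have "S \<in> insert (Suc m) ` open_sets m (k - 1)" "k \<noteq> 0" by (metis image_eqI)+
    then show ?thesis by simp
  next
    case False
    then show ?thesis using S' by (auto simp: open_sets_def atLeastAtMostSuc_conv)
  qed
next
  fix S assume "S \<in> open_sets m k \<union> (if k = 0 then {} else insert (Suc m) ` open_sets m (k - 1))"
  then consider "S \<in> open_sets m k" | T where "k \<noteq> 0" "S = insert (Suc m) T" "T \<in> open_sets m (k - 1)"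
    by (auto split: if_splits)
  then show "S \<in> open_sets (Suc m) k"
  proof cases
    case 1
    then show ?thesis using open_setsD(1)[OF 1] by (auto simp: open_sets_def)
  next
    case 2
    then show ?thesis using open_setsD[OF 2(3)] by (auto simp: open_sets_def)
  qed
qed

text \<open>The height of the path is the number of open blocks. If the last point opens a block the
  path ascends with weight 1; if it closes one of k + 1 open blocks, the path descends and the
  choices of that block add up to the bracket of k + 1.\<close>

lemma matching_sum_path_weight:
  "(\<Sum>S\<in>open_sets m k. matching_sum q t ({1..m} - S) S) = path_weight (qt_bracket q t) m k"
proof (induction m arbitrary: k)
  case 0
  have "open_sets 0 k = (if k = 0 then {{}} else {})" by (auto simp: open_sets_def)
  then show ?case by (simp add: matching_sum_def matching_weight_def)
next
  case (Suc m)
  let ?M = "Suc m"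
  let ?F = "\<lambda>m S. matching_sum q t ({1..m} - S) S"
  let ?g = "\<lambda>S a. \<Prod>s\<in>S. if a < s then q else t"
  have inj: "inj_on (insert ?M) (open_sets m (k - 1))"
    by (rule inj_onI) (metis Diff_insert_absorb open_setsD(4))
  have "(\<Sum>S\<in>open_sets (Suc m) k. ?F (Suc m) S) = (\<Sum>S\<in>open_sets m k. ?F (Suc m) S) +
    (if k = 0 then 0 else \<Sum>S\<in>open_sets m (k - 1). ?F (Suc m) (insert ?M S))"
  proof (cases "k = 0")
    case False
    have "open_sets m k \<inter> insert ?M ` open_sets m (k - 1) = {}" using open_setsD(4) by auto
    then show ?thesis using False
      by (simp add: open_sets_Suc sum.union_disjoint sum.reindex[OF inj[simplified]])
  qed (simp add: open_sets_Suc)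
  also have "(\<Sum>S\<in>open_sets m (k - 1). ?F (Suc m) (insert ?M S)) = (\<Sum>S\<in>open_sets m (k - 1). ?F m S)"
  proof (rule sum.cong[OF refl])
    fix S assume S: "S \<in> open_sets m (k - 1)"
    have "{1..Suc m} - insert ?M S = {1..m} - S" by auto
    moreover have "matching_sum q t ({1..m} - S) (insert ?M S) = ?F m S"
      by (rule matching_sum_insert_open) (use open_setsD[OF S] in auto)
    ultimately show "?F (Suc m) (insert ?M S) = ?F m S" by simp
  qed
  also have "(\<Sum>S\<in>open_sets m k. ?F (Suc m) S) =
    (\<Sum>S\<in>open_sets m k. \<Sum>a\<in>{1..m} - S. ?g S a * ?F m (insert a S))"
  proof (rule sum.cong[OF refl])
    fix S assume S: "S \<in> open_sets m k"
    have "{1..Suc m} - S = insert ?M ({1..m} - S)" using open_setsD[OF S] by auto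
    moreover have "{1..m} - S - {a} = {1..m} - insert a S" for a by auto
    ultimately show "?F (Suc m) S = (\<Sum>a\<in>{1..m} - S. ?g S a * ?F m (insert a S))"
      using open_setsD[OF S] by (simp, subst matching_sum_insert_matched) (auto simp: less_Suc_eq_le)
  qed
  also have "\<dots> = (\<Sum>(S, a)\<in>(SIGMA S:open_sets m k. {1..m} - S). ?g S a * ?F m (insert a S))"
    by (rule sum.Sigma) auto
  \<comment> \<open>Pairs of \<open>S\<close> and a partner outside it correspond to sets
    \<open>T\<close> of open points before the last step with the point \<open>a\<close> to be
    closed.\<close>
  also have "\<dots> = (\<Sum>(T, a)\<in>(SIGMA T:open_sets m (Suc k). T). ?g (T - {a}) a * ?F m T)"
  proof (rule sum.reindex_bij_witness[where i = "\<lambda>(T, a). (T - {a}, a)" and j = "\<lambda>(S, a). (insert a S, a)"], goal_cases)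
    case (2 x)
    then show ?case by (auto simp: open_sets_def finite_subset[of _ "{1..m}"] card_insert_if)
  next
    case (4 x)
    then show ?case by (auto simp: open_sets_def)
  qed (auto simp: insert_absorb)
  also have "\<dots> = (\<Sum>T\<in>open_sets m (Suc k). \<Sum>a\<in>T. ?g (T - {a}) a * ?F m T)"
    by (rule sum.Sigma[symmetric]) (auto dest: open_setsD)
  also have "\<dots> = (\<Sum>T\<in>open_sets m (Suc k). qt_bracket q t (Suc k) * ?F m T)"
  proof (rule sum.cong[OF refl])
    fix T assume T: "T \<in> open_sets m (Suc k)"
    show "(\<Sum>a\<in>T. ?g (T - {a}) a * ?F m T) = qt_bracket q t (Suc k) * ?F m T"
      using sum_open_positions[OF open_setsD(3)[OF T], of q t] open_setsD(2)[OF T]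
      by (simp add: sum_distrib_right[symmetric])
  qed
  also have "\<dots> = qt_bracket q t (Suc k) * path_weight (qt_bracket q t) m (Suc k)"
    using Suc.IH[of "Suc k"] by (simp add: sum_distrib_left[symmetric])
  finally show ?case using Suc.IH[of "k - 1"] by simp
qed

lemma matching_weight_closed:
  assumes "finite V"
  shows "matching_weight q t {} V = q ^ crossings V * t ^ nestings V"
proof -
  have prod: "(\<Prod>B\<in>V. \<Prod>C\<in>V. if P B C then c else 1) = c ^ card {(B, C). B \<in> V \<and> C \<in> V \<and> P B C}" for P and c :: real
  proof -
    have "(\<Prod>B\<in>V. \<Prod>C\<in>V. if P B C then c else 1) = (\<Prod>x\<in>V \<times> V. if P (fst x) (snd x) then c else 1)"
      by (simp add: prod.cartesian_product case_prod_beta)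
    also have "\<dots> = c ^ card ((V \<times> V) \<inter> {x. P (fst x) (snd x)})"
      using assms by (simp add: prod.If_cases)
    also have "(V \<times> V) \<inter> {x. P (fst x) (snd x)} = {(B, C). B \<in> V \<and> C \<in> V \<and> P B C}" by auto
    finally show ?thesis .
  qed
  show ?thesis
    by (simp add: matching_weight_def block_weight_def prod.distrib prod crossings_def nestings_def)
qed

theorem pair_partitions_path_weight:
  "(\<Sum>V\<in>pair_partitions m. q ^ crossings V * t ^ nestings V) = path_weight (qt_bracket q t) m 0"
proof -
  have "open_sets m 0 = {{}}" by (auto simp: open_sets_def finite_subset[of _ "{1..m}"])
  then have "path_weight (qt_bracket q t) m 0 = matching_sum q t {1..m} {}"
    using matching_sum_path_weight[where m = m and k = 0] by simp
  also have "\<dots> = (\<Sum>V\<in>pair_partitions m. q ^ crossings V * t ^ nestings V)"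
    unfolding matching_sum_def
    by (rule sum.cong) (auto simp: pair_partitions_def matchings_def intro!: matching_weight_closed
        finite_matching[of "{1..m}"])
  finally show ?thesis by simp
qed

section \<open>The continued fraction\<close>

lemma fps_nth_const_X_mult: "fps_nth (fps_const c * fps_X * F) (Suc n) = c * fps_nth F n"
  for F :: "real fps"
  by (simp add: mult.assoc)

text \<open>The division-free form of one level of the fraction; its factor X makes each coefficient
  depend on earlier ones only.\<close>

lemma cfrac_approx_Suc_eq:
  "cfrac_approx b (Suc N) k = 1 + fps_const (b k) * fps_X * (cfrac_approx b N (Suc k) * cfrac_approx b (Suc N) k)"
proof -
  let ?d = "1 - fps_const (b k) * fps_X * cfrac_approx b N (Suc k)"
  have "fps_nth ?d 0 = 1" by simp
  then have "cfrac_approx b (Suc N) k * ?d = 1"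
    by (simp add: fps_divide_unit inverse_mult_eq_1)
  then show ?thesis by (simp add: algebra_simps del: cfrac_approx.simps)
qed

lemma cfrac_approx_nth_0: "fps_nth (cfrac_approx b N k) 0 = 1"
proof (cases N)
  case (Suc M)
  show ?thesis unfolding Suc by (subst cfrac_approx_Suc_eq) simp
qed simp

lemma cfrac_approx_nth_Suc:
  "fps_nth (cfrac_approx b (Suc N) k) (Suc n) =
     b k * (\<Sum>i\<le>n. fps_nth (cfrac_approx b N (Suc k)) i * fps_nth (cfrac_approx b (Suc N) k) (n - i))"
  by (subst cfrac_approx_Suc_eq, unfold fps_add_nth fps_nth_const_X_mult)
    (simp add: fps_mult_nth atLeast0AtMost del: cfrac_approx.simps)

text \<open>By \<open>cfrac_approx_nth_Suc\<close> the coefficient at \<open>Suc m\<close> involves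
  only indices up to \<open>m\<close>, with one factor taken one level shallower; the bound n \<le>
  N survives both changes.\<close>

lemma cfrac_approx_stable:
  "n \<le> N \<Longrightarrow> N \<le> N' \<Longrightarrow> fps_nth (cfrac_approx b N k) n = fps_nth (cfrac_approx b N' k) n"
proof (induction n arbitrary: N N' k rule: less_induct)
  case (less n)
  show ?case
  proof (cases n)
    case 0
    then show ?thesis by (simp add: cfrac_approx_nth_0)
  next
    case (Suc m)
    obtain M M' where M: "N = Suc M" "N' = Suc M'" using less.prems Suc by (cases N; cases N') auto
    have "fps_nth (cfrac_approx b M (Suc k)) i = fps_nth (cfrac_approx b M' (Suc k)) i"
      "fps_nth (cfrac_approx b (Suc M) k) (m - i) = fps_nth (cfrac_approx b (Suc M') k) (m - i)"
      if "i \<le> m" for i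
      using that less.prems M Suc by (auto intro!: less.IH simp del: cfrac_approx.simps)
    then show ?thesis unfolding M Suc cfrac_approx_nth_Suc by simp
  qed
qed

text \<open>Coefficients are read off on the diagonal, where by \<open>cfrac_approx_stable\<close>
  they no longer change.\<close>

definition cfrac_limit :: "(nat \<Rightarrow> real) \<Rightarrow> nat \<Rightarrow> real fps" where
  "cfrac_limit b k = Abs_fps (\<lambda>n. fps_nth (cfrac_approx b n k) n)"

lemma cfrac_limit_nth: "fps_nth (cfrac_limit b k) n = fps_nth (cfrac_approx b n k) n"
  by (simp add: cfrac_limit_def)

lemma cfrac_approx_nth_limit: "n \<le> N \<Longrightarrow> fps_nth (cfrac_approx b N k) n = fps_nth (cfrac_limit b k) n"
  unfolding cfrac_limit_nth by (rule cfrac_approx_stable[symmetric]) simp_all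

lemma cfrac_approx_tendsto: "(\<lambda>N. cfrac_approx b N k) \<longlonglongrightarrow> cfrac_limit b k"
proof (rule tendsto_fpsI)
  fix n
  show "\<forall>\<^sub>F N in sequentially. fps_nth (cfrac_approx b N k) n = fps_nth (cfrac_limit b k) n"
    using eventually_ge_at_top[of n] by eventually_elim (rule cfrac_approx_nth_limit)
qed

lemma cfrac_limit_eq:
  "cfrac_limit b k = 1 + fps_const (b k) * fps_X * (cfrac_limit b (Suc k) * cfrac_limit b k)"
proof (rule fps_ext)
  fix n show "fps_nth (cfrac_limit b k) n =
    fps_nth (1 + fps_const (b k) * fps_X * (cfrac_limit b (Suc k) * cfrac_limit b k)) n"
  proof (cases n)
    case 0
    then show ?thesis by (simp add: cfrac_limit_nth cfrac_approx_nth_0)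
  next
    case (Suc m)
    have "fps_nth (cfrac_limit b k) n = fps_nth (cfrac_approx b (Suc m) k) (Suc m)"
      by (simp only: Suc cfrac_limit_nth)
    also have "\<dots> = b k * (\<Sum>i\<le>m. fps_nth (cfrac_limit b (Suc k)) i * fps_nth (cfrac_limit b k) (m - i))"
      unfolding cfrac_approx_nth_Suc
      by (intro arg_cong[where f = "(*) (b k)"] sum.cong refl arg_cong2[where f = "(*)"] cfrac_approx_nth_limit) auto
    also have "\<dots> = fps_nth (1 + fps_const (b k) * fps_X * (cfrac_limit b (Suc k) * cfrac_limit b k)) n"
      unfolding Suc fps_add_nth fps_nth_const_X_mult by (simp add: fps_mult_nth atLeast0AtMost)
    finally show ?thesis .
  qed
qed

text \<open>The paths ending at height \<open>j\<close> are decomposed at their last visits to the heights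
  \<open>0, \<dots>, j - 1\<close>, whence their generating function is the product of \<open>j + 1\<close> continued fractions.\<close>

definition cfrac_prod :: "(nat \<Rightarrow> real) \<Rightarrow> nat \<Rightarrow> real fps" where
  "cfrac_prod b j = (\<Prod>k=1..Suc j. cfrac_limit b k)"

lemma cfrac_prod_0: "cfrac_prod b 0 = 1 + fps_const (b 1) * fps_X * cfrac_prod b 1"
proof -
  have "cfrac_prod b 0 = cfrac_limit b 1" by (simp add: cfrac_prod_def)
  also have "\<dots> = 1 + fps_const (b 1) * fps_X * (cfrac_limit b (Suc 1) * cfrac_limit b 1)"
    by (rule cfrac_limit_eq)
  finally show ?thesis by (simp add: cfrac_prod_def mult_ac)
qed

text \<open>Expanding the last factor by \<open>cfrac_limit_eq\<close> reproduces the recursion of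
  \<open>path_weight\<close>: the first summand accounts for a final ascent, the second for a final
  descent.\<close>

lemma cfrac_prod_Suc:
  "cfrac_prod b (Suc j) = cfrac_prod b j + fps_const (b (Suc (Suc j))) * fps_X * cfrac_prod b (Suc (Suc j))"
proof -
  let ?k = "Suc (Suc j)"
  have "cfrac_prod b (Suc j) = cfrac_prod b j * cfrac_limit b ?k"
    by (simp add: cfrac_prod_def)
  also have "\<dots> = cfrac_prod b j * (1 + fps_const (b ?k) * fps_X * (cfrac_limit b (Suc ?k) * cfrac_limit b ?k))"
    by (rule arg_cong[OF cfrac_limit_eq])
  also have "\<dots> = cfrac_prod b j + fps_const (b ?k) * fps_X * (cfrac_prod b j * cfrac_limit b ?k * cfrac_limit b (Suc ?k))"
    by (simp add: distrib_left mult_ac)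
  finally show ?thesis by (simp add: cfrac_prod_def)
qed

text \<open>A path of 2 i + j steps from 0 to j has exactly i descents, so the power series variable
  marks descents.\<close>

lemma path_weight_cfrac_prod: "m = 2 * i + j \<Longrightarrow> path_weight b m j = fps_nth (cfrac_prod b j) i"
proof (induction m arbitrary: i j)
  case 0
  then show ?case by (simp add: cfrac_prod_def cfrac_limit_nth cfrac_approx_nth_0)
next
  case (Suc m)
  have down: "path_weight b m (Suc j) = (if i = 0 then 0 else fps_nth (cfrac_prod b (Suc j)) (i - 1))"
    using Suc.IH[of "i - 1" "Suc j"] Suc.prems by (cases i) (simp_all add: path_weight_above)
  show ?case
  proof (cases j)
    case 0
    show ?thesis using Suc.prems down unfolding 0
      by (subst cfrac_prod_0) (cases i; simp add: fps_nth_const_X_mult)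
  next
    case (Suc j')
    then have up: "path_weight b m j' = fps_nth (cfrac_prod b j') i"
      using Suc.prems by (intro Suc.IH) simp
    show ?thesis using Suc down up
      by (simp only: cfrac_prod_Suc[of b j']) (cases i; simp add: fps_nth_const_X_mult)
  qed
qed

theorem path_weight_qt_cfrac: "path_weight (qt_bracket q t) (2 * n) 0 = fps_nth (qt_cfrac q t) n"
proof -
  have "qt_cfrac q t = cfrac_limit (qt_bracket q t) 1"
    unfolding qt_cfrac_def by (rule limI) (rule cfrac_approx_tendsto)
  then show ?thesis using path_weight_cfrac_prod[of "2 * n" n 0 "qt_bracket q t"] by (simp add: cfrac_prod_def)
qed

section \<open>Moments of the Gaussian element\<close>

text \<open>A path from 0 to k with m steps has (m - k) / 2 descents, each gaining
  \<open>r\<^sup>2\<close>. The factor \<open>r ^ k\<close> on the left avoids a division, so that r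
  = 0 is included.\<close>

lemma path_weight_scale:
  "path_weight (\<lambda>k. b k * r\<^sup>2) m k * r ^ k = r ^ m * path_weight b m k"
proof (induction m arbitrary: k)
  case (Suc m)
  have "path_weight (\<lambda>k. b k * r\<^sup>2) (Suc m) k * r ^ k =
    (if k = 0 then 0 else r * (path_weight (\<lambda>k. b k * r\<^sup>2) m (k - 1) * r ^ (k - 1))) +
    b (Suc k) * r * (path_weight (\<lambda>k. b k * r\<^sup>2) m (Suc k) * r ^ Suc k)"
    by (cases k) (simp_all add: algebra_simps power2_eq_square)
  also have "\<dots> = r ^ Suc m * path_weight b (Suc m) k"
    unfolding Suc by (simp add: algebra_simps)
  finally show ?case .
qed simp

definition tensor_power :: "'a::real_inner \<Rightarrow> nat \<Rightarrow> 'a fock" where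
  "tensor_power h k = tensor (replicate k (cplx_of h))"

lemma tensor_power_0: "tensor_power h 0 = vacuum"
  by (simp add: tensor_power_def)

lemma fock_create_tensor_power: "fock_create h (tensor_power h k) = tensor_power h (Suc k)"
  by (simp add: tensor_power_def fock_create_tensor)

text \<open>All deletions leave the same power and their weights add up to the bracket. At k = 0 the
  bracket vanishes, so the truncated \<open>k - 1\<close> is harmless.\<close>

lemma fock_annihilate_tensor_power:
  "fock_annihilate q t h (tensor_power h k) =
     fock_scale (of_real (qt_bracket q t k * (norm h)\<^sup>2)) (tensor_power h (k - 1))"
proof -
  have "take i (replicate k x) @ drop (Suc i) (replicate k x) = replicate (k - 1) x"
    if "i < k" for i and x :: "'a cplx"
    using that by (simp add: min_def replicate_add[symmetric])
  then have "fock_annihilate q t h (tensor_power h k) =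
    (\<Sum>i<k. fock_scale (of_real (q ^ i * t ^ (k - 1 - i)) * of_real ((norm h)\<^sup>2)) (tensor_power h (k - 1)))"
    unfolding tensor_power_def fock_annihilate_tensor
    by (intro sum.cong) (auto simp: dot_square_norm)
  then show ?thesis
    by (simp add: qt_bracket_lessThan fock.scale_sum_left[symmetric] sum_distrib_right)
qed

lemma word_kernel_Nil: "word_kernel q t [] w = (if w = [] then 1 else 0)"
proof (cases "w = []")
  case True
  then show ?thesis by (simp add: word_kernel_def word_inner_def perm_inv_def perm_cinv_def)
qed (simp add: word_kernel_length_neq)

lemma qt_inner_vacuum_tensor_power: "qt_inner q t vacuum (tensor_power h k) = (if k = 0 then 1 else 0)"
  by (simp add: tensor_power_def qt_inner_tensor word_kernel_Nil)

section \<open>Polynomials in an operator\<close>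

definition poly_apply :: "('a::real_inner fock \<Rightarrow> 'a fock) \<Rightarrow> real poly \<Rightarrow> 'a fock \<Rightarrow> 'a fock" where
  "poly_apply T p \<xi> = (\<Sum>i\<le>degree p. fock_scale (of_real (coeff p i)) ((T ^^ i) \<xi>))"

lemma poly_apply_superset:
  assumes "degree p \<le> n"
  shows "poly_apply T p \<xi> = (\<Sum>i\<le>n. fock_scale (of_real (coeff p i)) ((T ^^ i) \<xi>))"
  unfolding poly_apply_def
  by (rule sum.mono_neutral_left) (use assms in \<open>auto simp: coeff_eq_0\<close>)

lemma poly_apply_add: "poly_apply T (p + r) \<xi> = poly_apply T p \<xi> + poly_apply T r \<xi>"
proof -
  let ?n = "max (degree p) (degree r)"
  have "degree (p + r) \<le> ?n" by (rule degree_add_le_max)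
  then show ?thesis
    by (simp add: poly_apply_superset[of _ ?n] fock.scale_left_distrib sum.distrib)
qed

lemma poly_apply_smult: "poly_apply T (smult c p) \<xi> = fock_scale (of_real c) (poly_apply T p \<xi>)"
  using poly_apply_superset[OF degree_smult_le[of c p], of T \<xi>]
  by (simp add: poly_apply_def fock.scale_sum_right)

lemma poly_apply_0 [simp]: "poly_apply T 0 \<xi> = 0"
  by (simp add: poly_apply_def)

lemma poly_apply_1 [simp]: "poly_apply T 1 \<xi> = \<xi>"
  by (simp add: poly_apply_def)

lemma poly_apply_pCons:
  assumes "fock_linear T"
  shows "poly_apply T (pCons c p) \<xi> = fock_scale (of_real c) \<xi> + T (poly_apply T p \<xi>)"
  using poly_apply_superset[OF degree_pCons_le[of c p], of T \<xi>]
  by (simp add: poly_apply_def fock_linear_sum[OF assms] fock_linearD[OF assms] sum.atMost_Suc_shift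
      del: sum.atMost_Suc)

lemma poly_apply_mult:
  assumes "fock_linear T"
  shows "poly_apply T (p * r) \<xi> = poly_apply T p (poly_apply T r \<xi>)"
  by (induction p) (simp_all add: poly_apply_pCons[OF assms] poly_apply_add poly_apply_smult)

lemma poly_apply_X_power:
  assumes "fock_linear T"
  shows "poly_apply T ([:0, 1:] ^ n) \<xi> = (T ^^ n) \<xi>"
  by (induction n) (simp_all add: poly_apply_mult[OF assms] poly_apply_pCons[OF assms] fock_linear_0[OF assms])

lemma poly_apply_commute:
  assumes "fock_linear T"
  shows "poly_apply T p (T \<xi>) = T (poly_apply T p \<xi>)"
  by (induction p) (simp_all add: poly_apply_pCons[OF assms] fock_linear_0[OF assms] fock_linearD[OF assms])

context qt_param
begin

lemma fock_gaussian_tensor_power: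
  "fock_gaussian h (tensor_power h k) =
     fock_scale (of_real (qt_bracket q t k * (norm h)\<^sup>2)) (tensor_power h (k - 1)) + tensor_power h (Suc k)"
  by (simp add: fock_gaussian_def fock_annihilate_tensor_power fock_create_tensor_power)

lemma fock_gaussian_funpow_vacuum:
  "(fock_gaussian h ^^ m) vacuum =
     (\<Sum>k\<le>m. fock_scale (of_real (path_weight (\<lambda>k. qt_bracket q t k * (norm h)\<^sup>2) m k)) (tensor_power h k))"
proof (induction m)
  case 0
  show ?case by (simp add: tensor_power_0)
next
  case (Suc m)
  let ?b = "\<lambda>k. qt_bracket q t k * (norm h)\<^sup>2"
  let ?w = "path_weight ?b m" and ?e = "tensor_power h"
  let ?f = "\<lambda>k. fock_scale (of_real (?b k * ?w k)) (?e (k - 1))"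
  \<comment> \<open>These coefficients vanish, so the lowered sum may be extended by two terms
    before its index is shifted; its term at 0 drops out because the bracket of 0 is 0.\<close>
  have above: "?w (Suc m) = 0" "?w (Suc (Suc m)) = 0" by (simp_all add: path_weight_above)
  have "(\<Sum>k\<le>m. ?f k) = (\<Sum>k\<le>Suc (Suc m). ?f k)" by (simp add: above)
  also have "\<dots> = (\<Sum>k\<le>Suc m. fock_scale (of_real (?b (Suc k) * ?w (Suc k))) (?e k))"
    by (subst sum.atMost_Suc_shift) simp
  finally have down: "(\<Sum>k\<le>m. ?f k) = (\<Sum>k\<le>Suc m. fock_scale (of_real (?b (Suc k) * ?w (Suc k))) (?e k))" .
  have up: "(\<Sum>k\<le>m. fock_scale (of_real (?w k)) (?e (Suc k))) =
    (\<Sum>k\<le>Suc m. fock_scale (of_real (if k = 0 then 0 else ?w (k - 1))) (?e k))"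
    by (subst sum.atMost_Suc_shift) simp
  have "(fock_gaussian h ^^ Suc m) vacuum = (\<Sum>k\<le>m. fock_scale (of_real (?w k)) (fock_gaussian h (?e k)))"
    by (simp add: Suc fock_linear_sum[OF fock_linear_gaussian] fock_linearD[OF fock_linear_gaussian])
  also have "\<dots> = (\<Sum>k\<le>m. ?f k) + (\<Sum>k\<le>m. fock_scale (of_real (?w k)) (?e (Suc k)))"
    by (simp add: fock_gaussian_tensor_power fock.scale_right_distrib sum.distrib mult_ac)
  also have "\<dots> = (\<Sum>k\<le>Suc m. fock_scale (of_real (path_weight ?b (Suc m) k)) (?e k))"
    unfolding down up sum.distrib[symmetric] fock.scale_left_distrib[symmetric] of_real_add[symmetric]
    by (simp only: path_weight.simps add.commute)
  finally show ?case .
qed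

lemma qt_inner_vacuum_gaussian:
  "qt_inner q t vacuum ((fock_gaussian h ^^ m) vacuum) = of_real (norm h ^ m * path_weight (qt_bracket q t) m 0)"
proof -
  have "qt_inner q t vacuum ((fock_gaussian h ^^ m) vacuum) =
    of_real (path_weight (\<lambda>k. qt_bracket q t k * (norm h)\<^sup>2) m 0)"
    unfolding fock_gaussian_funpow_vacuum qt_inner_sum_right qt_inner_scale_right qt_inner_vacuum_tensor_power
    by (simp add: if_distrib sum.delta cong: if_cong)
  then show ?thesis using path_weight_scale[of "qt_bracket q t" "norm h" m 0] by simp
qed

lemma vacuum_state_gaussian_path_weight:
  "vacuum_state q t (qt_gaussian q t h ^^ m) = of_real (norm h ^ m * path_weight (qt_bracket q t) m 0)"
  by (simp only: vacuum_state_gaussian qt_inner_vacuum_gaussian)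

lemma qt_inner_poly_gaussian:
  "qt_inner q t (poly_apply (fock_gaussian h) p \<eta>) \<xi> = qt_inner q t \<eta> (poly_apply (fock_gaussian h) p \<xi>)"
  by (induction p arbitrary: \<eta> \<xi>)
    (simp_all add: poly_apply_pCons[OF fock_linear_gaussian] qt_inner_add_left qt_inner_add_right
      qt_inner_scale_left qt_inner_scale_right qt_inner_gaussian poly_apply_commute[OF fock_linear_gaussian])

end

section \<open>The moment problem on a bounded interval\<close>

text \<open>The factorial moments of the binomial distribution, from the trinomial revision of
  binomial coefficients and the binomial theorem. When u + v = 1, Bernstein weights reproduce u^m
  exactly against the quotients of \<open>k choose m\<close> by \<open>N choose m\<close>. A general
  ring allows u and v to be polynomials.\<close>

lemma sum_choose_Bernstein:
  fixes u v :: "'a::comm_ring_1"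
  assumes "m \<le> N"
  shows "(\<Sum>k\<le>N. of_nat (k choose m) * (of_nat (N choose k) * (u ^ k * v ^ (N - k)))) =
    of_nat (N choose m) * (u ^ m * (u + v) ^ (N - m))"
proof -
  have "(\<Sum>k\<le>N. of_nat (k choose m) * (of_nat (N choose k) * (u ^ k * v ^ (N - k)))) =
    (\<Sum>k=m..N. of_nat (k choose m) * (of_nat (N choose k) * (u ^ k * v ^ (N - k))))"
    by (rule sum.mono_neutral_right) (auto simp: not_le binomial_eq_0)
  also have "\<dots> = (\<Sum>j\<le>N - m. of_nat ((m + j) choose m) * (of_nat (N choose (m + j)) * (u ^ (m + j) * v ^ (N - (m + j)))))"
    by (rule sum.reindex_bij_witness[where i = "\<lambda>j. m + j" and j = "\<lambda>k. k - m"]) (use assms in auto)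
  also have "\<dots> = (\<Sum>j\<le>N - m. of_nat (N choose m) * (u ^ m * (of_nat ((N - m) choose j) * u ^ j * v ^ (N - m - j))))"
  proof (rule sum.cong[OF refl])
    fix j assume "j \<in> {..N - m}"
    then have "(N choose (m + j)) * ((m + j) choose m) = (N choose m) * ((N - m) choose j)"
      using choose_mult[of m "m + j" N] assms by simp
    then have "of_nat ((m + j) choose m) * of_nat (N choose (m + j)) = (of_nat (N choose m) * of_nat ((N - m) choose j) :: 'a)"
      by (metis mult.commute of_nat_mult)
    then have "of_nat ((m + j) choose m) * of_nat (N choose (m + j)) * (u ^ m * u ^ j * v ^ (N - m - j)) =
      of_nat (N choose m) * of_nat ((N - m) choose j) * (u ^ m * u ^ j * v ^ (N - m - j))" by simp
    then show "of_nat ((m + j) choose m) * (of_nat (N choose (m + j)) * (u ^ (m + j) * v ^ (N - (m + j)))) =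
      of_nat (N choose m) * (u ^ m * (of_nat ((N - m) choose j) * u ^ j * v ^ (N - m - j)))"
      by (simp add: power_add mult_ac)
  qed
  also have "\<dots> = of_nat (N choose m) * (u ^ m * (u + v) ^ (N - m))"
    by (simp add: binomial_ring sum_distrib_left)
  finally show ?thesis .
qed

text \<open>Both terms are products of m factors of modulus at most 1, so their difference is at
  most the sum of the differences of factors, each at most m / (N - m).\<close>

lemma choose_quotient_bound:
  assumes "k \<le> N" "2 * m < N"
  shows "\<bar>(real k / real N) ^ m - real (k choose m) / real (N choose m)\<bar> \<le> real m * (real m / (real N - real m))"
proof -
  have prod: "real (k choose m) / real (N choose m) = (\<Prod>i<m. (real k - real i) / (real N - real i))"
    by (simp add: binomial_gbinomial gbinomial_prod_rev prod_dividef atLeast0LessThan)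
  have "\<bar>(\<Prod>i<m. real k / real N) - (\<Prod>i<m. (real k - real i) / (real N - real i))\<bar> \<le>
    (\<Sum>i<m. \<bar>real k / real N - (real k - real i) / (real N - real i)\<bar>)"
    unfolding real_norm_def[symmetric]
  proof (rule norm_prod_diff)
    fix i assume "i \<in> {..<m}"
    then show "norm ((real k - real i) / (real N - real i)) \<le> 1" using assms by (auto simp: divide_le_eq_1)
  qed (use assms in \<open>auto simp: divide_le_eq_1\<close>)
  also have "\<dots> \<le> (\<Sum>i<m. real m / (real N - real m))"
  proof (rule sum_mono)
    fix i assume i: "i \<in> {..<m}"
    have pos: "0 < real N" "0 < real N - real i" "0 < real N - real m" using i assms by auto
    have "real k / real N - (real k - real i) / (real N - real i) = (real N - real k) / real N * (real i / (real N - real i))"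
      using pos by (simp add: divide_simps) (simp add: algebra_simps)
    then have "\<bar>real k / real N - (real k - real i) / (real N - real i)\<bar> = (real N - real k) / real N * (real i / (real N - real i))"
      using pos assms by (simp add: abs_mult)
    also have "\<dots> \<le> 1 * (real m / (real N - real m))"
      using pos assms i by (intro mult_mono frac_le) auto
    finally show "\<bar>real k / real N - (real k - real i) / (real N - real i)\<bar> \<le> real m / (real N - real m)"
      by (simp only: mult_1_left)
  qed
  finally show ?thesis by (simp add: prod)
qed

lemma choose_quotient_bound_tendsto_0: "(\<lambda>N. real m * (real m / (real N - real m))) \<longlonglongrightarrow> 0"
  by real_asymp

text \<open>Weak convergence is tested on bounded continuous functions. Powers of
  \<open>clamp01\<close> are such functions and agree with the monomials on the unit
  interval.\<close>

definition clamp01 :: "real \<Rightarrow> real" where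
  "clamp01 x = max 0 (min 1 x)"

lemma clamp01: "0 \<le> clamp01 x" "clamp01 x \<le> 1" "0 \<le> x \<Longrightarrow> x \<le> 1 \<Longrightarrow> clamp01 x = x"
  by (auto simp: clamp01_def)

lemma isCont_clamp01 [continuous_intros]: "isCont f x \<Longrightarrow> isCont (\<lambda>x. clamp01 (f x)) x"
  unfolding clamp01_def by (intro continuous_intros)

locale linear_functional =
  fixes L :: "real poly \<Rightarrow> real"
  assumes add: "L (p + r) = L p + L r" and smult: "L (smult c p) = c * L p"
begin

lemma zero: "L 0 = 0"
  using smult[of 0 0] by simp

lemma sum: "L (\<Sum>i\<in>A. f i) = (\<Sum>i\<in>A. L (f i))"
  by (induction A rule: infinite_finite_induct) (auto simp: zero add)

lemma monomials: "L p = (\<Sum>i\<le>degree p. coeff p i * L ([:0, 1:] ^ i))"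
proof -
  have "L p = L (\<Sum>i\<le>degree p. monom (coeff p i) i)" by (simp add: poly_as_sum_of_monoms)
  then show ?thesis by (simp add: sum smult monom_altdef)
qed

end

text \<open>The Bernstein polynomials yield discrete measures with weights \<open>L(B\<^bsub>N,k\<^esub>)\<close> at \<open>k/N\<close>, whose
  moments converge to those prescribed; the measure sought is a weak limit.\<close>

lemma Hausdorff_moment_unit_interval:
  assumes "linear_functional L" and L1: "L 1 = 1"
    and pos: "\<And>k l. 0 \<le> L ([:0, 1:] ^ k * [:1, -1:] ^ l)"
  shows "\<exists>\<nu>. real_distribution \<nu> \<and>
    (\<forall>m. integrable \<nu> (\<lambda>x. x ^ m) \<and> (\<integral>x. x ^ m \<partial>\<nu>) = L ([:0, 1:] ^ m))"
proof -
  interpret linear_functional L by fact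
  let ?u = "[:0, 1:] :: real poly" and ?v = "[:1, -1:] :: real poly"
  define w where "w N k = L (smult (of_nat (N choose k)) (?u ^ k * ?v ^ (N - k)))" for N k
  have w_nonneg: "0 \<le> w N k" for N k by (simp add: w_def smult pos)
  have w_moment: "(\<Sum>k\<le>N. real (k choose m) / real (N choose m) * w N k) = L (?u ^ m)" if "m \<le> N" for m N
  proof -
    have "(\<Sum>k\<le>N. real (k choose m) * w N k) =
        L (\<Sum>k\<le>N. of_nat (k choose m) * (of_nat (N choose k) * (?u ^ k * ?v ^ (N - k))))"
      by (simp add: sum w_def of_nat_poly smult mult_ac)
    also have "\<dots> = L (of_nat (N choose m) * (?u ^ m * (?u + ?v) ^ (N - m)))"
      by (simp only: sum_choose_Bernstein[OF that])
    also have "?u + ?v = 1" by (simp add: one_pCons)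
    also have "L (of_nat (N choose m) * (?u ^ m * 1 ^ (N - m))) = real (N choose m) * L (?u ^ m)"
      by (simp add: of_nat_poly smult)
    finally have "(\<Sum>k\<le>N. real (k choose m) * w N k) = real (N choose m) * L (?u ^ m)" .
    then show ?thesis using that by (simp add: sum_divide_distrib[symmetric] field_simps)
  qed
  have w_sum: "(\<Sum>k\<le>N. w N k) = 1" for N
    using w_moment[of 0 N] L1 by simp
  have "\<exists>P. \<forall>k. pmf P k = (if k \<le> N then w N k else 0)" for N
  proof -
    let ?f = "\<lambda>k. if k \<le> N then w N k else 0"
    have "(\<integral>\<^sup>+ k. ennreal (?f k) \<partial>count_space UNIV) = (\<Sum>k\<le>N. ennreal (?f k))"
      by (rule nn_integral_count_space') auto
    also have "\<dots> = 1" using w_nonneg w_sum[of N] by (simp add: sum_ennreal)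
    finally show ?thesis using w_nonneg by (intro exI[of _ "embed_pmf ?f"]) (simp add: pmf_embed_pmf)
  qed
  then obtain P where P: "\<And>N k. pmf (P N) k = (if k \<le> N then w N k else 0)" by metis
  define \<mu> where "\<mu> N = distr (measure_pmf (P N)) borel (\<lambda>k. real k / real N)" for N
  have set_P: "set_pmf (P N) \<subseteq> {..N}" for N by (auto simp: set_pmf_eq P)
  have dist: "real_distribution (\<mu> N)" for N
    unfolding \<mu>_def by (rule prob_space.real_distribution_distr) (auto simp: measure_pmf.prob_space_axioms)
  have int: "(\<integral>x. f x \<partial>\<mu> N) = (\<Sum>k\<le>N. f (real k / real N) * w N k)"
    if [measurable]: "f \<in> borel_measurable borel" for f :: "real \<Rightarrow> real" and N
  proof -
    have "(\<integral>x. f x \<partial>\<mu> N) = (\<integral>k. f (real k / real N) \<partial>measure_pmf (P N))"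
      unfolding \<mu>_def by (rule integral_distr) auto
    also have "\<dots> = (\<Sum>k\<le>N. pmf (P N) k *\<^sub>R f (real k / real N))"
      by (rule integral_measure_pmf) (use set_P in auto)
    finally show ?thesis by (simp add: P mult.commute)
  qed
  \<comment> \<open>For N = 0 the quotient is 0 / 0 = 0, so this index is covered too.\<close>
  have range: "0 \<le> real k / real N" "real k / real N \<le> 1" if "k \<le> N" for k N
    using that by (auto simp: divide_le_eq_1)
  have "tight \<mu>"
    unfolding tight_def
  proof (intro conjI allI impI dist)
    fix e :: real assume "0 < e"
    \<comment> \<open>Tightness is phrased with half-open intervals, so the left end has to lie
      strictly below the possible atom at 0.\<close>
    have "measure (\<mu> N) {-1<..1} = 1" for N
    proof -
      have "measure (\<mu> N) {-1<..1} = measure (P N) ((\<lambda>k. real k / real N) -` {-1<..1})"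
        unfolding \<mu>_def by (subst measure_distr) auto
      also have "\<dots> = 1"
      proof (subst measure_pmf.prob_eq_1)
        show "AE k in measure_pmf (P N). k \<in> (\<lambda>k. real k / real N) -` {-1<..1}"
          using range set_P[of N] by (auto simp: AE_measure_pmf_iff intro: less_le_trans[of "-1" 0])
      qed auto
      finally show ?thesis .
    qed
    then show "\<exists>a b. a < b \<and> (\<forall>n. 1 - e < measure (\<mu> n) {a<..b})"
      using \<open>0 < e\<close> by (intro exI[of _ "-1"] exI[of _ 1]) auto
  qed
  then obtain r M where r: "strict_mono r" and M: "real_distribution M" and conv: "weak_conv_m (\<mu> \<circ> r) M"
    using tight_imp_convergent_subsubsequence[of \<mu> "\<lambda>n. n"] by (auto simp: strict_mono_def o_def)
  interpret M: real_distribution M by fact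
  have lim: "(\<lambda>n. \<integral>x. f x \<partial>\<mu> (r n)) \<longlonglongrightarrow> (\<integral>x. f x \<partial>M)"
    if "\<And>x. isCont f x" "\<And>x. norm (f x) \<le> 1" for f :: "real \<Rightarrow> real"
    using weak_conv_imp_integral_bdd_continuous_conv[OF _ M conv, of f 1] dist that by (simp add: o_def)
  have clamp_meas [measurable]: "clamp01 \<in> borel_measurable borel"
    unfolding clamp01_def[abs_def] by measurable
  have moment: "(\<integral>x. clamp01 x ^ m \<partial>M) = L (?u ^ m)" for m
  proof (rule LIMSEQ_unique)
    show "(\<lambda>n. \<integral>x. clamp01 x ^ m \<partial>\<mu> (r n)) \<longlonglongrightarrow> (\<integral>x. clamp01 x ^ m \<partial>M)"
      by (rule lim) (use clamp01 in \<open>auto intro!: continuous_intros simp: power_le_one\<close>)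
    \<comment> \<open>The prescribed moment is exact for the binomial quotients, so the error is a
      weighted average of the differences estimated in \<open>choose_quotient_bound\<close>.\<close>
    have eq: "(\<integral>x. clamp01 x ^ m \<partial>\<mu> N) - L (?u ^ m) =
        (\<Sum>k\<le>N. ((real k / real N) ^ m - real (k choose m) / real (N choose m)) * w N k)" if "m \<le> N" for N
    proof -
      have "(\<integral>x. clamp01 x ^ m \<partial>\<mu> N) = (\<Sum>k\<le>N. (real k / real N) ^ m * w N k)"
        by (subst int) (use range clamp01(3) in \<open>auto intro!: sum.cong\<close>)
      then show ?thesis by (simp only: w_moment[OF that, symmetric] left_diff_distrib sum_subtractf)
    qed
    have bound: "norm ((\<integral>x. clamp01 x ^ m \<partial>\<mu> N) - L (?u ^ m)) \<le> real m * (real m / (real N - real m))"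
      if "2 * m < N" for N
    proof -
      have "norm ((\<integral>x. clamp01 x ^ m \<partial>\<mu> N) - L (?u ^ m)) \<le>
        (\<Sum>k\<le>N. norm (((real k / real N) ^ m - real (k choose m) / real (N choose m)) * w N k))"
        using that by (subst eq) (auto intro: norm_sum)
      also have "\<dots> \<le> (\<Sum>k\<le>N. real m * (real m / (real N - real m)) * w N k)"
      proof (rule sum_mono)
        fix k assume "k \<in> {..N}"
        then have "\<bar>(real k / real N) ^ m - real (k choose m) / real (N choose m)\<bar> * w N k \<le>
          real m * (real m / (real N - real m)) * w N k"
          using that w_nonneg by (intro mult_right_mono choose_quotient_bound) auto
        then show "norm (((real k / real N) ^ m - real (k choose m) / real (N choose m)) * w N k) \<le>
          real m * (real m / (real N - real m)) * w N k"
          using w_nonneg by (simp add: abs_mult)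
      qed
      also have "\<dots> = real m * (real m / (real N - real m))"
        by (simp only: sum_distrib_left[symmetric] w_sum mult_1_right)
      finally show ?thesis .
    qed
    have "\<forall>\<^sub>F N in sequentially. norm ((\<integral>x. clamp01 x ^ m \<partial>\<mu> N) - L (?u ^ m)) \<le> real m * (real m / (real N - real m))"
      using eventually_gt_at_top[of "2 * m"] by eventually_elim (rule bound)
    from Lim_null_comparison[OF this choose_quotient_bound_tendsto_0[of m]]
    have "(\<lambda>N. (\<integral>x. clamp01 x ^ m \<partial>\<mu> N) - L (?u ^ m)) \<longlonglongrightarrow> 0" .
    then have "(\<lambda>N. \<integral>x. clamp01 x ^ m \<partial>\<mu> N) \<longlonglongrightarrow> L (?u ^ m)" by (rule LIM_zero_cancel)
    from LIMSEQ_subseq_LIMSEQ[OF this r]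
    show "(\<lambda>n. \<integral>x. clamp01 x ^ m \<partial>\<mu> (r n)) \<longlonglongrightarrow> L (?u ^ m)" by (simp add: o_def)
  qed
  \<comment> \<open>A bounded continuous function vanishing exactly on the unit interval. Its
    integral is 0 for every approximating measure, hence also for the limit, which is thereby
    concentrated on that interval.\<close>
  define g where "g x = min 1 \<bar>x - clamp01 x\<bar>" for x
  have g_cont: "isCont g x" for x
    unfolding g_def[abs_def] by (intro continuous_intros)
  have g_bound: "0 \<le> g x" "norm (g x) \<le> 1" for x by (auto simp: g_def)
  have [measurable]: "g \<in> borel_measurable borel" unfolding g_def[abs_def] by measurable
  have "(\<integral>x. g x \<partial>\<mu> N) = 0" for N
    by (subst int) (use range clamp01(3) in \<open>auto intro!: sum.neutral simp: g_def\<close>)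
  then have "(\<integral>x. g x \<partial>M) = 0" using LIMSEQ_unique[OF lim[of g, OF g_cont g_bound(2)]] by simp
  moreover have "integrable M g"
    by (rule M.integrable_const_bound[where B = 1]) (use g_bound in auto)
  ultimately have "AE x in M. g x = 0"
    using integral_nonneg_eq_0_iff_AE[of M g] g_bound by simp
  then have AE: "AE x in M. clamp01 x = x"
    by eventually_elim (auto simp: g_def min_def split: if_splits)
  have "integrable M (\<lambda>x. x ^ m) \<and> (\<integral>x. x ^ m \<partial>M) = L (?u ^ m)" for m
  proof
    have AE': "AE x in M. clamp01 x ^ m = x ^ m" using AE by eventually_elim simp
    have "integrable M (\<lambda>x. clamp01 x ^ m)"
      by (rule M.integrable_const_bound[where B = 1]) (use clamp01 in \<open>auto simp: power_le_one\<close>)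
    then show "integrable M (\<lambda>x. x ^ m)"
      by (subst integrable_cong_AE[of _ _ "\<lambda>x. clamp01 x ^ m"]) (use AE' in \<open>auto elim: eventually_mono\<close>)
    have "(\<integral>x. clamp01 x ^ m \<partial>M) = (\<integral>x. x ^ m \<partial>M)" by (rule integral_cong_AE) (use AE' in auto)
    then show "(\<integral>x. x ^ m \<partial>M) = L (?u ^ m)" using moment by simp
  qed
  then show ?thesis using M by blast
qed

section \<open>Moments on a symmetric interval and determinacy\<close>

lemma integrable_poly:
  assumes "\<And>m. integrable \<nu> (\<lambda>x. x ^ m)"
  shows "integrable \<nu> (\<lambda>x. poly p x :: real)"
  unfolding poly_altdef using assms by (intro Bochner_Integration.integrable_sum integrable_mult_right) auto

lemma integral_poly_moments:
  assumes "linear_functional L" and "\<And>m. integrable \<nu> (\<lambda>x. x ^ m)"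
    and "\<And>m. (\<integral>x. x ^ m \<partial>\<nu>) = L ([:0, 1:] ^ m)"
  shows "(\<integral>x. poly p x \<partial>\<nu>) = L p"
proof -
  interpret linear_functional L by fact
  show ?thesis unfolding poly_altdef using assms(2,3)
    by (subst Bochner_Integration.integral_sum) (auto simp: monomials[of p])
qed

lemma pcompose_power: "pcompose (p ^ n) r = pcompose p r ^ n" for p r :: "real poly"
  by (induction n) (simp_all add: pcompose_mult pcompose_1)

text \<open>The substitution y = (R + x) / (2 R) maps [-R, R] onto [0, 1] and turns y and 1 - y into
  positive multiples of R + x and R - x; the measure found for y is transported back by x = 2 R y -
  R.\<close>

lemma Hausdorff_moment_interval:
  assumes "linear_functional L" and L1: "L 1 = 1" and "0 < R"
    and pos: "\<And>k l. 0 \<le> L ([:R, 1:] ^ k * [:R, -1:] ^ l)"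
  shows "\<exists>\<mu>. real_distribution \<mu> \<and>
    (\<forall>m. integrable \<mu> (\<lambda>x. x ^ m) \<and> (\<integral>x. x ^ m \<partial>\<mu>) = L ([:0, 1:] ^ m))"
proof -
  interpret linear_functional L by fact
  let ?c = "[:1/2, 1/(2*R):]"
  define L' where "L' p = L (pcompose p ?c)" for p
  have lin: "linear_functional L'"
    by unfold_locales (simp_all add: L'_def pcompose_add pcompose_smult add smult)
  have scale: "pcompose [:0, 1:] ?c = smult (1/(2*R)) [:R, 1:]" "pcompose [:1, -1:] ?c = smult (1/(2*R)) [:R, -1:]"
    using \<open>0 < R\<close> by (auto simp: pcompose_pCons)
  have "0 \<le> L' ([:0, 1:] ^ k * [:1, -1:] ^ l)" for k l
    unfolding L'_def pcompose_mult pcompose_power scale smult_power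
      mult_smult_left mult_smult_right smult
    using pos[of k l] \<open>0 < R\<close> by (intro mult_nonneg_nonneg) simp_all
  moreover have "L' 1 = 1" by (simp add: L'_def L1 pcompose_1)
  ultimately obtain \<nu> where \<nu>: "real_distribution \<nu>" "\<And>m. integrable \<nu> (\<lambda>x. x ^ m)"
    "\<And>m. (\<integral>x. x ^ m \<partial>\<nu>) = L' ([:0, 1:] ^ m)"
    using Hausdorff_moment_unit_interval[OF lin] by blast
  interpret \<nu>: real_distribution \<nu> by fact
  define \<mu> where "\<mu> = distr \<nu> borel (\<lambda>y. 2 * R * y - R)"
  have meas: "(\<lambda>y. 2 * R * y - R) \<in> \<nu> \<rightarrow>\<^sub>M borel" by measurable
  have poly: "(2 * R * y - R) ^ m = poly ([:-R, 2 * R:] ^ m) y" for y m by (simp add: algebra_simps)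
  have "integrable \<mu> (\<lambda>x. x ^ m) \<and> (\<integral>x. x ^ m \<partial>\<mu>) = L ([:0, 1:] ^ m)" for m
  proof
    show "integrable \<mu> (\<lambda>x. x ^ m)"
      unfolding \<mu>_def by (subst integrable_distr_eq[OF meas], measurable) (simp only: poly integrable_poly[OF \<nu>(2)])
    have "(\<integral>x. x ^ m \<partial>\<mu>) = (\<integral>y. (2 * R * y - R) ^ m \<partial>\<nu>)"
      unfolding \<mu>_def by (rule integral_distr[OF meas]) auto
    also have "\<dots> = L' ([:-R, 2 * R:] ^ m)"
      unfolding poly by (rule integral_poly_moments[OF lin \<nu>(2,3)])
    also have "\<dots> = L ([:0, 1:] ^ m)"
      using \<open>0 < R\<close> by (simp add: L'_def pcompose_power pcompose_pCons)
    finally show "(\<integral>x. x ^ m \<partial>\<mu>) = L ([:0, 1:] ^ m)" .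
  qed
  moreover have "real_distribution \<mu>" unfolding \<mu>_def by (rule \<nu>.real_distribution_distr[OF meas])
  ultimately show ?thesis by blast
qed

text \<open>The partial sums \<open>S n\<close> depend on the moments only and converge to both
  characteristic functions. They stop at even degree so that the absolute moment in the Taylor error
  is an ordinary moment; the factorial then beats its geometric growth.\<close>

lemma real_distribution_eq_moments:
  assumes "real_distribution \<mu>" "real_distribution \<nu>"
    and int: "\<And>m. integrable \<mu> (\<lambda>x. x ^ m)" "\<And>m. integrable \<nu> (\<lambda>x. x ^ m)"
    and eq: "\<And>m. (\<integral>x. x ^ m \<partial>\<mu>) = (\<integral>x. x ^ m \<partial>\<nu>)"
    and bound: "\<And>m. (\<integral>x. x ^ (2 * m) \<partial>\<mu>) \<le> R ^ (2 * m)"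
  shows "\<mu> = \<nu>"
proof (rule Levy_uniqueness[OF assms(1,2)], rule ext)
  fix s :: real
  define S where "S n = (\<Sum>k \<le> 2 * n. ((\<i> * s) ^ k / fact k) * (\<integral>x. x ^ k \<partial>\<mu>))" for n
  have lim: "S \<longlonglongrightarrow> char \<rho> s"
    if \<rho>: "real_distribution \<rho>" "\<And>m. integrable \<rho> (\<lambda>x. x ^ m)" "\<And>m. (\<integral>x. x ^ m \<partial>\<rho>) = (\<integral>x. x ^ m \<partial>\<mu>)" for \<rho>
  proof -
    interpret \<rho>: real_distribution \<rho> by fact
    have "norm (S n - char \<rho> s) \<le> 2 * ((\<bar>s\<bar> * R) ^ (2 * n) / fact (2 * n))" for n
    proof -
      have "norm (S n - char \<rho> s) \<le> (2 * \<bar>s\<bar> ^ (2 * n) / fact (2 * n)) * (\<integral>x. \<bar>x\<bar> ^ (2 * n) \<partial>\<rho>)"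
        using \<rho>.char_approx1[of "2 * n" s] \<rho>(2,3) by (simp add: S_def norm_minus_commute)
      also have "\<dots> = (2 * \<bar>s\<bar> ^ (2 * n) / fact (2 * n)) * (\<integral>x. x ^ (2 * n) \<partial>\<mu>)"
        using \<rho>(3)[of "2 * n"] by (simp only: power_even_abs[OF dvd_triv_left])
      also have "\<dots> \<le> (2 * \<bar>s\<bar> ^ (2 * n) / fact (2 * n)) * R ^ (2 * n)"
        by (rule mult_left_mono[OF bound]) simp
      finally show ?thesis by (simp add: power_mult_distrib)
    qed
    moreover have "(\<lambda>n. 2 * ((\<bar>s\<bar> * R) ^ (2 * n) / fact (2 * n))) \<longlonglongrightarrow> 0"
    proof -
      have "(\<lambda>n. (\<bar>s\<bar> * R) ^ n / fact n) \<longlonglongrightarrow> 0" 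
        using summable_LIMSEQ_zero[OF summable_exp[of "\<bar>s\<bar> * R"]] by (simp add: field_simps)
      from LIMSEQ_subseq_LIMSEQ[OF this, of "\<lambda>n. 2 * n"]
      show ?thesis by (intro tendsto_mult_right_zero) (simp add: o_def strict_mono_def)
    qed
    ultimately have "(\<lambda>n. S n - char \<rho> s) \<longlonglongrightarrow> 0"
      by (intro Lim_null_comparison[of "\<lambda>n. S n - char \<rho> s"]) auto
    then show ?thesis by (rule LIM_zero_cancel)
  qed
  show "char \<mu> s = char \<nu> s"
    by (rule LIMSEQ_unique[OF lim lim]) (use assms in auto)
qed

section \<open>The distribution of the Gaussian element\<close>

context qt_param
begin

definition vacuum_functional :: "'a::real_inner \<Rightarrow> real poly \<Rightarrow> real" where
  "vacuum_functional h p = Re (qt_inner q t vacuum (poly_apply (fock_gaussian h) p vacuum))"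

lemma linear_functional_vacuum: "linear_functional (vacuum_functional h)"
  by unfold_locales
    (simp_all add: vacuum_functional_def poly_apply_add poly_apply_smult qt_inner_add_right qt_inner_scale_right)

lemma vacuum_functional_mult:
  "vacuum_functional h (p * r) =
     Re (qt_inner q t (poly_apply (fock_gaussian h) p vacuum) (poly_apply (fock_gaussian h) r vacuum))"
  by (simp add: vacuum_functional_def poly_apply_mult[OF fock_linear_gaussian] qt_inner_poly_gaussian)

lemma qt_inner_vacuum_vacuum: "qt_inner q t vacuum (vacuum :: 'a::real_inner fock) = 1"
  by (simp add: qt_inner_tensor word_kernel_Nil)

lemma vacuum_functional_1: "vacuum_functional h 1 = 1"
  by (simp add: vacuum_functional_def qt_inner_vacuum_vacuum)

lemma vacuum_state_functional:
  "vacuum_state q t (qt_gaussian q t h ^^ n) = of_real (vacuum_functional h ([:0, 1:] ^ n))"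
  by (simp add: vacuum_state_gaussian_path_weight vacuum_functional_def qt_inner_vacuum_gaussian
      poly_apply_X_power[OF fock_linear_gaussian])

text \<open>Twice \<open>create_const h\<close> bounds the sum of annihilation and creation; the
  added 1 keeps the radius positive even for h = 0, as the rescaling of the interval
  requires.\<close>

definition gaussian_radius :: "'a::real_inner \<Rightarrow> real" where
  "gaussian_radius h = 2 * create_const h + 1"

lemma gaussian_radius_pos: "0 < gaussian_radius h"
  using create_const_nonneg[of h] by (simp add: gaussian_radius_def)

lemma fock_gaussian_radius: "qt_norm q t (fock_gaussian h \<xi>) \<le> gaussian_radius h * qt_norm q t \<xi>"
  using fock_gaussian_bound[of h \<xi>] by (simp add: gaussian_radius_def distrib_right) (smt (verit) qt_norm_nonneg)

text \<open>By symmetry of the Gaussian element, an even moment is the squared norm of its n-th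
  power applied to the vacuum.\<close>

lemma vacuum_functional_moment_bound:
  "vacuum_functional h ([:0, 1:] ^ (2 * n)) \<le> gaussian_radius h ^ (2 * n)"
proof -
  let ?s = "fock_gaussian h" and ?R = "gaussian_radius h"
  have "qt_norm q t ((?s ^^ n) vacuum) \<le> ?R ^ n"
  proof (induction n)
    case 0
    show ?case by (simp add: qt_norm_def qt_inner_vacuum_vacuum)
  next
    case (Suc n)
    have "qt_norm q t ((?s ^^ Suc n) vacuum) \<le> ?R * qt_norm q t ((?s ^^ n) vacuum)"
      using fock_gaussian_radius by simp
    also have "\<dots> \<le> ?R * ?R ^ n" using gaussian_radius_pos[of h] by (intro mult_left_mono Suc) auto
    finally show ?case by simp
  qed
  then have "(qt_norm q t ((?s ^^ n) vacuum))\<^sup>2 \<le> (?R ^ n)\<^sup>2" by (rule power_mono) simp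
  moreover have "vacuum_functional h ([:0, 1:] ^ (2 * n)) = (qt_norm q t ((?s ^^ n) vacuum))\<^sup>2"
    by (simp only: mult_2 power_add vacuum_functional_mult poly_apply_X_power[OF fock_linear_gaussian] qt_norm_square)
  ultimately show ?thesis by (simp add: power_mult[symmetric] mult.commute)
qed

text \<open>\<open>(R + x)\<^sup>k (R - x)\<^sup>l\<close> is a square times \<open>1\<close>, \<open>R \<plusminus> x\<close> or \<open>R\<^sup>2 - x\<^sup>2\<close>, so that positivity
  only needs \<open>\<parallel>s\<parallel> \<le> R\<close>.\<close>

lemma vacuum_functional_interval_nonneg:
  "0 \<le> vacuum_functional h ([:gaussian_radius h, 1:] ^ k * [:gaussian_radius h, -1:] ^ l)"
proof -
  let ?s = "fock_gaussian h" and ?R = "gaussian_radius h"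
  let ?u = "[:?R, 1:]" and ?v = "[:?R, -1:]"
  define p where "p = ?u ^ (k div 2) * ?v ^ (l div 2)"
  define w where "w = ?u ^ (k mod 2) * ?v ^ (l mod 2)"
  define \<eta> where "\<eta> = poly_apply ?s p vacuum"
  have "?u ^ k = (?u ^ (k div 2)) * (?u ^ (k div 2)) * ?u ^ (k mod 2)"
    "?v ^ l = (?v ^ (l div 2)) * (?v ^ (l div 2)) * ?v ^ (l mod 2)"
    by (metis power_add mult_2 mult_div_mod_eq)+
  then have "?u ^ k * ?v ^ l = p * (w * p)" unfolding p_def w_def by (simp only: mult_ac)
  then have eq: "vacuum_functional h (?u ^ k * ?v ^ l) = Re (qt_inner q t \<eta> (poly_apply ?s w \<eta>))"
    by (simp only: vacuum_functional_mult poly_apply_mult[OF fock_linear_gaussian] \<eta>_def)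
  have "\<bar>Re (qt_inner q t \<eta> (?s \<eta>))\<bar> \<le> qt_norm q t \<eta> * qt_norm q t (?s \<eta>)"
    using qt_Cauchy_Schwarz[of \<eta> "?s \<eta>"] abs_Re_le_cmod order_trans by blast
  also have "\<dots> \<le> qt_norm q t \<eta> * (?R * qt_norm q t \<eta>)"
    by (rule mult_left_mono[OF fock_gaussian_radius]) simp
  also have "\<dots> = ?R * Re (qt_inner q t \<eta> \<eta>)"
    by (simp add: qt_norm_square[symmetric] power2_eq_square)
  finally have first: "\<bar>Re (qt_inner q t \<eta> (?s \<eta>))\<bar> \<le> ?R * Re (qt_inner q t \<eta> \<eta>)" .
  have "(qt_norm q t (?s \<eta>))\<^sup>2 \<le> (?R * qt_norm q t \<eta>)\<^sup>2"
    by (rule power_mono[OF fock_gaussian_radius]) simp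
  then have second: "Re (qt_inner q t \<eta> (?s (?s \<eta>))) \<le> ?R * (?R * Re (qt_inner q t \<eta> \<eta>))"
    by (simp add: power_mult_distrib qt_norm_square qt_inner_gaussian) (simp add: power2_eq_square)
  note simps = poly_apply_pCons[OF fock_linear_gaussian] poly_apply_mult[OF fock_linear_gaussian]
    qt_inner_add_right qt_inner_scale_right fock_linear_0[OF fock_linear_gaussian]
    fock_linearD[OF fock_linear_gaussian] fock_linear_diff[OF fock_linear_gaussian] qt_inner_diff_right
  have "k mod 2 = 0 \<or> k mod 2 = 1" "l mod 2 = 0 \<or> l mod 2 = 1" by auto
  then consider "w = 1" | "w = ?u" | "w = ?v" | "w = ?u * ?v" by (auto simp: w_def)
  then have "0 \<le> Re (qt_inner q t \<eta> (poly_apply ?s w \<eta>))"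
  proof cases
    case 1
    then show ?thesis by (simp add: qt_inner_self_ge_0)
  next
    case 2
    show ?thesis unfolding 2 using first by (simp add: simps)
  next
    case 3
    have "poly_apply ?s ?v \<eta> = fock_scale (of_real ?R) \<eta> + fock_scale (-1) (?s \<eta>)"
      by (simp add: simps del: fock.scale_minus_left)
    then show ?thesis unfolding 3 using first by (simp add: simps)
  next
    case 4
    have "poly_apply ?s (?u * ?v) \<eta> =
      fock_scale (of_real (?R * ?R)) \<eta> + fock_scale (-1) (?s (?s \<eta>))"
      unfolding poly_apply_mult[OF fock_linear_gaussian]
      by (simp add: simps fock_linear_uminus[OF fock_linear_gaussian] fock.scale_right_distrib algebra_simps)
    then show ?thesis unfolding 4 using second by (simp add: simps)
  qed
  then show ?thesis unfolding eq .
qed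

section \<open>Hermite polynomials and the distribution\<close>

text \<open>For a unit vector the term subtracted in the Hermite recurrence is exactly the lowered
  term of the Gaussian element on a tensor power, so only the raised power remains.\<close>

lemma poly_apply_hermite:
  assumes "norm h = 1"
  shows "poly_apply (fock_gaussian h) (qt_hermite q t n) vacuum = tensor_power h n"
proof (induction n rule: induct_nat_012)
  case 1
  then show ?case
    using fock_gaussian_tensor_power[of h 0]
    by (simp add: poly_apply_pCons[OF fock_linear_gaussian] fock_linear_0[OF fock_linear_gaussian] tensor_power_0)
next
  case (ge2 n)
  let ?b = "qt_bracket q t (Suc n)"
  have "qt_hermite q t (Suc (Suc n)) = pCons 0 (qt_hermite q t (Suc n)) + smult (- ?b) (qt_hermite q t n)"
    by simp
  then have "poly_apply (fock_gaussian h) (qt_hermite q t (Suc (Suc n))) vacuum =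
    fock_gaussian h (tensor_power h (Suc n)) + fock_scale (of_real (- ?b)) (tensor_power h n)"
    by (simp only: poly_apply_add poly_apply_smult poly_apply_pCons[OF fock_linear_gaussian] ge2
        of_real_0 fock.scale_zero_left add_0_left)
  then show ?case using assms by (simp add: fock_gaussian_tensor_power)
qed (simp add: tensor_power_0)

lemma vacuum_functional_hermite_mult:
  assumes "norm h = 1" "m \<noteq> n"
  shows "vacuum_functional h (qt_hermite q t m * qt_hermite q t n) = 0"
  using assms
  by (simp add: vacuum_functional_mult poly_apply_hermite tensor_power_def qt_inner_tensor word_kernel_length_neq)

text \<open>Orthogonality to the constant polynomial fixes the integral of every later Hermite
  polynomial, and total mass 1 that of the first. The recurrence then carries multiplication by x
  through, giving all moments.\<close>

lemma orthogonalizes_moments: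
  assumes \<nu>: "real_distribution \<nu>" "orthogonalizes \<nu> (qt_hermite q t)" and h: "norm h = 1"
  shows "integrable \<nu> (\<lambda>x. x ^ m)" "(\<integral>x. x ^ m \<partial>\<nu>) = vacuum_functional h ([:0, 1:] ^ m)"
proof -
  interpret \<nu>: real_distribution \<nu> by fact
  interpret L: linear_functional "vacuum_functional h" by (rule linear_functional_vacuum)
  define S where "S = {p. integrable \<nu> (poly p) \<and> (\<integral>x. poly p x \<partial>\<nu>) = vacuum_functional h p}"
  have S_add: "p + r \<in> S" if "p \<in> S" "r \<in> S" for p r
  proof -
    have "poly (p + r) = (\<lambda>x. poly p x + poly r x)" by auto
    then show ?thesis using that by (simp add: S_def L.add)
  qed
  have S_smult: "smult c p \<in> S" if "p \<in> S" for c p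
  proof -
    have "poly (smult c p) = (\<lambda>x. c * poly p x)" by auto
    then show ?thesis using that by (simp add: S_def L.smult)
  qed
  have H: "qt_hermite q t n \<in> S" for n
  proof (cases "n = 0")
    case True
    moreover have "poly 1 = (\<lambda>_. 1 :: real)" by auto
    ultimately show ?thesis using \<nu>.prob_space by (simp add: S_def vacuum_functional_1)
  next
    case False
    have "integrable \<nu> (\<lambda>x. poly (qt_hermite q t 0) x * poly (qt_hermite q t n) x)"
      "(\<integral>x. poly (qt_hermite q t 0) x * poly (qt_hermite q t n) x \<partial>\<nu>) = 0"
      using \<nu>(2) False unfolding orthogonalizes_def by (metis, metis)
    moreover have "vacuum_functional h (qt_hermite q t 0 * qt_hermite q t n) = 0"
      using vacuum_functional_hermite_mult[OF h, of 0 n] False by simp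
    ultimately show ?thesis by (simp add: S_def)
  qed
  \<comment> \<open>The statement is generalized from n = 0 to all n because one multiplication by x
    leads to both neighbouring indices.\<close>
  have "[:0, 1:] ^ k * qt_hermite q t n \<in> S" for k n
  proof (induction k arbitrary: n)
    case 0
    then show ?case using H by simp
  next
    case (Suc k)
    show ?case
    proof (cases n)
      case 0
      then show ?thesis using Suc.IH[of 1] by (simp add: mult.commute)
    next
      case (Suc n')
      have "[:0, 1:] ^ Suc k * qt_hermite q t n =
        [:0, 1:] ^ k * qt_hermite q t (Suc n) + smult (qt_bracket q t n) ([:0, 1:] ^ k * qt_hermite q t n')"
        unfolding Suc qt_hermite.simps(3) by (simp add: algebra_simps)
      then show ?thesis using S_add[OF Suc.IH S_smult[OF Suc.IH]] by simp
    qed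
  qed
  from this[of m 0] have "[:0, 1:] ^ m \<in> S" by simp
  moreover have "poly ([:0, 1:] ^ m) = (\<lambda>x :: real. x ^ m)" by (simp add: fun_eq_iff)
  ultimately show "integrable \<nu> (\<lambda>x. x ^ m)" "(\<integral>x. x ^ m \<partial>\<nu>) = vacuum_functional h ([:0, 1:] ^ m)"
    by (simp_all add: S_def)
qed

text \<open>Being the distribution and orthogonalizing the Hermite polynomials both force the
  moments given by \<open>vacuum_functional h\<close>, and the one measure with these moments has
  both properties.\<close>

lemma gaussian_distribution_unique:
  assumes h: "norm h = 1"
  shows "\<exists>\<mu>. (\<forall>\<nu>. is_distribution q t (qt_gaussian q t h) \<nu> \<longleftrightarrow> \<nu> = \<mu>) \<and>
    (\<forall>\<nu>. real_distribution \<nu> \<and> orthogonalizes \<nu> (qt_hermite q t) \<longleftrightarrow> \<nu> = \<mu>)"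
proof -
  note lin = linear_functional_vacuum[of h]
  obtain \<mu> where \<mu>: "real_distribution \<mu>" "\<And>m. integrable \<mu> (\<lambda>x. x ^ m)"
    "\<And>m. (\<integral>x. x ^ m \<partial>\<mu>) = vacuum_functional h ([:0, 1:] ^ m)"
    using Hausdorff_moment_interval[OF lin vacuum_functional_1 gaussian_radius_pos[of h]
        vacuum_functional_interval_nonneg] by blast
  have unique: "\<nu> = \<mu>" if \<nu>: "real_distribution \<nu>" "\<And>m. integrable \<nu> (\<lambda>x. x ^ m)"
    "\<And>m. (\<integral>x. x ^ m \<partial>\<nu>) = vacuum_functional h ([:0, 1:] ^ m)" for \<nu>
    using real_distribution_eq_moments[OF \<mu>(1) \<nu>(1) \<mu>(2) \<nu>(2), of "gaussian_radius h"] \<mu>(3) \<nu>(3)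
      vacuum_functional_moment_bound[of h] by simp
  have "is_distribution q t (qt_gaussian q t h) \<mu>"
    using \<mu> by (simp add: is_distribution_def vacuum_state_functional)
  moreover have "\<nu> = \<mu>" if "is_distribution q t (qt_gaussian q t h) \<nu>" for \<nu>
    using that by (intro unique) (simp_all add: is_distribution_def vacuum_state_functional)
  moreover have "orthogonalizes \<mu> (qt_hermite q t)"
    unfolding orthogonalizes_def poly_mult[symmetric]
    using integrable_poly[OF \<mu>(2)] vacuum_functional_hermite_mult[OF h]
    by (simp add: integral_poly_moments[OF lin \<mu>(2,3)] del: poly_mult)
  moreover have "\<nu> = \<mu>" if "real_distribution \<nu>" "orthogonalizes \<nu> (qt_hermite q t)" for \<nu>
    using that orthogonalizes_moments[OF that h] by (intro unique)
  ultimately show ?thesis using \<mu>(1) by (intro exI[of _ \<mu>]) blast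
qed

lemma qt_bracket_closed: "qt_bracket q t n = (t ^ n - q ^ n) / (t - q)"
proof -
  have "(t - q) * qt_bracket q t n = t ^ n - q ^ n"
  proof (induction n)
    case (Suc n)
    have "(t - q) * qt_bracket q t (Suc n) = (t - q) * t ^ n + q * ((t - q) * qt_bracket q t n)"
      by (simp add: qt_bracket_Suc algebra_simps)
    then show ?case unfolding Suc by (simp add: algebra_simps)
  qed simp
  then show ?thesis using abs_q_less_t by (simp add: field_simps)
qed

end

text \<open>The sort of \<open>'a\<close> combines an inner product with completeness and second
  countability, that is, a real separable Hilbert space. Odd moments start at n = 1 because
  \<open>2 * n - 1\<close> is truncated to 0 at n = 0, where the moment is 1.\<close>

theorem mainTheorem3:
  fixes q t :: real and h :: "'a::{real_inner, polish_space}"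
  assumes "\<bar>q\<bar> < t" and "t \<le> 1"
  shows "self_adjoint q t (qt_gaussian q t h) \<and>
    (\<forall>n\<ge>1. vacuum_state q t (qt_gaussian q t h ^^ (2 * n - 1)) = 0) \<and>
    (\<forall>n. vacuum_state q t (qt_gaussian q t h ^^ (2 * n)) =
      complex_of_real (norm h ^ (2 * n) *
        (\<Sum>V\<in>pair_partitions (2 * n). q ^ crossings V * t ^ nestings V))) \<and>
    (\<forall>n. norm h ^ (2 * n) *
        (\<Sum>V\<in>pair_partitions (2 * n). q ^ crossings V * t ^ nestings V) =
      norm h ^ (2 * n) * fps_nth (qt_cfrac q t) n) \<and>
    (\<forall>n. qt_bracket q t n = (t ^ n - q ^ n) / (t - q)) \<and>
    (\<forall>e :: 'a. norm e = 1 \<longrightarrow>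
      (\<exists>\<mu>. (\<forall>\<nu>. is_distribution q t (qt_gaussian q t e) \<nu> \<longleftrightarrow> \<nu> = \<mu>) \<and>
           (\<forall>\<nu>. real_distribution \<nu> \<and> orthogonalizes \<nu> (qt_hermite q t) \<longleftrightarrow> \<nu> = \<mu>)))"
proof -
  interpret qt_param q t by unfold_locales fact+
  have "vacuum_state q t (qt_gaussian q t h ^^ (2 * n - 1)) = 0" if "n \<ge> 1" for n
    using path_weight_parity[of "2 * n - 1" 0] that by (simp add: vacuum_state_gaussian_path_weight)
  then show ?thesis
    by (intro conjI allI impI qt_gaussian_self_adjoint gaussian_distribution_unique qt_bracket_closed)
      (simp_all add: vacuum_state_gaussian_path_weight pair_partitions_path_weight path_weight_qt_cfrac)
qed

end
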